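(* Let $(M,g)$ be a pseudo-Riemannian manifold, let $\nabla$ be a linear connection on $M$, let $J$ be an arbitrary $g$-symmetric endomorphism of the tangent bundle $TM$, and let $p,q$ be any real numbers. Let $\check J$ and $\check g$ be the endomorphism and the metric on $TM\oplus T^*M$ determined by $(J,g)$ and $p,q$ as in the context, and let $\Psi^\nabla:TM\oplus T^*M\to T(TM)$ be the isomorphism determined by $\nabla$ and $g$. Define $\bar J:T(TM)\to T(TM)$ and $\bar g$ on the manifold $TM$ by $$\bar J:=\Psi^\nabla\circ\check J\circ(\Psi^\nabla)^{-1},\qquad \bar g:=\big((\Psi^\nabla)^{-1}\big)^*(\check g).$$ Then $(TM,\bar J,\bar g)$ is a metallic pseudo-Riemannian manifold.
   Context: A metallic pseudo-Riemannian manifold $(N,F,h)$ is a pseudo-Riemannian manifold $(N,h)$ with a $(1,1)$-tensor field $F$ such that $h(FX,Y)=h(X,FY)$ for all vector fields $X,Y$ and $F^2=pF+qI$ for some real numbers $p,q$. An endomorphism $J$ of $TM$ is $g$-symmetric if $g(JX,Y)=g(X,JY)$ for all $X,Y$. Let $\flat_g:TM\to T^*M$, $\flat_g(X)=g(X,\cdot)$, $\sharp_g:=\flat_g^{-1}$, and $(J^*\alpha)(X):=\alpha(JX)$. For vector fields $X,Y$ and 1-forms $\alpha,\beta$ on $M$ define $$\check J(X+\alpha):=JX+(-J^2+pJ+qI)(\sharp_g\alpha)+\flat_g(X)-J^*\alpha+p\alpha,$$ $$\check g(X+\alpha,Y+\beta):=g(X,Y)+\frac{p^2+4q}{4}g(\sharp_g\alpha,\sharp_g\beta)+\frac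 p4\big(\alpha(Y)+\beta(X)\big)-\frac12\big(\alpha(JY)+\beta(JX)\big).$$ Let $\pi:TM\to M$ be the projection. The connection $\nabla$ gives the splitting $T(TM)=T^H(TM)\oplus T^V(TM)$ into horizontal and vertical subbundles. For $a\in TM$, let $X^H_a\in T_a(TM)$ be the horizontal lift of $X\in T_{\pi(a)}M$ and let $\chi_a$ be the standard identification of $T_{\pi(a)}M$ with its tangent space $T_a(T_{\pi(a)}M)$. The bundle morphism $\Psi^\nabla$ is given at each $a\in TM$ by the linear isomorphism $T_{\pi(a)}M\oplus T^*_{\pi(a)}M\to T_a(TM)$, $\Psi^\nabla(X+\alpha):=X^H_a+\chi_a(\sharp_g\alpha)$; the formulas for $\bar J,\bar g$ are understood pointwise at each $a\in TM$ via this isomorphism.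
   Formalization: The formal statement assumes that $\check g$ is nondegenerate on each fibre of $TM\oplus T^*M$; for arbitrary $J,p,q$ this can fail (e.g. $M=\mathbb R$, $g=dx^2$, $J=2I$, $p=0$, $q=1$), and then $\bar g$ is not a metric. *)

theory Defs
  imports "HOL-Analysis.Analysis" "HOL-Library.Function_Algebras"
begin

section \<open>Linear algebra on functions and on subspaces\<close>

text \<open>Tangent vectors and covectors below are functions; they carry the pointwise vector space
  structure.\<close>

instantiation "fun" :: (type, real_vector) real_vector
begin

definition scaleR_fun :: "real \<Rightarrow> ('a \<Rightarrow> 'b) \<Rightarrow> 'a \<Rightarrow> 'b"
  where "scaleR_fun r f = (\<lambda>x. r *\<^sub>R f x)"

instance
  by standard (simp_all add: scaleR_fun_def fun_eq_iff algebra_simps)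

end

lemma scaleR_fun_apply [simp]: "(r *\<^sub>R f) x = r *\<^sub>R f x"
  by (simp add: scaleR_fun_def)

definition linear_map_on :: "'a::real_vector set \<Rightarrow> ('a \<Rightarrow> 'b::real_vector) \<Rightarrow> bool"
  where "linear_map_on V f \<longleftrightarrow>
    (\<forall>v\<in>V. \<forall>w\<in>V. f (v + w) = f v + f w) \<and> (\<forall>r. \<forall>v\<in>V. f (r *\<^sub>R v) = r *\<^sub>R f v)"

definition scalar_product_on :: "'a::real_vector set \<Rightarrow> ('a \<Rightarrow> 'a \<Rightarrow> real) \<Rightarrow> bool"
  where "scalar_product_on V b \<longleftrightarrow>
    (\<forall>v\<in>V. linear_map_on V (b v)) \<and>
    (\<forall>v\<in>V. \<forall>w\<in>V. b v w = b w v) \<and>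
    (\<forall>v\<in>V. (\<forall>w\<in>V. b v w = 0) \<longrightarrow> v = 0)"

section \<open>Smooth maps between Euclidean spaces\<close>

primrec Ck_on :: "nat \<Rightarrow> 'a::euclidean_space set \<Rightarrow> ('a \<Rightarrow> 'b::real_normed_vector) \<Rightarrow> bool"
  where
    "Ck_on 0 S f \<longleftrightarrow> continuous_on S f"
  | "Ck_on (Suc k) S f \<longleftrightarrow>
      (\<forall>x\<in>S. f differentiable at x) \<and> (\<forall>v. Ck_on k S (\<lambda>x. frechet_derivative f (at x) v))"

text \<open>Only meant for open \<open>S\<close>.\<close>

definition smooth_on :: "'a::euclidean_space set \<Rightarrow> ('a \<Rightarrow> 'b::real_normed_vector) \<Rightarrow> bool"
  where "smooth_on S f \<longleftrightarrow> (\<forall>k. Ck_on k S f)"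

section \<open>Smooth manifolds\<close>

text \<open>A chart is a pair of its domain and the coordinate map, whose values outside the domain are
  irrelevant. A manifold is given by a (not necessarily maximal) smooth atlas, which determines the
  underlying set and the topology.\<close>

type_synonym ('m, 'e) chart = "'m set \<times> ('m \<Rightarrow> 'e)"

abbreviation chart_dom :: "('m, 'e) chart \<Rightarrow> 'm set"
  where "chart_dom c \<equiv> fst c"

abbreviation chart_map :: "('m, 'e) chart \<Rightarrow> 'm \<Rightarrow> 'e"
  where "chart_map c \<equiv> snd c"

definition chart_inv :: "('m, 'e) chart \<Rightarrow> 'e \<Rightarrow> 'm"
  where "chart_inv c = inv_into (chart_dom c) (chart_map c)"

definition points :: "('m, 'e) chart set \<Rightarrow> 'm set"
  where "points A = (\<Union>c\<in>A. chart_dom c)"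

definition charts_at :: "('m, 'e) chart set \<Rightarrow> 'm \<Rightarrow> ('m, 'e) chart set"
  where "charts_at A x = {c \<in> A. x \<in> chart_dom c}"

definition atlas_topology :: "('m, 'e::euclidean_space) chart set \<Rightarrow> 'm topology"
  where "atlas_topology A =
    topology (\<lambda>W. W \<subseteq> points A \<and> (\<forall>c\<in>A. open (chart_map c ` (W \<inter> chart_dom c))))"

definition smooth_atlas :: "('m, 'e::euclidean_space) chart set \<Rightarrow> bool"
  where "smooth_atlas A \<longleftrightarrow>
    (\<forall>c\<in>A. inj_on (chart_map c) (chart_dom c)) \<and>
    (\<forall>c\<in>A. \<forall>d\<in>A. open (chart_map c ` (chart_dom c \<inter> chart_dom d)) \<and>
      smooth_on (chart_map c ` (chart_dom c \<inter> chart_dom d)) (chart_map d \<circ> chart_inv c))"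

lemma openin_atlas_topology:
  assumes "smooth_atlas A"
  shows "openin (atlas_topology A) W \<longleftrightarrow>
    W \<subseteq> points A \<and> (\<forall>c\<in>A. open (chart_map c ` (W \<inter> chart_dom c)))"
proof -
  let ?P = "\<lambda>W. W \<subseteq> points A \<and> (\<forall>c\<in>A. open (chart_map c ` (W \<inter> chart_dom c)))"
  have inj: "inj_on (chart_map c) (chart_dom c)" if "c \<in> A" for c
    using assms that by (auto simp: smooth_atlas_def)
  have "?P (S \<inter> T)" if S: "?P S" and T: "?P T" for S T
  proof (intro conjI ballI)
    show "S \<inter> T \<subseteq> points A" using S by auto
  next
    fix c assume c: "c \<in> A"
    have "chart_map c ` (S \<inter> T \<inter> chart_dom c) =
        chart_map c ` (S \<inter> chart_dom c) \<inter> chart_map c ` (T \<inter> chart_dom c)"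
      using inj[OF c] by (auto simp: inj_on_def)
    then show "open (chart_map c ` (S \<inter> T \<inter> chart_dom c))"
      using S T c by auto
  qed
  moreover have "?P (\<Union>K)" if K: "\<forall>S\<in>K. ?P S" for K
  proof (intro conjI ballI)
    show "\<Union>K \<subseteq> points A" using K by auto
  next
    fix c assume c: "c \<in> A"
    have "chart_map c ` (\<Union>K \<inter> chart_dom c) = (\<Union>S\<in>K. chart_map c ` (S \<inter> chart_dom c))"
      by auto
    then show "open (chart_map c ` (\<Union>K \<inter> chart_dom c))"
      using K c by auto
  qed
  ultimately have "istopology ?P"
    unfolding istopology_def by blast
  then show ?thesis
    by (simp add: atlas_topology_def)
qed

definition smooth_manifold :: "('m, 'e::euclidean_space) chart set \<Rightarrow> bool"
  where "smooth_manifold A \<longleftrightarrow>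
    smooth_atlas A \<and> Hausdorff_space (atlas_topology A) \<and> second_countable (atlas_topology A)"

section \<open>Tangent vectors and the tangent bundle\<close>

text \<open>A tangent vector at \<open>x\<close> assigns to each chart around \<open>x\<close> its components, which transform by
  the derivative of the coordinate change; it is 0 on everything that is not a chart around \<open>x\<close>.
  In particular the tangent space is \<open>{0}\<close> outside the manifold.\<close>

type_synonym ('m, 'e) tvec = "('m, 'e) chart \<Rightarrow> 'e"

definition chart_change :: "('m, 'e::euclidean_space) chart \<Rightarrow> ('m, 'e) chart \<Rightarrow> 'm \<Rightarrow> 'e \<Rightarrow> 'e"
  where "chart_change c d x =
    frechet_derivative (chart_map d \<circ> chart_inv c) (at (chart_map c x))"

definition tangent_space :: "('m, 'e::euclidean_space) chart set \<Rightarrow> 'm \<Rightarrow> ('m, 'e) tvec set"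
  where "tangent_space A x = {v.
    (\<forall>c. c \<notin> charts_at A x \<longrightarrow> v c = 0) \<and>
    (\<forall>c\<in>charts_at A x. \<forall>d\<in>charts_at A x. v d = chart_change c d x (v c))}"

text \<open>The vector at \<open>x\<close> with component vector \<open>e\<close> in the chart \<open>c\<close>; for \<open>e\<close> in the standard basis
  this is the coordinate vector field of \<open>c\<close>.\<close>

definition coord_vec ::
    "('m, 'e::euclidean_space) chart set \<Rightarrow> ('m, 'e) chart \<Rightarrow> 'e \<Rightarrow> 'm \<Rightarrow> ('m, 'e) tvec"
  where "coord_vec A c e x = (\<lambda>d. if d \<in> charts_at A x then chart_change c d x e else 0)"

definition cotangent_space ::
    "('m, 'e::euclidean_space) chart set \<Rightarrow> 'm \<Rightarrow> (('m, 'e) tvec \<Rightarrow> real) set"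
  where "cotangent_space A x =
    {\<alpha>. linear_map_on (tangent_space A x) \<alpha> \<and> (\<forall>v. v \<notin> tangent_space A x \<longrightarrow> \<alpha> v = 0)}"

text \<open>A point of the tangent bundle is a pair of a base point and a tangent vector there; the
  bundle projection is \<^const>\<open>fst\<close>.\<close>

definition tangent_chart ::
    "('m, 'e::euclidean_space) chart set \<Rightarrow> ('m, 'e) chart \<Rightarrow> ('m \<times> ('m, 'e) tvec, 'e \<times> 'e) chart"
  where "tangent_chart A c =
    (Sigma (chart_dom c) (tangent_space A), \<lambda>(x, v). (chart_map c x, v c))"

definition tangent_atlas ::
    "('m, 'e::euclidean_space) chart set \<Rightarrow> ('m \<times> ('m, 'e) tvec, 'e \<times> 'e) chart set"
  where "tangent_atlas A = tangent_chart A ` A"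

section \<open>Differentials\<close>

text \<open>For differentiable maps and tangent vectors, the values of \<open>differential\<close> and \<open>vec_deriv\<close> do
  not depend on the chosen chart.\<close>

definition curve_velocity ::
    "('m, 'e::euclidean_space) chart set \<Rightarrow> (real \<Rightarrow> 'm) \<Rightarrow> ('m, 'e) tvec"
  where "curve_velocity A \<gamma> =
    (\<lambda>d. if d \<in> charts_at A (\<gamma> 0) then vector_derivative (chart_map d \<circ> \<gamma>) (at 0) else 0)"

definition differential ::
    "('m, 'e::euclidean_space) chart set \<Rightarrow> ('n, 'f::euclidean_space) chart set \<Rightarrow>
      ('m \<Rightarrow> 'n) \<Rightarrow> 'm \<Rightarrow> ('m, 'e) tvec \<Rightarrow> ('n, 'f) tvec"
  where "differential A B F x v =
    (let c = (SOME c. c \<in> charts_at A x) in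
      (\<lambda>d. if d \<in> charts_at B (F x)
           then frechet_derivative (chart_map d \<circ> F \<circ> chart_inv c) (at (chart_map c x)) (v c)
           else 0))"

definition vec_deriv ::
    "('m, 'e::euclidean_space) chart set \<Rightarrow> 'm \<Rightarrow> ('m, 'e) tvec \<Rightarrow> ('m \<Rightarrow> real) \<Rightarrow> real"
  where "vec_deriv A x v f =
    (let c = (SOME c. c \<in> charts_at A x) in
      frechet_derivative (f \<circ> chart_inv c) (at (chart_map c x)) (v c))"

section \<open>Smooth functions, vector fields, endomorphisms and metrics\<close>

definition smooth_function :: "('m, 'e::euclidean_space) chart set \<Rightarrow> ('m \<Rightarrow> real) \<Rightarrow> bool"
  where "smooth_function A f \<longleftrightarrow>
    (\<forall>c\<in>A. smooth_on (chart_map c ` chart_dom c) (f \<circ> chart_inv c))"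

text \<open>Vector fields vanish outside the manifold, so equality of vector fields is equality of
  functions.\<close>

definition vector_fields ::
    "('m, 'e::euclidean_space) chart set \<Rightarrow> ('m \<Rightarrow> ('m, 'e) tvec) set"
  where "vector_fields A = {X.
    (\<forall>x. X x \<in> tangent_space A x) \<and>
    (\<forall>c\<in>A. smooth_on (chart_map c ` chart_dom c) (\<lambda>u. X (chart_inv c u) c))}"

definition tangent_endomorphism ::
    "('m, 'e::euclidean_space) chart set \<Rightarrow> ('m \<Rightarrow> ('m, 'e) tvec \<Rightarrow> ('m, 'e) tvec) \<Rightarrow> bool"
  where "tangent_endomorphism A J \<longleftrightarrow>
    (\<forall>x\<in>points A. linear_map_on (tangent_space A x) (J x) \<and>
      J x ` tangent_space A x \<subseteq> tangent_space A x) \<and>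
    (\<forall>c\<in>A. \<forall>e. smooth_on (chart_map c ` chart_dom c)
      (\<lambda>u. let x = chart_inv c u in J x (coord_vec A c e x) c))"

definition pseudo_riemannian_metric ::
    "('m, 'e::euclidean_space) chart set \<Rightarrow> ('m \<Rightarrow> ('m, 'e) tvec \<Rightarrow> ('m, 'e) tvec \<Rightarrow> real) \<Rightarrow> bool"
  where "pseudo_riemannian_metric A g \<longleftrightarrow>
    (\<forall>x\<in>points A. scalar_product_on (tangent_space A x) (g x)) \<and>
    (\<forall>c\<in>A. \<forall>e e'. smooth_on (chart_map c ` chart_dom c)
      (\<lambda>u. let x = chart_inv c u in g x (coord_vec A c e x) (coord_vec A c e' x)))"

definition pseudo_riemannian_manifold ::
    "('m, 'e::euclidean_space) chart set \<Rightarrow> ('m \<Rightarrow> ('m, 'e) tvec \<Rightarrow> ('m, 'e) tvec \<Rightarrow> real) \<Rightarrow> bool"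
  where "pseudo_riemannian_manifold A g \<longleftrightarrow> smooth_manifold A \<and> pseudo_riemannian_metric A g"

definition symmetric_endomorphism ::
    "('m, 'e::euclidean_space) chart set \<Rightarrow> ('m \<Rightarrow> ('m, 'e) tvec \<Rightarrow> ('m, 'e) tvec \<Rightarrow> real) \<Rightarrow>
      ('m \<Rightarrow> ('m, 'e) tvec \<Rightarrow> ('m, 'e) tvec) \<Rightarrow> bool"
  where "symmetric_endomorphism A g J \<longleftrightarrow>
    tangent_endomorphism A J \<and>
    (\<forall>x\<in>points A. \<forall>v\<in>tangent_space A x. \<forall>w\<in>tangent_space A x. g x (J x v) w = g x v (J x w))"

definition metallic_pseudo_riemannian_manifold ::
    "('m, 'e::euclidean_space) chart set \<Rightarrow> ('m \<Rightarrow> ('m, 'e) tvec \<Rightarrow> ('m, 'e) tvec) \<Rightarrow>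
      ('m \<Rightarrow> ('m, 'e) tvec \<Rightarrow> ('m, 'e) tvec \<Rightarrow> real) \<Rightarrow> bool"
  where "metallic_pseudo_riemannian_manifold A F h \<longleftrightarrow>
    pseudo_riemannian_manifold A h \<and> symmetric_endomorphism A h F \<and>
    (\<exists>p q :: real. \<forall>x\<in>points A. \<forall>v\<in>tangent_space A x.
      F x (F x v) = p *\<^sub>R F x v + q *\<^sub>R v)"

section \<open>Linear connections and the isomorphism they determine\<close>

definition linear_connection ::
    "('m, 'e::euclidean_space) chart set \<Rightarrow>
      (('m \<Rightarrow> ('m, 'e) tvec) \<Rightarrow> ('m \<Rightarrow> ('m, 'e) tvec) \<Rightarrow> 'm \<Rightarrow> ('m, 'e) tvec) \<Rightarrow> bool"
  where "linear_connection A D \<longleftrightarrow>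
    (\<forall>X\<in>vector_fields A. \<forall>Y\<in>vector_fields A. D X Y \<in> vector_fields A) \<and>
    (\<forall>X\<in>vector_fields A. \<forall>X'\<in>vector_fields A. \<forall>Y\<in>vector_fields A.
      D (X + X') Y = D X Y + D X' Y) \<and>
    (\<forall>f X Y. smooth_function A f \<longrightarrow> X \<in> vector_fields A \<longrightarrow> Y \<in> vector_fields A \<longrightarrow>
      D (\<lambda>x. f x *\<^sub>R X x) Y = (\<lambda>x. f x *\<^sub>R D X Y x)) \<and>
    (\<forall>X\<in>vector_fields A. \<forall>Y\<in>vector_fields A. \<forall>Y'\<in>vector_fields A.
      D X (Y + Y') = D X Y + D X Y') \<and>
    (\<forall>f X Y. smooth_function A f \<longrightarrow> X \<in> vector_fields A \<longrightarrow> Y \<in> vector_fields A \<longrightarrow>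
      D X (\<lambda>x. f x *\<^sub>R Y x) = (\<lambda>x. vec_deriv A x (X x) f *\<^sub>R Y x + f x *\<^sub>R D X Y x))"

text \<open>The horizontal subspace at \<open>a\<close> consists of the derivatives, in directions \<open>X\<close>, of those vector
  fields \<open>Y\<close> through \<open>a\<close> (regarded as maps into the tangent bundle) that satisfy \<open>D X Y = 0\<close> at the
  base point of \<open>a\<close>.\<close>

definition horizontal_space ::
    "('m, 'e::euclidean_space) chart set \<Rightarrow>
      (('m \<Rightarrow> ('m, 'e) tvec) \<Rightarrow> ('m \<Rightarrow> ('m, 'e) tvec) \<Rightarrow> 'm \<Rightarrow> ('m, 'e) tvec) \<Rightarrow>
      'm \<times> ('m, 'e) tvec \<Rightarrow> ('m \<times> ('m, 'e) tvec, 'e \<times> 'e) tvec set"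
  where "horizontal_space A D a =
    {differential A (tangent_atlas A) (\<lambda>x. (x, Y x)) (fst a) (X (fst a)) | X Y.
      X \<in> vector_fields A \<and> Y \<in> vector_fields A \<and> Y (fst a) = snd a \<and> D X Y (fst a) = 0}"

definition horizontal_lift ::
    "('m, 'e::euclidean_space) chart set \<Rightarrow>
      (('m \<Rightarrow> ('m, 'e) tvec) \<Rightarrow> ('m \<Rightarrow> ('m, 'e) tvec) \<Rightarrow> 'm \<Rightarrow> ('m, 'e) tvec) \<Rightarrow>
      'm \<times> ('m, 'e) tvec \<Rightarrow> ('m, 'e) tvec \<Rightarrow> ('m \<times> ('m, 'e) tvec, 'e \<times> 'e) tvec"
  where "horizontal_lift A D a v =
    (THE h. h \<in> horizontal_space A D a \<and> differential (tangent_atlas A) A fst a h = v)"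

definition vertical_lift ::
    "('m, 'e::euclidean_space) chart set \<Rightarrow>
      'm \<times> ('m, 'e) tvec \<Rightarrow> ('m, 'e) tvec \<Rightarrow> ('m \<times> ('m, 'e) tvec, 'e \<times> 'e) tvec"
  where "vertical_lift A a w = curve_velocity (tangent_atlas A) (\<lambda>t. (fst a, snd a + t *\<^sub>R w))"

definition flat ::
    "('m, 'e::euclidean_space) chart set \<Rightarrow> ('m \<Rightarrow> ('m, 'e) tvec \<Rightarrow> ('m, 'e) tvec \<Rightarrow> real) \<Rightarrow>
      'm \<Rightarrow> ('m, 'e) tvec \<Rightarrow> ('m, 'e) tvec \<Rightarrow> real"
  where "flat A g x v = (\<lambda>w. if w \<in> tangent_space A x then g x v w else 0)"

definition sharp ::
    "('m, 'e::euclidean_space) chart set \<Rightarrow> ('m \<Rightarrow> ('m, 'e) tvec \<Rightarrow> ('m, 'e) tvec \<Rightarrow> real) \<Rightarrow>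
      'm \<Rightarrow> (('m, 'e) tvec \<Rightarrow> real) \<Rightarrow> ('m, 'e) tvec"
  where "sharp A g x = inv_into (tangent_space A x) (flat A g x)"

definition dual_endomorphism ::
    "('m, 'e::euclidean_space) chart set \<Rightarrow> ('m \<Rightarrow> ('m, 'e) tvec \<Rightarrow> ('m, 'e) tvec) \<Rightarrow>
      'm \<Rightarrow> (('m, 'e) tvec \<Rightarrow> real) \<Rightarrow> ('m, 'e) tvec \<Rightarrow> real"
  where "dual_endomorphism A J x \<alpha> = (\<lambda>v. if v \<in> tangent_space A x then \<alpha> (J x v) else 0)"

type_synonym ('m, 'e) gvec = "('m, 'e) tvec \<times> (('m, 'e) tvec \<Rightarrow> real)"

definition generalized_tangent_space ::
    "('m, 'e::euclidean_space) chart set \<Rightarrow> 'm \<Rightarrow> ('m, 'e) gvec set"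
  where "generalized_tangent_space A x = tangent_space A x \<times> cotangent_space A x"

definition check_J ::
    "('m, 'e::euclidean_space) chart set \<Rightarrow> ('m \<Rightarrow> ('m, 'e) tvec \<Rightarrow> ('m, 'e) tvec \<Rightarrow> real) \<Rightarrow>
      ('m \<Rightarrow> ('m, 'e) tvec \<Rightarrow> ('m, 'e) tvec) \<Rightarrow> real \<Rightarrow> real \<Rightarrow> 'm \<Rightarrow> ('m, 'e) gvec \<Rightarrow> ('m, 'e) gvec"
  where "check_J A g J p q x = (\<lambda>(v, \<alpha>).
    let z = sharp A g x \<alpha> in
      (J x v + (- J x (J x z) + p *\<^sub>R J x z + q *\<^sub>R z),
       flat A g x v - dual_endomorphism A J x \<alpha> + p *\<^sub>R \<alpha>))"

text \<open>This form can be degenerate, e.g. for \<open>M = \<real>\<close> with the standard metric, \<open>J = 2 id\<close>, \<open>p = 0\<close>,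
  \<open>q = 1\<close>; that it is a metric on the generalized tangent bundle has to be assumed.\<close>

definition check_g ::
    "('m, 'e::euclidean_space) chart set \<Rightarrow> ('m \<Rightarrow> ('m, 'e) tvec \<Rightarrow> ('m, 'e) tvec \<Rightarrow> real) \<Rightarrow>
      ('m \<Rightarrow> ('m, 'e) tvec \<Rightarrow> ('m, 'e) tvec) \<Rightarrow> real \<Rightarrow> real \<Rightarrow>
      'm \<Rightarrow> ('m, 'e) gvec \<Rightarrow> ('m, 'e) gvec \<Rightarrow> real"
  where "check_g A g J p q x = (\<lambda>(v, \<alpha>) (w, \<beta>).
    g x v w + (p\<^sup>2 + 4 * q) / 4 * g x (sharp A g x \<alpha>) (sharp A g x \<beta>)
    + p / 4 * (\<alpha> w + \<beta> v) - 1 / 2 * (\<alpha> (J x w) + \<beta> (J x v)))"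

definition Psi ::
    "('m, 'e::euclidean_space) chart set \<Rightarrow> ('m \<Rightarrow> ('m, 'e) tvec \<Rightarrow> ('m, 'e) tvec \<Rightarrow> real) \<Rightarrow>
      (('m \<Rightarrow> ('m, 'e) tvec) \<Rightarrow> ('m \<Rightarrow> ('m, 'e) tvec) \<Rightarrow> 'm \<Rightarrow> ('m, 'e) tvec) \<Rightarrow>
      'm \<times> ('m, 'e) tvec \<Rightarrow> ('m, 'e) gvec \<Rightarrow> ('m \<times> ('m, 'e) tvec, 'e \<times> 'e) tvec"
  where "Psi A g D a = (\<lambda>(v, \<alpha>).
    horizontal_lift A D a v + vertical_lift A a (sharp A g (fst a) \<alpha>))"

definition Psi_inv ::
    "('m, 'e::euclidean_space) chart set \<Rightarrow> ('m \<Rightarrow> ('m, 'e) tvec \<Rightarrow> ('m, 'e) tvec \<Rightarrow> real) \<Rightarrow>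
      (('m \<Rightarrow> ('m, 'e) tvec) \<Rightarrow> ('m \<Rightarrow> ('m, 'e) tvec) \<Rightarrow> 'm \<Rightarrow> ('m, 'e) tvec) \<Rightarrow>
      'm \<times> ('m, 'e) tvec \<Rightarrow> ('m \<times> ('m, 'e) tvec, 'e \<times> 'e) tvec \<Rightarrow> ('m, 'e) gvec"
  where "Psi_inv A g D a = inv_into (generalized_tangent_space A (fst a)) (Psi A g D a)"

definition bar_J ::
    "('m, 'e::euclidean_space) chart set \<Rightarrow> ('m \<Rightarrow> ('m, 'e) tvec \<Rightarrow> ('m, 'e) tvec \<Rightarrow> real) \<Rightarrow>
      (('m \<Rightarrow> ('m, 'e) tvec) \<Rightarrow> ('m \<Rightarrow> ('m, 'e) tvec) \<Rightarrow> 'm \<Rightarrow> ('m, 'e) tvec) \<Rightarrow>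
      ('m \<Rightarrow> ('m, 'e) tvec \<Rightarrow> ('m, 'e) tvec) \<Rightarrow> real \<Rightarrow> real \<Rightarrow> 'm \<times> ('m, 'e) tvec \<Rightarrow>
      ('m \<times> ('m, 'e) tvec, 'e \<times> 'e) tvec \<Rightarrow> ('m \<times> ('m, 'e) tvec, 'e \<times> 'e) tvec"
  where "bar_J A g D J p q a = Psi A g D a \<circ> check_J A g J p q (fst a) \<circ> Psi_inv A g D a"

definition bar_g ::
    "('m, 'e::euclidean_space) chart set \<Rightarrow> ('m \<Rightarrow> ('m, 'e) tvec \<Rightarrow> ('m, 'e) tvec \<Rightarrow> real) \<Rightarrow>
      (('m \<Rightarrow> ('m, 'e) tvec) \<Rightarrow> ('m \<Rightarrow> ('m, 'e) tvec) \<Rightarrow> 'm \<Rightarrow> ('m, 'e) tvec) \<Rightarrow>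
      ('m \<Rightarrow> ('m, 'e) tvec \<Rightarrow> ('m, 'e) tvec) \<Rightarrow> real \<Rightarrow> real \<Rightarrow> 'm \<times> ('m, 'e) tvec \<Rightarrow>
      ('m \<times> ('m, 'e) tvec, 'e \<times> 'e) tvec \<Rightarrow> ('m \<times> ('m, 'e) tvec, 'e \<times> 'e) tvec \<Rightarrow> real"
  where "bar_g A g D J p q a \<xi> \<eta> =
    check_g A g J p q (fst a) (Psi_inv A g D a \<xi>) (Psi_inv A g D a \<eta>)"

end

theory Submission
  imports Defs
begin

text \<open>In a chart \<open>c\<close> of the base, \<open>(D X Y) c\<close> is the derivative of the components of \<open>Y\<close> plus a
  bilinear Christoffel term, so the horizontal lift of \<open>v\<close> at \<open>(x, y)\<close> has the components
  \<open>(v, - \<Gamma> v y)\<close> and the vertical lift of \<open>w\<close> the components \<open>(0, w)\<close>. Hence every tangent vector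
  of the bundle is \<open>v\<^sup>H + w\<^sup>V\<close> for unique \<open>v\<close> and \<open>w\<close>, and \<open>Psi\<close> maps \<open>v + \<flat>w\<close> to it.
  Because \<open>J\<close> is symmetric, \<open>J\<^sup>* (\<flat>w) = \<flat>(J w)\<close>, and the structures become
  \<open>v\<^sup>H + w\<^sup>V \<mapsto> (J v - J (J w) + p J w + q w)\<^sup>H + (v - J w + p w)\<^sup>V\<close> and a polynomial expression in
  \<open>g\<close> and \<open>J\<close>. In this form no inverse of the metric occurs, so smoothness only needs sums, products
  and compositions, and the algebraic identities are direct computations.\<close>

section \<open>Calculus of smooth maps\<close>

text \<open>The chart formula for \<open>D\<close> is the costly point. \<open>D\<close> acts on
  global fields only, so its dependence on local data has to be proved with smooth cutoffs that
  extend local data by zero; closedness of their supports uses the Hausdorff property of the base.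
  The same cutoffs supply global fields with prescribed value and derivative at a point. Since
  \<open>horizontal_space\<close> is built from such fields, this is what makes it large enough to
  contain a lift of every vector. The direct computations have a short reason. On pairs (v, w), the
  lifted endomorphism and the lifted form (relative to \<open>g\<close>) are 2x2 matrices over the
  commutative ring of polynomials in \<open>J x\<close>, so the metallic equation becomes
  Cayley-Hamilton and compatibility becomes symmetry of a matrix product. Nondegeneracy of the
  lifted form is the assumption on \<open>check_g\<close>, transported along the linear bijection
  \<open>Psi\<close>.\<close>

lemma Ck_on_cong:
  fixes f g :: "'a::euclidean_space \<Rightarrow> 'b::real_normed_vector"
  assumes "open S" "\<And>x. x \<in> S \<Longrightarrow> f x = g x" "Ck_on k S f"
  shows "Ck_on k S g"
  using assms(2,3)
proof (induction k arbitrary: f g)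
  case 0
  then show ?case by (simp cong: continuous_on_cong)
next
  case (Suc k)
  have d: "f differentiable at x" if "x \<in> S" for x using Suc.prems that by simp
  \<comment> \<open>Since \<open>S\<close> is open, equality on \<open>S\<close> is equality near
    each of its points and passes to derivatives; this feeds the induction.\<close>
  have fd: "frechet_derivative f (at x) = frechet_derivative g (at x)" if "x \<in> S" for x
    using frechet_derivative_transform_within_open[OF d[OF that] assms(1) that] Suc.prems(1) by blast
  have "g differentiable at x" if "x \<in> S" for x
    using d[OF that] Suc.prems(1) assms(1) that
    by (metis differentiable_def has_derivative_transform_within_open)
  moreover have "Ck_on k S (\<lambda>x. frechet_derivative g (at x) v)" for v
    by (rule Suc.IH[of "\<lambda>x. frechet_derivative f (at x) v"]) (use fd Suc.prems in auto)
  ultimately show ?case by simp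
qed

text \<open>By uniqueness of derivatives, \<open>frechet_derivative\<close> may be replaced by a
  derivative known in closed form. The calculus rules below all take their induction step through
  this.\<close>

lemma Ck_on_SucI:
  fixes f :: "'a::euclidean_space \<Rightarrow> 'b::real_normed_vector"
  assumes "open S" "\<And>x. x \<in> S \<Longrightarrow> (f has_derivative f' x) (at x)"
    and "\<And>v. Ck_on k S (\<lambda>x. f' x v)"
  shows "Ck_on (Suc k) S f"
proof -
  have "Ck_on k S (\<lambda>x. frechet_derivative f (at x) v)" for v
    by (rule Ck_on_cong[OF assms(1) _ assms(3)[of v]]) (use assms(2) frechet_derivative_at in metis)
  then show ?thesis using assms(2) by (auto simp: differentiable_def)
qed

lemma Ck_on_Suc_has_derivative:
  "Ck_on (Suc k) S f \<Longrightarrow> x \<in> S \<Longrightarrow> (f has_derivative frechet_derivative f (at x)) (at x)"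
  using frechet_derivative_works by auto

lemma Ck_on_Suc_imp: "Ck_on (Suc k) S f \<Longrightarrow> Ck_on k S f"
proof (induction k arbitrary: f)
  case 0
  then show ?case
    by (auto intro!: continuous_at_imp_continuous_on differentiable_imp_continuous_within)
next
  case (Suc k)
  then show ?case by (metis Ck_on.simps(2))
qed

lemma Ck_on_subset: "Ck_on k S f \<Longrightarrow> T \<subseteq> S \<Longrightarrow> Ck_on k T f"
  by (induction k arbitrary: f) (auto intro: continuous_on_subset)

text \<open>The derivative at a point does not depend on the neighbourhood, so the local statements
  concern one and the same derivative function and the induction applies to it. Needed where a
  construction, such as a cutoff, is available only near each point.\<close>

lemma Ck_on_local:
  fixes f :: "'a::euclidean_space \<Rightarrow> 'b::real_normed_vector"
  assumes "\<And>x. x \<in> S \<Longrightarrow> \<exists>T. open T \<and> x \<in> T \<and> Ck_on k T f"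
  shows "Ck_on k S f"
  using assms
proof (induction k arbitrary: f)
  case 0
  have "continuous (at x) f" if "x \<in> S" for x
    using 0[OF that] by (auto simp: continuous_on_eq_continuous_at)
  then show ?case by (simp add: continuous_at_imp_continuous_on)
next
  case (Suc k)
  show ?case
    unfolding Ck_on.simps
  proof (intro conjI ballI allI)
    show "f differentiable at x" if "x \<in> S" for x
      using Suc.prems[OF that] by auto
    show "Ck_on k S (\<lambda>x. frechet_derivative f (at x) v)" for v
      by (rule Suc.IH) (use Suc.prems in fastforce)
  qed
qed

lemma Ck_on_const:
  fixes S :: "'a::euclidean_space set" and a :: "'b::real_normed_vector"
  shows "Ck_on k S (\<lambda>x. a)"
  by (induction k arbitrary: a) auto

lemma Ck_on_bounded_linear:
  assumes "bounded_linear L" shows "Ck_on k S L"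
proof (cases k)
  case 0
  then show ?thesis by (simp add: linear_continuous_on[OF assms])
next
  case (Suc j)
  have "frechet_derivative L (at x) = L" for x
    using frechet_derivative_at bounded_linear_imp_has_derivative[OF assms] by metis
  then show ?thesis
    using Suc bounded_linear_imp_differentiable[OF assms] by (simp add: Ck_on_const)
qed

lemma Ck_on_linear_compose:
  fixes f :: "'a::euclidean_space \<Rightarrow> 'b::real_normed_vector"
  assumes "bounded_linear L" "open S" "Ck_on k S f"
  shows "Ck_on k S (\<lambda>x. L (f x))"
  using assms(3)
proof (induction k arbitrary: f)
  case 0
  then show ?case
    using bounded_linear.continuous_on[OF assms(1)] by auto
next
  case (Suc k)
  show ?case
  proof (rule Ck_on_SucI[OF assms(2)])
    show "((\<lambda>x. L (f x)) has_derivative (\<lambda>v. L (frechet_derivative f (at x) v))) (at x)"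
      if "x \<in> S" for x
      by (rule bounded_linear.has_derivative[OF assms(1)])
        (rule Ck_on_Suc_has_derivative[OF Suc.prems that])
    show "Ck_on k S (\<lambda>x. L (frechet_derivative f (at x) v))" for v
      by (rule Suc.IH) (use Suc.prems in auto)
  qed
qed

lemma Ck_on_add:
  fixes f g :: "'a::euclidean_space \<Rightarrow> 'b::real_normed_vector"
  assumes "open S" "Ck_on k S f" "Ck_on k S g"
  shows "Ck_on k S (\<lambda>x. f x + g x)"
  using assms(2,3)
proof (induction k arbitrary: f g)
  case 0
  then show ?case by (auto intro: continuous_on_add)
next
  case (Suc k)
  show ?case
  proof (rule Ck_on_SucI[OF assms(1)])
    show "((\<lambda>x. f x + g x) has_derivative
        (\<lambda>v. frechet_derivative f (at x) v + frechet_derivative g (at x) v)) (at x)"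
      if "x \<in> S" for x
      by (intro has_derivative_add Ck_on_Suc_has_derivative[OF Suc.prems(1) that]
          Ck_on_Suc_has_derivative[OF Suc.prems(2) that])
    show "Ck_on k S (\<lambda>x. frechet_derivative f (at x) v + frechet_derivative g (at x) v)" for v
      by (rule Suc.IH) (use Suc.prems in auto)
  qed
qed

lemma Ck_on_sum:
  fixes f :: "'i \<Rightarrow> 'a::euclidean_space \<Rightarrow> 'b::real_normed_vector"
  assumes "open S" "\<And>i. i \<in> I \<Longrightarrow> Ck_on k S (f i)"
  shows "Ck_on k S (\<lambda>x. \<Sum>i\<in>I. f i x)"
  using assms(2)
  by (induction I rule: infinite_finite_induct) (auto intro: Ck_on_const Ck_on_add[OF assms(1)])

text \<open>Product rule: each summand of the derivative has one differentiated and one plain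
  factor, so the plain factor is also needed at order \<open>k\<close>.\<close>

lemma Ck_on_bilinear:
  fixes f :: "'a::euclidean_space \<Rightarrow> 'b::real_normed_vector" and g :: "'a \<Rightarrow> 'c::real_normed_vector"
  assumes "bounded_bilinear m" "open S" "Ck_on k S f" "Ck_on k S g"
  shows "Ck_on k S (\<lambda>x. m (f x) (g x))"
  using assms(3,4)
proof (induction k arbitrary: f g)
  case 0
  then show ?case using bounded_bilinear.continuous_on[OF assms(1)] by auto
next
  case (Suc k)
  show ?case
  proof (rule Ck_on_SucI[OF assms(2)])
    show "((\<lambda>x. m (f x) (g x)) has_derivative
        (\<lambda>v. m (f x) (frechet_derivative g (at x) v) + m (frechet_derivative f (at x) v) (g x)))
        (at x)" if "x \<in> S" for x
      by (rule bounded_bilinear.FDERIV[OF assms(1)])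
        (use that Ck_on_Suc_has_derivative Suc.prems in blast)+
    show "Ck_on k S (\<lambda>x. m (f x) (frechet_derivative g (at x) v)
        + m (frechet_derivative f (at x) v) (g x))" for v
      using Suc.prems[THEN Ck_on_Suc_imp] Suc.prems
      by (intro Ck_on_add[OF assms(2)] Suc.IH) simp_all
  qed
qed

text \<open>In the derivative \<open>f' (g x) (g' x v)\<close> both the map and its argument vary
  with \<open>x\<close>. Expanding \<open>g' x v\<close> in the basis leaves a finite sum of
  products whose factors \<open>f' (g x) b\<close> are again compositions with the same
  \<open>g\<close>; hence the induction generalises over \<open>f\<close> only.\<close>

lemma Ck_on_compose:
  fixes f :: "'b::euclidean_space \<Rightarrow> 'c::real_normed_vector" and g :: "'a::euclidean_space \<Rightarrow> 'b"
  assumes "open S" "open T" "g ` S \<subseteq> T" "Ck_on k T f" "Ck_on k S g"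
  shows "Ck_on k S (\<lambda>x. f (g x))"
  using assms(4,5)
proof (induction k arbitrary: f)
  case 0
  then show ?case using assms(3) continuous_on_compose2 by fastforce
next
  case (Suc k)
  let ?f' = "\<lambda>y. frechet_derivative f (at y)" and ?g' = "\<lambda>x. frechet_derivative g (at x)"
  have df: "(f has_derivative ?f' (g x)) (at (g x))" if "x \<in> S" for x
    using that assms(3) by (intro Ck_on_Suc_has_derivative[OF Suc.prems(1)]) auto
  show ?case
  proof (rule Ck_on_SucI[OF assms(1)])
    fix x assume x: "x \<in> S"
    have "((\<lambda>x. f (g x)) has_derivative (\<lambda>v. ?f' (g x) (?g' x v))) (at x)"
      using diff_chain_at[OF Ck_on_Suc_has_derivative[OF Suc.prems(2) x] df[OF x]]
      by (simp add: o_def)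
    also have "(\<lambda>v. ?f' (g x) (?g' x v)) = (\<lambda>v. \<Sum>b\<in>Basis. (?g' x v \<bullet> b) *\<^sub>R ?f' (g x) b)"
    proof
      fix v
      have "?f' (g x) (\<Sum>b\<in>Basis. (?g' x v \<bullet> b) *\<^sub>R b) =
          (\<Sum>b\<in>Basis. (?g' x v \<bullet> b) *\<^sub>R ?f' (g x) b)"
        using has_derivative_linear[OF df[OF x]] by (simp add: linear_sum linear_scale)
      then show "?f' (g x) (?g' x v) = (\<Sum>b\<in>Basis. (?g' x v \<bullet> b) *\<^sub>R ?f' (g x) b)"
        by (simp add: euclidean_representation)
    qed
    finally show "((\<lambda>x. f (g x)) has_derivative
      (\<lambda>v. \<Sum>b\<in>Basis. (?g' x v \<bullet> b) *\<^sub>R ?f' (g x) b)) (at x)" .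
  next
    fix v
    show "Ck_on k S (\<lambda>x. \<Sum>b\<in>Basis. (?g' x v \<bullet> b) *\<^sub>R ?f' (g x) b)"
    proof (intro Ck_on_sum assms(1) Ck_on_bilinear[OF bounded_bilinear_scaleR])
      fix b
      show "Ck_on k S (\<lambda>x. ?g' x v \<bullet> b)"
        using Suc.prems by (intro Ck_on_linear_compose[OF bounded_linear_inner_left assms(1)]) auto
      show "Ck_on k S (\<lambda>x. ?f' (g x) b)"
        by (rule Suc.IH) (use Suc.prems Ck_on_Suc_imp in auto)
    qed
  qed
qed

lemma smooth_on_cong:
  assumes "open S" "\<And>x. x \<in> S \<Longrightarrow> f x = g x" "smooth_on S f" shows "smooth_on S g"
  using assms Ck_on_cong[OF assms(1)] unfolding smooth_on_def by blast

lemma smooth_on_subset: "smooth_on S f \<Longrightarrow> T \<subseteq> S \<Longrightarrow> smooth_on T f"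
  unfolding smooth_on_def using Ck_on_subset by blast

lemma smooth_on_local:
  assumes "\<And>x. x \<in> S \<Longrightarrow> \<exists>T. open T \<and> x \<in> T \<and> smooth_on T f" shows "smooth_on S f"
  using assms Ck_on_local unfolding smooth_on_def by metis

lemma smooth_on_const [intro]: "smooth_on S (\<lambda>x. a)"
  by (simp add: smooth_on_def Ck_on_const)

lemma smooth_on_bounded_linear: "bounded_linear L \<Longrightarrow> smooth_on S L"
  by (simp add: smooth_on_def Ck_on_bounded_linear)

lemma smooth_on_linear_compose:
  "bounded_linear L \<Longrightarrow> open S \<Longrightarrow> smooth_on S f \<Longrightarrow> smooth_on S (\<lambda>x. L (f x))"
  by (simp add: smooth_on_def Ck_on_linear_compose)

lemma smooth_on_add: "open S \<Longrightarrow> smooth_on S f \<Longrightarrow> smooth_on S g \<Longrightarrow> smooth_on S (\<lambda>x. f x + g x)"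
  by (simp add: smooth_on_def Ck_on_add)

lemma smooth_on_scaleR:
  "open S \<Longrightarrow> smooth_on S f \<Longrightarrow> smooth_on S g \<Longrightarrow> smooth_on S (\<lambda>x. f x *\<^sub>R g x)"
  by (simp add: smooth_on_def Ck_on_bilinear[OF bounded_bilinear_scaleR])

lemma smooth_on_mult:
  fixes f g :: "'a::euclidean_space \<Rightarrow> real"
  shows "open S \<Longrightarrow> smooth_on S f \<Longrightarrow> smooth_on S g \<Longrightarrow> smooth_on S (\<lambda>x. f x * g x)"
  by (simp add: smooth_on_def Ck_on_bilinear[OF bounded_bilinear_mult])

lemma smooth_on_inner:
  fixes f g :: "'a::euclidean_space \<Rightarrow> 'b::euclidean_space"
  shows "open S \<Longrightarrow> smooth_on S f \<Longrightarrow> smooth_on S g \<Longrightarrow> smooth_on S (\<lambda>x. f x \<bullet> g x)"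
  by (simp add: smooth_on_def Ck_on_bilinear[OF bounded_bilinear_inner])

lemma smooth_on_diff:
  assumes "open S" "smooth_on S f" "smooth_on S g" shows "smooth_on S (\<lambda>x. f x - g x)"
  using smooth_on_add[OF assms(1,2) smooth_on_linear_compose[OF _ assms(1,3), of uminus]]
  by (simp add: bounded_linear_minus bounded_linear_ident)

lemma smooth_on_sum:
  "open S \<Longrightarrow> (\<And>i. i \<in> I \<Longrightarrow> smooth_on S (f i)) \<Longrightarrow> smooth_on S (\<lambda>x. \<Sum>i\<in>I. f i x)"
  by (simp add: smooth_on_def Ck_on_sum)

lemma smooth_on_Pair:
  fixes f :: "'a::euclidean_space \<Rightarrow> 'b::real_normed_vector" and g :: "'a \<Rightarrow> 'c::real_normed_vector"
  assumes "open S" "smooth_on S f" "smooth_on S g" shows "smooth_on S (\<lambda>x. (f x, g x))"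
proof -
  have "bounded_linear (\<lambda>y::'b. (y, 0::'c))" "bounded_linear (\<lambda>z::'c. (0::'b, z))"
    by (auto intro!: bounded_linear_Pair bounded_linear_ident bounded_linear_zero)
  from smooth_on_add[OF assms(1) smooth_on_linear_compose[OF this(1) assms(1,2)]
      smooth_on_linear_compose[OF this(2) assms(1,3)]]
  show ?thesis by simp
qed

lemma smooth_on_compose:
  "open S \<Longrightarrow> open T \<Longrightarrow> g ` S \<subseteq> T \<Longrightarrow> smooth_on T f \<Longrightarrow> smooth_on S g \<Longrightarrow> smooth_on S (\<lambda>x. f (g x))"
  by (simp add: smooth_on_def Ck_on_compose)

lemma smooth_on_has_derivative:
  "smooth_on S f \<Longrightarrow> x \<in> S \<Longrightarrow> (f has_derivative frechet_derivative f (at x)) (at x)"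
  unfolding smooth_on_def using Ck_on_Suc_has_derivative by blast

lemma smooth_on_frechet_derivative:
  "smooth_on S f \<Longrightarrow> smooth_on S (\<lambda>x. frechet_derivative f (at x) v)"
  unfolding smooth_on_def by (metis Ck_on.simps(2))

lemma smooth_on_continuous: "smooth_on S f \<Longrightarrow> continuous_on S f"
  unfolding smooth_on_def by (metis Ck_on.simps(1))

text \<open>The definitions test smoothness of endomorphisms and metrics on fixed coordinate vectors
  only; expanding the argument in the basis passes to arguments that vary smoothly. Applied below to
  transition derivatives, \<open>J\<close>, \<open>g\<close> and the Christoffel symbols.\<close>

lemma smooth_on_linear_apply:
  fixes f :: "'a::euclidean_space \<Rightarrow> 'b::euclidean_space" and L :: "'a \<Rightarrow> 'b \<Rightarrow> 'c::real_normed_vector"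
  assumes "open S" "\<And>x. x \<in> S \<Longrightarrow> linear (L x)"
    and "\<And>b. b \<in> Basis \<Longrightarrow> smooth_on S (\<lambda>x. L x b)" "smooth_on S f"
  shows "smooth_on S (\<lambda>x. L x (f x))"
proof (rule smooth_on_cong[OF assms(1)])
  show "(\<Sum>b\<in>Basis. (f x \<bullet> b) *\<^sub>R L x b) = L x (f x)" if "x \<in> S" for x
    using linear_sum[OF assms(2)[OF that], of "\<lambda>b. (f x \<bullet> b) *\<^sub>R b" Basis]
    by (simp add: linear_scale[OF assms(2)[OF that]] euclidean_representation)
  show "smooth_on S (\<lambda>x. \<Sum>b\<in>Basis. (f x \<bullet> b) *\<^sub>R L x b)"
    using assms by (intro smooth_on_sum smooth_on_scaleR smooth_on_linear_compose[OF bounded_linear_inner_left]) auto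
qed

section \<open>Flat functions and bump functions\<close>

definition exp_flat :: "nat \<Rightarrow> real \<Rightarrow> real"
  where "exp_flat n t = (if t \<le> 0 then 0 else inverse t ^ n * exp (- inverse t))"

lemma exp_flat_tendsto: "(exp_flat n \<longlongrightarrow> 0) (at 0)"
proof -
  have "((\<lambda>s::real. s ^ n / exp s) \<longlongrightarrow> 0) at_top" by (rule tendsto_power_div_exp_0)
  then have "((\<lambda>t::real. inverse t ^ n / exp (inverse t)) \<longlongrightarrow> 0) (at_right 0)"
    by (rule filterlim_compose[OF _ filterlim_inverse_at_top_right])
  moreover have "\<forall>\<^sub>F t in at_right 0. inverse t ^ n / exp (inverse t) = exp_flat n t"
    by (auto simp: eventually_at_right_field exp_flat_def exp_minus field_simps intro: exI[of _ 1])
  ultimately have "(exp_flat n \<longlongrightarrow> 0) (at_right 0)"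
    using Lim_transform_eventually by blast
  moreover have "(exp_flat n \<longlongrightarrow> 0) (at_left 0)"
    by (rule Lim_transform_eventually[OF tendsto_const])
      (auto simp: eventually_at_left_field exp_flat_def intro: exI[of _ "-1"])
  ultimately show ?thesis by (simp add: filterlim_split_at)
qed

text \<open>The negative powers of t in front of exp(-1/t) make the family closed under
  differentiation, so smoothness follows by one induction over all \<open>n\<close> at once.\<close>

lemma exp_flat_has_derivative:
  "(exp_flat n has_field_derivative - real n * exp_flat (n + 1) t + exp_flat (n + 2) t) (at t)"
proof -
  consider "t < 0" | "t = 0" | "t > 0" by linarith
  then show ?thesis
  proof cases
    case 1
    have "((\<lambda>t. 0) has_field_derivative - real n * exp_flat (n + 1) t + exp_flat (n + 2) t) (at t)"
      using 1 by (simp add: exp_flat_def)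
    then show ?thesis
      by (rule has_field_derivative_transform_within_open[of _ _ _ "{..<0}"])
        (use 1 in \<open>auto simp: exp_flat_def\<close>)
  next
    case 2
    have "(\<lambda>t. (exp_flat n (0 + t) - exp_flat n 0) / t) \<midarrow>0\<rightarrow> 0"
    \<comment> \<open>The difference quotient of \<open>exp_flat n\<close> at 0 is
      \<open>exp_flat (n + 1)\<close> itself: dividing by t raises the power by one, and both vanish
      for negative t.\<close>
    proof (rule Lim_transform_eventually[OF exp_flat_tendsto[of "n + 1"]])
      show "\<forall>\<^sub>F t in at 0. exp_flat (n + 1) t = (exp_flat n (0 + t) - exp_flat n 0) / t"
        by (auto simp: eventually_at_filter exp_flat_def field_simps)
    qed
    then show ?thesis using 2 by (simp add: exp_flat_def DERIV_def)
  next
    case 3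
    have inv: "(inverse has_field_derivative - (inverse t * inverse t)) (at t)"
      using DERIV_inverse[of t UNIV] 3 by (simp add: power2_eq_square)
    have "((\<lambda>t. inverse t ^ n * exp (- inverse t)) has_field_derivative
        - real n * exp_flat (n + 1) t + exp_flat (n + 2) t) (at t)"
      using DERIV_mult[OF DERIV_power[OF inv] DERIV_fun_exp[OF DERIV_minus[OF inv]], of n] 3
      by (cases n) (simp_all add: exp_flat_def algebra_simps)
    then show ?thesis
      by (rule has_field_derivative_transform_within_open[of _ _ _ "{0<..}"])
        (use 3 in \<open>auto simp: exp_flat_def\<close>)
  qed
qed

lemma smooth_on_exp_flat: "smooth_on UNIV (exp_flat n)"
proof -
  have "Ck_on k UNIV (exp_flat n)" for k
  proof (induction k arbitrary: n)
    case 0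
    show ?case
      by (simp add: continuous_on_eq_continuous_at DERIV_isCont[OF exp_flat_has_derivative])
  next
    case (Suc k)
    show ?case
    proof (rule Ck_on_SucI[OF open_UNIV])
      show "(exp_flat n has_derivative (\<lambda>v. v * (- real n * exp_flat (n + 1) t + exp_flat (n + 2) t))) (at t)"
        for t
        using exp_flat_has_derivative[of n t] unfolding has_field_derivative_def
        by (simp only: mult.commute[of _ "- real n * exp_flat (n + 1) t + exp_flat (n + 2) t"])
      have bl: "bounded_linear (\<lambda>s. r * s)" for r :: real by (rule bounded_linear_mult_right)
      show "Ck_on k UNIV (\<lambda>t. v * (- real n * exp_flat (n + 1) t + exp_flat (n + 2) t))" for v
        by (rule Ck_on_linear_compose[OF bl open_UNIV]
           Ck_on_add[OF open_UNIV] Ck_on_linear_compose[OF bl[of "- real n"] open_UNIV] Suc.IH)+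
    qed
  qed
  then show ?thesis by (simp add: smooth_on_def)
qed

text \<open>The cutoff has the form \<open>h (1 - h t / h \<delta>) / h 1\<close> with \<open>t = (dist z u)\<^sup>2 - s\<^sup>2\<close>, which avoids
  reciprocals of smooth functions.\<close>

lemma exists_bump:
  fixes z :: "'e::euclidean_space"
  assumes "0 < r"
  obtains \<rho> :: "'e \<Rightarrow> real" and s where "smooth_on UNIV \<rho>" "0 < s"
    "\<And>u. dist z u < s \<Longrightarrow> \<rho> u = 1" "\<And>u. dist z u \<ge> r \<Longrightarrow> \<rho> u = 0"
proof -
  define h where "h = exp_flat 0"
  define s where "s = r / 2"
  \<comment> \<open>\<open>\<delta>\<close> is the value of t at distance \<open>r\<close>. There
    the inner quotient reaches 1 and the outer argument drops to 0; inside radius \<open>s\<close>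
    one has t \<le> 0, so the outer argument is 1.\<close>
  define \<delta> where "\<delta> = r\<^sup>2 - s\<^sup>2"
  define \<rho> where "\<rho> u = inverse (h 1) * h (1 - inverse (h \<delta>) * h ((u - z) \<bullet> (u - z) - s\<^sup>2))" for u
  have h: "smooth_on UNIV h" unfolding h_def by (rule smooth_on_exp_flat)
  have \<delta>: "\<delta> > 0" using assms unfolding \<delta>_def s_def by (simp add: power2_eq_square field_simps)
  have hpos: "h t > 0" if "t > 0" for t using that by (simp add: h_def exp_flat_def)
  have hmono: "h t \<ge> h \<delta>" if "t \<ge> \<delta>" for t
    using that \<delta> by (simp add: h_def exp_flat_def le_imp_inverse_le)
  have h0: "h t = 0" if "t \<le> 0" for t using that by (simp add: h_def exp_flat_def)
  have id: "smooth_on UNIV (\<lambda>u::'e. u)" by (rule smooth_on_bounded_linear[OF bounded_linear_ident])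
  have sq: "smooth_on UNIV (\<lambda>u. h ((u - z) \<bullet> (u - z) - s\<^sup>2))"
    by (rule smooth_on_compose[OF _ _ _ h])
      (auto intro!: smooth_on_diff smooth_on_inner id smooth_on_const)
  have "smooth_on UNIV (\<lambda>u. h (1 - inverse (h \<delta>) * h ((u - z) \<bullet> (u - z) - s\<^sup>2)))"
    by (rule smooth_on_compose[OF _ _ _ h])
      (auto intro!: smooth_on_diff smooth_on_mult sq smooth_on_const)
  then have sm: "smooth_on UNIV \<rho>"
    unfolding \<rho>_def by (intro smooth_on_mult) auto
  have d: "(u - z) \<bullet> (u - z) = (dist z u)\<^sup>2" for u
    by (simp add: dist_norm norm_minus_commute power2_norm_eq_inner)
  have "\<rho> u = 1" if "dist z u < s" for u
  proof -
    have "(dist z u)\<^sup>2 \<le> s\<^sup>2" using that by (intro power_mono) auto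
    then show ?thesis using h0 hpos[of 1] by (simp add: \<rho>_def d)
  qed
  moreover have "\<rho> u = 0" if "dist z u \<ge> r" for u
  proof -
    have "(dist z u)\<^sup>2 \<ge> r\<^sup>2" using that assms by (intro power_mono) auto
    then have "h \<delta> \<le> h ((u - z) \<bullet> (u - z) - s\<^sup>2)" by (intro hmono) (simp add: d \<delta>_def)
    then have "1 - inverse (h \<delta>) * h ((u - z) \<bullet> (u - z) - s\<^sup>2) \<le> 0"
      using hpos[OF \<delta>] by (simp add: field_simps)
    then show ?thesis by (simp add: \<rho>_def h0)
  qed
  moreover have "0 < s" using assms by (simp add: s_def)
  ultimately show ?thesis using that sm by blast
qed

section \<open>Charts and tangent spaces\<close>

lemma points_charts_at: "x \<in> points A \<longleftrightarrow> charts_at A x \<noteq> {}"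
  unfolding points_def charts_at_def by blast

context
  fixes A :: "('m, 'e::euclidean_space) chart set"
  assumes sA: "smooth_atlas A"
begin

lemma chart_inv_chart_map: "c \<in> A \<Longrightarrow> x \<in> chart_dom c \<Longrightarrow> chart_inv c (chart_map c x) = x"
  using sA unfolding smooth_atlas_def chart_inv_def by (meson inv_into_f_f)

lemma chart_map_chart_inv: "u \<in> chart_map c ` S \<Longrightarrow> S \<subseteq> chart_dom c \<Longrightarrow> chart_map c (chart_inv c u) = u"
  unfolding chart_inv_def by (rule f_inv_into_f) auto

lemma chart_inv_in: "c \<in> A \<Longrightarrow> u \<in> chart_map c ` S \<Longrightarrow> S \<subseteq> chart_dom c \<Longrightarrow> chart_inv c u \<in> S"
  by (auto simp: chart_inv_chart_map subset_iff)

lemma open_chart_overlap: "c \<in> A \<Longrightarrow> d \<in> A \<Longrightarrow> open (chart_map c ` (chart_dom c \<inter> chart_dom d))"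
  using sA unfolding smooth_atlas_def by blast

lemma open_chart_image: "c \<in> A \<Longrightarrow> open (chart_map c ` chart_dom c)"
  using open_chart_overlap[of c c] by simp

lemma smooth_transition:
  "c \<in> A \<Longrightarrow> d \<in> A \<Longrightarrow>
    smooth_on (chart_map c ` (chart_dom c \<inter> chart_dom d)) (chart_map d \<circ> chart_inv c)"
  using sA unfolding smooth_atlas_def by blast

lemma transition_has_derivative:
  assumes "c \<in> charts_at A x" "d \<in> charts_at A x"
  shows "(chart_map d \<circ> chart_inv c has_derivative chart_change c d x) (at (chart_map c x))"
  unfolding chart_change_def
  by (rule smooth_on_has_derivative[OF smooth_transition]) (use assms in \<open>auto simp: charts_at_def\<close>)

lemma linear_chart_change:
  "c \<in> charts_at A x \<Longrightarrow> d \<in> charts_at A x \<Longrightarrow> linear (chart_change c d x)"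
  by (rule has_derivative_linear[OF transition_has_derivative])

text \<open>Chain rule for \<open>G\<close> in chart \<open>d\<close> after the transition from
  \<open>c\<close> to \<open>d\<close>; the composite agrees with \<open>G\<close> in chart
  \<open>c\<close> only on the overlap, which is open. The cocycle law and the chart independence of
  \<open>vec_deriv\<close> and \<open>differential\<close> come from here.\<close>

lemma has_derivative_chart_change:
  assumes c: "c \<in> charts_at A x" and d: "d \<in> charts_at A x"
    and G: "(G \<circ> chart_inv d has_derivative G') (at (chart_map d x))"
  shows "(G \<circ> chart_inv c has_derivative (\<lambda>e. G' (chart_change c d x e))) (at (chart_map c x))"
proof -
  have x: "chart_map c x \<in> chart_map c ` (chart_dom c \<inter> chart_dom d)"
    using c d by (auto simp: charts_at_def)
  have inv: "chart_inv c (chart_map c x) = x"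
    using c by (auto simp: charts_at_def chart_inv_chart_map)
  have "((G \<circ> chart_inv d) \<circ> (chart_map d \<circ> chart_inv c) has_derivative
      G' \<circ> chart_change c d x) (at (chart_map c x))"
    by (rule diff_chain_at[OF transition_has_derivative[OF c d]]) (use G inv in simp)
  then have "((G \<circ> chart_inv d) \<circ> (chart_map d \<circ> chart_inv c) has_derivative
      (\<lambda>e. G' (chart_change c d x e))) (at (chart_map c x))"
    by (simp add: comp_def)
  then show ?thesis
    by (rule has_derivative_transform_within_open[OF _ open_chart_overlap x])
      (use c d in \<open>auto simp: charts_at_def chart_inv_chart_map\<close>)
qed

lemma chart_change_comp:
  assumes "b \<in> charts_at A x" "c \<in> charts_at A x" "d \<in> charts_at A x"
  shows "chart_change c d x (chart_change b c x e) = chart_change b d x e"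
  using has_derivative_chart_change[OF assms(1,2) transition_has_derivative[OF assms(2,3)]]
    frechet_derivative_at
  unfolding chart_change_def[of b d] by metis

lemma chart_change_self:
  assumes "c \<in> charts_at A x"
  shows "chart_change c c x e = e"
proof -
  have c: "c \<in> A" "x \<in> chart_dom c" using assms by (auto simp: charts_at_def)
  have "(chart_map c \<circ> chart_inv c has_derivative (\<lambda>e. e)) (at (chart_map c x))"
    by (rule has_derivative_transform_within_open[OF has_derivative_ident open_chart_image[OF c(1)]])
      (use c in \<open>auto simp: chart_inv_chart_map\<close>)
  then show ?thesis
    unfolding chart_change_def using frechet_derivative_at by metis
qed

lemma tangent_space_change:
  "c \<in> charts_at A x \<Longrightarrow> d \<in> charts_at A x \<Longrightarrow> v \<in> tangent_space A x \<Longrightarrow>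
    v d = chart_change c d x (v c)"
  unfolding tangent_space_def by blast

lemma tangent_space_other_chart: "c \<notin> charts_at A x \<Longrightarrow> v \<in> tangent_space A x \<Longrightarrow> v c = 0"
  unfolding tangent_space_def by blast

lemma tangent_spaceI:
  assumes "\<And>c. c \<notin> charts_at A x \<Longrightarrow> v c = 0"
    and "\<And>c d. c \<in> charts_at A x \<Longrightarrow> d \<in> charts_at A x \<Longrightarrow> v d = chart_change c d x (v c)"
  shows "v \<in> tangent_space A x"
  unfolding tangent_space_def using assms by blast

lemma tangent_subspace: "subspace (tangent_space A x)"
  unfolding subspace_def
proof (intro conjI ballI allI tangent_spaceI)
  fix c d v w assume "c \<in> charts_at A x" "d \<in> charts_at A x" "v \<in> tangent_space A x" "w \<in> tangent_space A x"
  then show "(v + w) d = chart_change c d x ((v + w) c)"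
    using tangent_space_change[of c x d] by (simp add: linear_chart_change linear_add)
next
  fix c d v r assume "c \<in> charts_at A x" "d \<in> charts_at A x" "v \<in> tangent_space A x"
  then show "(r *\<^sub>R v) d = chart_change c d x ((r *\<^sub>R v) c)"
    using tangent_space_change[of c x d v] by (simp add: linear_chart_change linear_scale)
qed (simp_all add: linear_chart_change linear_0 tangent_space_other_chart)

lemma coord_vec_in: "c \<in> charts_at A x \<Longrightarrow> coord_vec A c e x \<in> tangent_space A x"
  by (rule tangent_spaceI) (simp_all add: coord_vec_def chart_change_comp)

lemma coord_vec_apply: "c \<in> charts_at A x \<Longrightarrow> coord_vec A c e x c = e"
  by (simp add: coord_vec_def chart_change_self)

lemma tangent_space_coord_vec:
  assumes "c \<in> charts_at A x" "v \<in> tangent_space A x" shows "v = coord_vec A c (v c) x"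
proof
  show "v d = coord_vec A c (v c) x d" for d
    using assms tangent_space_change[OF assms(1) _ assms(2), of d] tangent_space_other_chart[OF _ assms(2)]
    by (cases "d \<in> charts_at A x") (simp_all add: coord_vec_def)
qed

text \<open>One component determines all others through \<open>chart_change\<close>. Identities
  between tangent vectors, on the base and on the bundle, are therefore checked in a single
  convenient chart.\<close>

lemma tangent_space_eqI:
  "c \<in> charts_at A x \<Longrightarrow> v \<in> tangent_space A x \<Longrightarrow> w \<in> tangent_space A x \<Longrightarrow> v c = w c \<Longrightarrow> v = w"
  by (metis tangent_space_coord_vec)

lemma zero_in_tangent: "0 \<in> tangent_space A x"
  by (rule subspace_0[OF tangent_subspace])

lemma coord_vec_add:
  "c \<in> charts_at A x \<Longrightarrow> coord_vec A c (e + e') x = coord_vec A c e x + coord_vec A c e' x"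
  unfolding coord_vec_def by (auto simp: fun_eq_iff linear_chart_change linear_add)

lemma coord_vec_scaleR:
  "c \<in> charts_at A x \<Longrightarrow> coord_vec A c (r *\<^sub>R e) x = r *\<^sub>R coord_vec A c e x"
  unfolding coord_vec_def by (auto simp: fun_eq_iff linear_chart_change linear_scale)

text \<open>The definition picks a chart by \<open>SOME\<close>. Passing to \<open>c\<close> changes
  the derivative by \<open>chart_change\<close> on the source side and the component of
  \<open>v\<close> by the same map, and the two changes cancel. \<open>differential_eq\<close> rests
  on the same cancellation.\<close>

lemma vec_deriv_eq:
  assumes "c \<in> charts_at A x" "v \<in> tangent_space A x"
    and "(f \<circ> chart_inv c has_derivative f') (at (chart_map c x))"
  shows "vec_deriv A x v f = f' (v c)"
proof -
  define d where "d = (SOME c. c \<in> charts_at A x)"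
  have d: "d \<in> charts_at A x" unfolding d_def using assms(1) someI by metis
  have "frechet_derivative (f \<circ> chart_inv d) (at (chart_map d x)) = (\<lambda>e. f' (chart_change d c x e))"
    using has_derivative_chart_change[OF d assms(1,3)] frechet_derivative_at by metis
  then show ?thesis
    unfolding vec_deriv_def Let_def d_def[symmetric]
    using tangent_space_change[OF d assms(1,2)] by simp
qed

lemma differential_eq:
  assumes "c \<in> charts_at A x" "v \<in> tangent_space A x" "d \<in> charts_at B (F x)"
    and "(chart_map d \<circ> F \<circ> chart_inv c has_derivative F') (at (chart_map c x))"
  shows "differential A B F x v d = F' (v c)"
proof -
  define b where "b = (SOME c. c \<in> charts_at A x)"
  have b: "b \<in> charts_at A x" unfolding b_def using assms(1) someI by metis
  have "frechet_derivative (chart_map d \<circ> F \<circ> chart_inv b) (at (chart_map b x)) =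
      (\<lambda>e. F' (chart_change b c x e))"
    using has_derivative_chart_change[OF b assms(1,4)] frechet_derivative_at by metis
  then show ?thesis
    unfolding differential_def Let_def b_def[symmetric]
    using tangent_space_change[OF b assms(1,2)] assms(3) by simp
qed

text \<open>The counterpart of \<open>has_derivative_chart_change\<close> for target charts: the
  derivative read in one chart determines it in all others. It shows that differentials and curve
  velocities transform as tangent vectors.\<close>

lemma has_derivative_into_chart_change:
  fixes F :: "'v::real_normed_vector \<Rightarrow> 'm"
  assumes c: "c \<in> charts_at A (F t)" and d: "d \<in> charts_at A (F t)"
    and S: "open S" "t \<in> S" "F ` S \<subseteq> chart_dom c"
    and F: "(chart_map c \<circ> F has_derivative F') (at t)"
  shows "(chart_map d \<circ> F has_derivative (\<lambda>v. chart_change c d (F t) (F' v))) (at t)"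
proof -
  have "((chart_map d \<circ> chart_inv c) \<circ> (chart_map c \<circ> F) has_derivative
      chart_change c d (F t) \<circ> F') (at t)"
    by (rule diff_chain_at[OF F]) (use transition_has_derivative[OF c d] in simp)
  then have "((chart_map d \<circ> chart_inv c) \<circ> (chart_map c \<circ> F) has_derivative
      (\<lambda>v. chart_change c d (F t) (F' v))) (at t)"
    by (simp add: comp_def)
  then show ?thesis
    by (rule has_derivative_transform_within_open[OF _ S(1,2)])
      (use S c in \<open>auto simp: charts_at_def image_subset_iff chart_inv_chart_map\<close>)
qed

section \<open>The topology defined by an atlas\<close>

lemma topspace_atlas: "topspace (atlas_topology A) = points A"
proof -
  have "openin (atlas_topology A) (points A)"
    unfolding openin_atlas_topology[OF sA]
  proof (intro conjI ballI order_refl)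
    fix c assume "c \<in> A"
    then have "points A \<inter> chart_dom c = chart_dom c" by (auto simp: points_def)
    then show "open (chart_map c ` (points A \<inter> chart_dom c))"
      using open_chart_image \<open>c \<in> A\<close> by simp
  qed
  then show ?thesis
    by (metis openin_atlas_topology[OF sA] openin_subset openin_topspace subset_antisym)
qed

text \<open>Continuity of chart maps: seen in another chart \<open>d\<close>, the set is the
  preimage of \<open>U\<close> under a smooth, hence continuous, transition on the open
  overlap.\<close>

lemma openin_chart_preimage:
  assumes "c \<in> A" "open U"
  shows "openin (atlas_topology A) {x \<in> chart_dom c. chart_map c x \<in> U}"
  unfolding openin_atlas_topology[OF sA]
proof (intro conjI ballI)
  show "{x \<in> chart_dom c. chart_map c x \<in> U} \<subseteq> points A" using assms by (auto simp: points_def)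
next
  fix d assume d: "d \<in> A"
  have "chart_map d ` ({x \<in> chart_dom c. chart_map c x \<in> U} \<inter> chart_dom d) =
      chart_map d ` (chart_dom d \<inter> chart_dom c) \<inter> (chart_map c \<circ> chart_inv d) -` U"
    using chart_inv_chart_map[OF d] by (auto simp: image_iff)
  moreover have "open \<dots>"
    by (rule continuous_open_preimage[OF smooth_on_continuous[OF smooth_transition]
        open_chart_overlap assms(2)]) (use d assms in auto)
  ultimately show "open (chart_map d ` ({x \<in> chart_dom c. chart_map c x \<in> U} \<inter> chart_dom d))"
    by simp
qed

lemma openin_chart_dom: "c \<in> A \<Longrightarrow> openin (atlas_topology A) (chart_dom c)"
  using openin_chart_preimage[of c UNIV] by simp

text \<open>Used to carry compact balls of a chart image to compact subsets of the manifold.\<close>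

lemma chart_inv_continuous:
  assumes "c \<in> A"
  shows "continuous_map (top_of_set (chart_map c ` chart_dom c)) (atlas_topology A) (chart_inv c)"
  unfolding continuous_map_def topspace_atlas
proof (intro conjI allI impI)
  show "chart_inv c \<in> topspace (top_of_set (chart_map c ` chart_dom c)) \<rightarrow> points A"
    using chart_inv_chart_map[OF assms] assms by (auto simp: points_def)
next
  fix W assume W: "openin (atlas_topology A) W"
  have "{u \<in> topspace (top_of_set (chart_map c ` chart_dom c)). chart_inv c u \<in> W} =
      chart_map c ` (W \<inter> chart_dom c)"
    using chart_inv_chart_map[OF assms] by auto
  moreover have "open (chart_map c ` (W \<inter> chart_dom c))"
    using W assms openin_atlas_topology[OF sA] by auto
  ultimately show "openin (top_of_set (chart_map c ` chart_dom c))
      {u \<in> topspace (top_of_set (chart_map c ` chart_dom c)). chart_inv c u \<in> W}"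
    by (auto simp: openin_open intro!: exI[of _ "chart_map c ` (W \<inter> chart_dom c)"])
qed

section \<open>The tangent bundle as a manifold\<close>

lemma chart_dom_tangent_chart: "chart_dom (tangent_chart A c) = Sigma (chart_dom c) (tangent_space A)"
  by (simp add: tangent_chart_def)

lemma chart_map_tangent_chart: "chart_map (tangent_chart A c) (x, v) = (chart_map c x, v c)"
  by (simp add: tangent_chart_def)

lemma charts_at_tangent_atlas:
  "charts_at (tangent_atlas A) (x, v) =
    (if v \<in> tangent_space A x then tangent_chart A ` charts_at A x else {})"
proof -
  have "charts_at (tangent_atlas A) (x, v) =
      tangent_chart A ` {c \<in> A. (x, v) \<in> chart_dom (tangent_chart A c)}"
    unfolding charts_at_def tangent_atlas_def by blast
  then show ?thesis by (simp add: chart_dom_tangent_chart charts_at_def)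
qed

lemma points_tangent_atlas: "points (tangent_atlas A) = Sigma (points A) (tangent_space A)"
  unfolding points_def tangent_atlas_def by (auto simp: chart_dom_tangent_chart)

text \<open>The fibre direction is filled completely because \<open>coord_vec\<close> realises every
  component vector. Stated for subsets \<open>S\<close> so that it also gives the images of
  overlaps.\<close>

lemma image_tangent_chart:
  assumes "S \<subseteq> chart_dom c" "c \<in> A"
  shows "chart_map (tangent_chart A c) ` Sigma S (tangent_space A) = chart_map c ` S \<times> UNIV"
proof (intro equalityI subsetI)
  fix z assume "z \<in> chart_map (tangent_chart A c) ` Sigma S (tangent_space A)"
  then show "z \<in> chart_map c ` S \<times> UNIV" by (auto simp: chart_map_tangent_chart)
next
  fix z assume "z \<in> chart_map c ` S \<times> (UNIV :: 'e set)"
  then obtain x y where z: "z = (chart_map c x, y)" "x \<in> S" by auto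
  then have c: "c \<in> charts_at A x" using assms by (auto simp: charts_at_def)
  show "z \<in> chart_map (tangent_chart A c) ` Sigma S (tangent_space A)"
    by (rule image_eqI[of _ _ "(x, coord_vec A c y x)"])
      (use z c in \<open>auto simp: chart_map_tangent_chart coord_vec_apply coord_vec_in\<close>)
qed

lemma inj_on_tangent_chart:
  assumes "c \<in> A"
  shows "inj_on (chart_map (tangent_chart A c)) (chart_dom (tangent_chart A c))"
proof (rule inj_onI)
  fix a b
  assume ab: "a \<in> chart_dom (tangent_chart A c)" "b \<in> chart_dom (tangent_chart A c)"
    "chart_map (tangent_chart A c) a = chart_map (tangent_chart A c) b"
  obtain x v y w where [simp]: "a = (x, v)" "b = (y, w)" by (cases a, cases b)
  have *: "x \<in> chart_dom c" "y \<in> chart_dom c" "v \<in> tangent_space A x" "w \<in> tangent_space A y"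
    "chart_map c x = chart_map c y" "v c = w c"
    using ab by (auto simp: chart_dom_tangent_chart chart_map_tangent_chart)
  then have "x = y" using chart_inv_chart_map[OF assms] by metis
  moreover have "v = w"
    by (rule tangent_space_eqI[of c x]) (use * assms \<open>x = y\<close> in \<open>auto simp: charts_at_def\<close>)
  ultimately show "a = b" by simp
qed

lemma chart_inv_tangent_chart:
  assumes "c \<in> A" "u \<in> chart_map c ` chart_dom c"
  shows "chart_inv (tangent_chart A c) (u, y) = (chart_inv c u, coord_vec A c y (chart_inv c u))"
proof -
  have x: "chart_inv c u \<in> chart_dom c" "chart_map c (chart_inv c u) = u"
    using chart_inv_in[OF assms order_refl] chart_map_chart_inv[OF assms(2) order_refl] by auto
  then have c: "c \<in> charts_at A (chart_inv c u)" using assms by (simp add: charts_at_def)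
  let ?a = "(chart_inv c u, coord_vec A c y (chart_inv c u))"
  have "?a \<in> chart_dom (tangent_chart A c)" "chart_map (tangent_chart A c) ?a = (u, y)"
    using x c by (auto simp: chart_dom_tangent_chart chart_map_tangent_chart coord_vec_in coord_vec_apply)
  then show ?thesis
    unfolding chart_inv_def[of "tangent_chart A c"]
    using inv_into_f_f[OF inj_on_tangent_chart[OF assms(1)]] by metis
qed

lemma tangent_chart_overlap:
  "chart_dom (tangent_chart A c) \<inter> chart_dom (tangent_chart A d) =
    Sigma (chart_dom c \<inter> chart_dom d) (tangent_space A)"
  by (auto simp: chart_dom_tangent_chart)

text \<open>With \<open>\<tau>\<close> the base transition, the bundle transition is the pair of
  \<open>\<tau>\<close> at the base coordinate and its derivative there, applied to the fibre
  coordinate. The second entry is smooth since it is linear in the fibre coordinate with smooth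
  coefficients.\<close>

lemma smooth_atlas_tangent_atlas: "smooth_atlas (tangent_atlas A)"
  unfolding smooth_atlas_def
proof (intro conjI ballI)
  show "inj_on (chart_map C) (chart_dom C)" if "C \<in> tangent_atlas A" for C
    using that inj_on_tangent_chart by (auto simp: tangent_atlas_def)
next
  fix C D assume "C \<in> tangent_atlas A" "D \<in> tangent_atlas A"
  then obtain c d where c: "c \<in> A" "C = tangent_chart A c" and d: "d \<in> A" "D = tangent_chart A d"
    by (auto simp: tangent_atlas_def)
  let ?U = "chart_map c ` (chart_dom c \<inter> chart_dom d)" and ?\<tau> = "chart_map d \<circ> chart_inv c"
  have U: "chart_map C ` (chart_dom C \<inter> chart_dom D) = ?U \<times> UNIV"
    unfolding c d tangent_chart_overlap by (rule image_tangent_chart) (use c in auto)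
  have opU: "open ?U" by (rule open_chart_overlap[OF c(1) d(1)])
  have op: "open (?U \<times> (UNIV::'e set))" by (intro open_Times opU open_UNIV)
  then show "open (chart_map C ` (chart_dom C \<inter> chart_dom D))" by (simp add: U)
  have base: "smooth_on (?U \<times> (UNIV::'e set)) (\<lambda>z. f (fst z))" if "smooth_on ?U f"
    for f :: "'e \<Rightarrow> 'e"
    by (rule smooth_on_compose[OF op opU _ that smooth_on_bounded_linear[OF bounded_linear_fst]]) auto
  have "smooth_on (?U \<times> (UNIV::'e set))
      (\<lambda>z. (?\<tau> (fst z), frechet_derivative ?\<tau> (at (fst z)) (snd z)))"
  proof (rule smooth_on_Pair[OF op base[OF smooth_transition[OF c(1) d(1)]]],
      rule smooth_on_linear_apply[OF op,
        where L = "\<lambda>z. frechet_derivative ?\<tau> (at (fst z))" and f = snd])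
    show "linear (frechet_derivative ?\<tau> (at (fst z)))" if "z \<in> ?U \<times> UNIV" for z
      using has_derivative_linear[OF smooth_on_has_derivative[OF smooth_transition[OF c(1) d(1)]]]
        that by (simp add: mem_Times_iff)
    show "smooth_on (?U \<times> (UNIV::'e set)) (\<lambda>z. frechet_derivative ?\<tau> (at (fst z)) b)" for b
      by (rule base[OF smooth_on_frechet_derivative[OF smooth_transition[OF c(1) d(1)]]])
    show "smooth_on (?U \<times> (UNIV::'e set)) snd"
      by (rule smooth_on_bounded_linear[OF bounded_linear_snd])
  qed
  then show "smooth_on (chart_map C ` (chart_dom C \<inter> chart_dom D)) (chart_map D \<circ> chart_inv C)"
    unfolding U
  proof (rule smooth_on_cong[OF op, rotated])
    fix z assume z: "z \<in> ?U \<times> (UNIV::'e set)"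
    define x where "x = chart_inv c (fst z)"
    have x: "x \<in> chart_dom c \<inter> chart_dom d" "chart_map c x = fst z"
      using z chart_inv_in[OF c(1), of "fst z" "chart_dom c \<inter> chart_dom d"]
        chart_map_chart_inv[of "fst z" c "chart_dom c \<inter> chart_dom d"]
      unfolding x_def by auto
    have ch: "c \<in> charts_at A x" "d \<in> charts_at A x" using x c d by (auto simp: charts_at_def)
    have "chart_inv C z = (x, coord_vec A c (snd z) x)"
      using chart_inv_tangent_chart[OF c(1), of "fst z" "snd z"] z
      unfolding c x_def by auto
    then show "(?\<tau> (fst z), frechet_derivative ?\<tau> (at (fst z)) (snd z)) = (chart_map D \<circ> chart_inv C) z"
      using ch x by (simp add: d chart_map_tangent_chart x_def[symmetric] coord_vec_def chart_change_def)
  qed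
qed

text \<open>Continuity of the bundle projection; it separates tangent vectors with distinct base
  points.\<close>

lemma openin_tangent_preimage:
  assumes "openin (atlas_topology A) W"
  shows "openin (atlas_topology (tangent_atlas A)) (Sigma W (tangent_space A))"
  unfolding openin_atlas_topology[OF smooth_atlas_tangent_atlas] points_tangent_atlas
proof (intro conjI ballI)
  have W: "W \<subseteq> points A" and Wc: "\<And>c. c \<in> A \<Longrightarrow> open (chart_map c ` (W \<inter> chart_dom c))"
    using assms openin_atlas_topology[OF sA] by auto
  show "Sigma W (tangent_space A) \<subseteq> Sigma (points A) (tangent_space A)" using W by auto
  fix C assume "C \<in> tangent_atlas A"
  then obtain c where c: "c \<in> A" "C = tangent_chart A c" by (auto simp: tangent_atlas_def)
  have "Sigma W (tangent_space A) \<inter> chart_dom C = Sigma (W \<inter> chart_dom c) (tangent_space A)"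
    by (auto simp: c chart_dom_tangent_chart)
  then have "chart_map C ` (Sigma W (tangent_space A) \<inter> chart_dom C) =
      chart_map c ` (W \<inter> chart_dom c) \<times> UNIV"
    using image_tangent_chart[of "W \<inter> chart_dom c" c] c by simp
  then show "open (chart_map C ` (Sigma W (tangent_space A) \<inter> chart_dom C))"
    using Wc[OF c(1)] by (simp add: open_Times)
qed

end

section \<open>Hausdorff property and countable base of the tangent bundle\<close>

lemma Hausdorff_tangent_atlas:
  fixes A :: "('m, 'e::euclidean_space) chart set"
  assumes sA: "smooth_atlas A" and H: "Hausdorff_space (atlas_topology A)"
  shows "Hausdorff_space (atlas_topology (tangent_atlas A))"
  unfolding Hausdorff_space_def topspace_atlas[OF smooth_atlas_tangent_atlas[OF sA]]
    points_tangent_atlas[OF sA]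
proof (clarify)
  fix x v y w
  assume *: "x \<in> points A" "v \<in> tangent_space A x" "y \<in> points A" "w \<in> tangent_space A y"
    and ne: "\<nexists>U V. openin (atlas_topology (tangent_atlas A)) U \<and>
      openin (atlas_topology (tangent_atlas A)) V \<and> (x, v) \<in> U \<and> (y, w) \<in> V \<and> disjnt U V"
  have xy: "x = y"
  proof (rule ccontr)
    assume "x \<noteq> y"
    then obtain U V where "openin (atlas_topology A) U" "openin (atlas_topology A) V"
      "x \<in> U" "y \<in> V" "disjnt U V"
      using H * unfolding Hausdorff_space_def topspace_atlas[OF sA] by blast
    moreover from this have "disjnt (Sigma U (tangent_space A)) (Sigma V (tangent_space A))"
      by (auto simp: disjnt_def)
    ultimately show False
      using ne openin_tangent_preimage[OF sA, of U] openin_tangent_preimage[OF sA, of V] *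
      by blast
  qed
  obtain c where c: "c \<in> A" "x \<in> chart_dom c" using *(1) by (auto simp: points_def)
  have C: "tangent_chart A c \<in> tangent_atlas A" using c by (simp add: tangent_atlas_def)
  \<comment> \<open>Over a common base point both vectors lie in one bundle chart, where their fibre
    components can be separated.\<close>
  have vc: "v c = w c"
  proof (rule ccontr)
    assume "v c \<noteq> w c"
    then obtain U V where UV: "open U" "open V" "v c \<in> U" "w c \<in> V" "U \<inter> V = {}"
      using hausdorff by metis
    let ?P = "\<lambda>U. {a \<in> chart_dom (tangent_chart A c). chart_map (tangent_chart A c) a \<in> UNIV \<times> U}"
    have "openin (atlas_topology (tangent_atlas A)) (?P U)"
         "openin (atlas_topology (tangent_atlas A)) (?P V)"
      by (intro openin_chart_preimage[OF smooth_atlas_tangent_atlas[OF sA] C] open_Times UV open_UNIV)+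
    have "disjnt (?P U) (?P V)" using UV by (auto simp: disjnt_def)
    have "(x, v) \<in> ?P U" "(y, w) \<in> ?P V"
      using * UV c xy by (simp_all add: chart_dom_tangent_chart[OF sA] chart_map_tangent_chart[OF sA])
    show False
      by (rule notE[OF ne], intro exI[of _ "?P U"] exI[of _ "?P V"] conjI) fact+
  qed
  have "c \<in> charts_at A x" using c by (simp add: charts_at_def)
  then have "v = w"
    using tangent_space_eqI[OF sA, of c x v w] vc * xy by simp
  then show "x = y \<and> v = w" using xy by simp
qed

text \<open>The atlas may be uncountable, so pulling a countable base back through all bundle charts
  is too much. A countable base of the manifold selects countably many charts that still cover it,
  and the pullbacks through these suffice.\<close>

lemma second_countable_tangent_atlas:
  fixes A :: "('m, 'e::euclidean_space) chart set"
  assumes sA: "smooth_atlas A" and S: "second_countable (atlas_topology A)"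
  shows "second_countable (atlas_topology (tangent_atlas A))"
proof -
  note sTA = smooth_atlas_tangent_atlas[OF sA]
  obtain \<B> where \<B>: "countable \<B>"
    "\<And>W x. openin (atlas_topology A) W \<Longrightarrow> x \<in> W \<Longrightarrow> \<exists>V\<in>\<B>. x \<in> V \<and> V \<subseteq> W"
    using S unfolding second_countable_def by metis
  obtain \<C> :: "('e \<times> 'e) set set" where \<C>: "countable \<C>" "topological_basis \<C>"
    using ex_countable_basis by blast
  define \<B>' where "\<B>' = {V \<in> \<B>. \<exists>c\<in>A. V \<subseteq> chart_dom c}"
  \<comment> \<open>One chart is chosen for each basic set \<open>V\<close> that fits into a chart
    domain. \<open>V\<close> serves as an index only: \<open>P V Q\<close> lives on the whole domain
    of the bundle chart of \<open>ch V\<close>.\<close>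
  define ch where "ch V = (SOME c. c \<in> A \<and> V \<subseteq> chart_dom c)" for V
  have ch: "ch V \<in> A \<and> V \<subseteq> chart_dom (ch V)" if "V \<in> \<B>'" for V
    unfolding ch_def by (rule someI_ex) (use that in \<open>unfold \<B>'_def, blast\<close>)
  define P where "P V Q = {a \<in> chart_dom (tangent_chart A (ch V)).
    chart_map (tangent_chart A (ch V)) a \<in> Q}" for V Q
  show ?thesis
    unfolding second_countable_def
  proof (intro exI[of _ "(\<lambda>(V, Q). P V Q) ` (\<B>' \<times> \<C>)"] conjI ballI allI impI)
    show "countable ((\<lambda>(V, Q). P V Q) ` (\<B>' \<times> \<C>))"
      using \<B>(1) \<C>(1) unfolding \<B>'_def by (intro countable_image countable_SIGMA) auto
    show "openin (atlas_topology (tangent_atlas A)) R"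
      if R: "R \<in> (\<lambda>(V, Q). P V Q) ` (\<B>' \<times> \<C>)" for R
    proof -
      obtain V Q where "V \<in> \<B>'" "Q \<in> \<C>" "R = P V Q" using R by auto
      moreover from this have "tangent_chart A (ch V) \<in> tangent_atlas A"
        using ch[of V] by (simp add: tangent_atlas_def)
      ultimately show ?thesis
        unfolding P_def using topological_basis_open[OF \<C>(2)]
        by (simp add: openin_chart_preimage[OF sTA])
    qed
  next
    fix W a assume Wa: "openin (atlas_topology (tangent_atlas A)) W \<and> a \<in> W"
    obtain x v where a: "a = (x, v)" by (cases a)
    have xv: "x \<in> points A" "v \<in> tangent_space A x"
      using Wa openin_subset[of "atlas_topology (tangent_atlas A)" W]
      unfolding topspace_atlas[OF sTA] points_tangent_atlas[OF sA] a by auto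
    then obtain c where c: "c \<in> A" "x \<in> chart_dom c" by (auto simp: points_def)
    obtain V where V: "V \<in> \<B>" "x \<in> V" "V \<subseteq> chart_dom c"
      using \<B>(2)[OF openin_chart_dom[OF sA c(1)] c(2)] by auto
    then have V': "V \<in> \<B>'" using c by (auto simp: \<B>'_def)
    let ?C = "tangent_chart A (ch V)"
    have C: "?C \<in> tangent_atlas A" using ch[OF V'] by (simp add: tangent_atlas_def)
    have aC: "a \<in> chart_dom ?C" using a xv ch[OF V'] V by (auto simp: chart_dom_tangent_chart[OF sA])
    have "open (chart_map ?C ` (W \<inter> chart_dom ?C))"
      using Wa C openin_atlas_topology[OF sTA] by auto
    moreover have "chart_map ?C a \<in> chart_map ?C ` (W \<inter> chart_dom ?C)" using Wa aC by auto
    ultimately obtain Q where Q: "Q \<in> \<C>" "chart_map ?C a \<in> Q" "Q \<subseteq> chart_map ?C ` (W \<inter> chart_dom ?C)"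
      using topological_basisE[OF \<C>(2)] by metis
    have "P V Q \<subseteq> W"
    proof
      fix b assume b: "b \<in> P V Q"
      then obtain b' where b': "b' \<in> W" "b' \<in> chart_dom ?C" "chart_map ?C b = chart_map ?C b'"
        using Q by (auto simp: P_def)
      have "b = b'"
        using inj_onD[OF inj_on_tangent_chart[OF sA] b'(3)] ch[OF V'] b b' by (auto simp: P_def)
      then show "b \<in> W" using b' by simp
    qed
    moreover have "a \<in> P V Q" using aC Q by (simp add: P_def)
    ultimately show "\<exists>R\<in>(\<lambda>(V, Q). P V Q) ` (\<B>' \<times> \<C>). a \<in> R \<and> R \<subseteq> W"
      using V' Q(1) by (intro bexI[of _ "P V Q"]) auto
  qed
qed

lemma smooth_manifold_tangent_atlas: "smooth_manifold A \<Longrightarrow> smooth_manifold (tangent_atlas A)"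
  by (simp add: smooth_manifold_def smooth_atlas_tangent_atlas Hausdorff_tangent_atlas
      second_countable_tangent_atlas)

section \<open>Extending local fields by zero\<close>

definition chart_function :: "('m, 'e) chart \<Rightarrow> ('e \<Rightarrow> real) \<Rightarrow> 'm \<Rightarrow> real"
  where "chart_function c z y = (if y \<in> chart_dom c then z (chart_map c y) else 0)"

definition chart_field ::
    "('m, 'e::euclidean_space) chart set \<Rightarrow> ('m, 'e) chart \<Rightarrow> ('e \<Rightarrow> 'e) \<Rightarrow> 'm \<Rightarrow> ('m, 'e) tvec"
  where "chart_field A c Z y = (if y \<in> chart_dom c then coord_vec A c (Z (chart_map c y)) y else 0)"

text \<open>Closedness in the whole manifold, not only in the chart domain, is what makes extensions by
  zero smooth; for images of compact sets it needs the Hausdorff property.\<close>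

definition cutoff_support :: "('m, 'e::euclidean_space) chart set \<Rightarrow> ('m, 'e) chart \<Rightarrow> 'e set \<Rightarrow> bool"
  where "cutoff_support A c K \<longleftrightarrow>
    K \<subseteq> chart_map c ` chart_dom c \<and> closedin (atlas_topology A) (chart_inv c ` K)"

text \<open>The plateau \<open>U\<close> is recorded because derivatives at \<open>x\<close> see
  only a neighbourhood. The point enters only through \<open>chart_map c x \<in> U\<close>, so one
  cutoff serves every point of its plateau.\<close>

definition chart_cutoff ::
    "('m, 'e::euclidean_space) chart set \<Rightarrow> ('m, 'e) chart \<Rightarrow> 'm \<Rightarrow> 'e set \<Rightarrow> ('e \<Rightarrow> real) \<Rightarrow> bool"
  where "chart_cutoff A c x U \<rho> \<longleftrightarrow> smooth_on UNIV \<rho> \<and>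
    open U \<and> chart_map c x \<in> U \<and> U \<subseteq> chart_map c ` chart_dom c \<and> (\<forall>u\<in>U. \<rho> u = 1) \<and>
    (\<exists>K. cutoff_support A c K \<and> (\<forall>u. u \<notin> K \<longrightarrow> \<rho> u = 0))"

lemma sum_fun_apply: "(\<Sum>i\<in>I. f i) x = (\<Sum>i\<in>I. f i x)"
  by (induction I rule: infinite_finite_induct) auto

lemma vector_field_in: "X \<in> vector_fields A \<Longrightarrow> X x \<in> tangent_space A x"
  by (simp add: vector_fields_def)

lemma vector_field_smooth:
  "X \<in> vector_fields A \<Longrightarrow> c \<in> A \<Longrightarrow>
    smooth_on (chart_map c ` chart_dom c) (\<lambda>u. X (chart_inv c u) c)"
  by (simp add: vector_fields_def)

lemma vector_fieldI:
  assumes "\<And>x. X x \<in> tangent_space A x"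
    and "\<And>c. c \<in> A \<Longrightarrow> smooth_on (chart_map c ` chart_dom c) (\<lambda>u. X (chart_inv c u) c)"
  shows "X \<in> vector_fields A"
  using assms by (simp add: vector_fields_def)

context
  fixes A :: "('m, 'e::euclidean_space) chart set"
  assumes sA: "smooth_atlas A"
begin

lemma vector_field_zero: "(\<lambda>x. 0) \<in> vector_fields A"
  by (rule vector_fieldI) (simp_all add: zero_in_tangent[OF sA] smooth_on_const)

lemma vector_field_add:
  assumes "X \<in> vector_fields A" "Y \<in> vector_fields A" shows "X + Y \<in> vector_fields A"
proof (rule vector_fieldI)
  show "(X + Y) x \<in> tangent_space A x" for x
    using subspace_add[OF tangent_subspace[OF sA] vector_field_in[OF assms(1)] vector_field_in[OF assms(2)]]
    by simp
  show "smooth_on (chart_map c ` chart_dom c) (\<lambda>u. (X + Y) (chart_inv c u) c)" if "c \<in> A" for c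
    using smooth_on_add[OF open_chart_image[OF sA that]
        vector_field_smooth[OF assms(1) that] vector_field_smooth[OF assms(2) that]]
    by simp
qed

lemma vector_field_scale:
  assumes "smooth_function A f" "X \<in> vector_fields A" shows "(\<lambda>x. f x *\<^sub>R X x) \<in> vector_fields A"
proof (rule vector_fieldI)
  show "f x *\<^sub>R X x \<in> tangent_space A x" for x
    by (rule subspace_scale[OF tangent_subspace[OF sA] vector_field_in[OF assms(2)]])
  show "smooth_on (chart_map c ` chart_dom c) (\<lambda>u. (f (chart_inv c u) *\<^sub>R X (chart_inv c u)) c)"
    if "c \<in> A" for c
    using smooth_on_scaleR[OF open_chart_image[OF sA that] _ vector_field_smooth[OF assms(2) that]]
      assms(1) that by (simp add: smooth_function_def comp_def)
qed

lemma vector_field_sum: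
  assumes "\<And>i. i \<in> I \<Longrightarrow> X i \<in> vector_fields A" shows "(\<Sum>i\<in>I. X i) \<in> vector_fields A"
  using assms
proof (induction I rule: infinite_finite_induct)
  case (insert i I)
  show ?case
    unfolding sum.insert[OF insert.hyps]
    by (rule vector_field_add) (use insert in auto)
qed (use vector_field_zero in \<open>simp_all add: zero_fun_def\<close>)

lemma smooth_function_mult:
  assumes "smooth_function A f" "smooth_function A h" shows "smooth_function A (\<lambda>x. f x * h x)"
  unfolding smooth_function_def
proof
  fix c assume c: "c \<in> A"
  show "smooth_on (chart_map c ` chart_dom c) ((\<lambda>x. f x * h x) \<circ> chart_inv c)"
    using smooth_on_mult[OF open_chart_image[OF sA c], of "f \<circ> chart_inv c" "h \<circ> chart_inv c"]
      assms c by (simp add: smooth_function_def comp_def)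
qed

lemma smooth_extend_by_zero:
  assumes c: "c \<in> A" and d: "d \<in> A" and K: "cutoff_support A c K"
    and zero: "\<And>y. y \<in> chart_dom d \<Longrightarrow> y \<notin> chart_inv c ` K \<Longrightarrow> f y = 0"
    and smooth: "smooth_on (chart_map d ` (chart_dom d \<inter> chart_dom c)) (\<lambda>u. f (chart_inv d u))"
  shows "smooth_on (chart_map d ` chart_dom d) (\<lambda>u. f (chart_inv d u))"
proof (rule smooth_on_local)
  fix u assume u: "u \<in> chart_map d ` chart_dom d"
  then obtain y where y: "u = chart_map d y" "y \<in> chart_dom d" by auto
  show "\<exists>T. open T \<and> u \<in> T \<and> smooth_on T (\<lambda>u. f (chart_inv d u))"
  proof (cases "y \<in> chart_dom c")
    case True
    then show ?thesis
      using y smooth open_chart_overlap[OF sA d c]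
      by (intro exI[of _ "chart_map d ` (chart_dom d \<inter> chart_dom c)"]) auto
  next
    case False
    let ?W = "points A - chart_inv c ` K"
    have "openin (atlas_topology A) ?W"
      using K topspace_atlas[OF sA] unfolding cutoff_support_def by (metis openin_diff openin_topspace)
    then have op: "open (chart_map d ` (?W \<inter> chart_dom d))"
      using d openin_atlas_topology[OF sA] by auto
    have "chart_inv c ` K \<subseteq> chart_dom c"
      using K chart_inv_in[OF sA c] unfolding cutoff_support_def by blast
    then have "y \<in> ?W" using False y d by (auto simp: points_def)
    moreover have "smooth_on (chart_map d ` (?W \<inter> chart_dom d)) (\<lambda>u. f (chart_inv d u))"
    proof (rule smooth_on_cong[OF op _ smooth_on_const[of _ 0]])
      fix u assume "u \<in> chart_map d ` (?W \<inter> chart_dom d)"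
      then have "chart_inv d u \<in> ?W \<inter> chart_dom d" by (rule chart_inv_in[OF sA d]) auto
      then show "0 = f (chart_inv d u)" using zero by auto
    qed
    ultimately show ?thesis
      using y op by (intro exI[of _ "chart_map d ` (?W \<inter> chart_dom d)"]) auto
  qed
qed

lemma cutoff_outside:
  assumes c: "c \<in> A" and y: "y \<in> chart_dom c" "y \<notin> chart_inv c ` K"
  shows "chart_map c y \<notin> K"
proof
  assume "chart_map c y \<in> K"
  then have "chart_inv c (chart_map c y) \<in> chart_inv c ` K" by (rule imageI)
  then show False using y chart_inv_chart_map[OF sA c] by simp
qed

lemma smooth_on_chart_overlap:
  assumes c: "c \<in> A" and d: "d \<in> A" and f: "smooth_on (chart_map c ` (chart_dom c \<inter> chart_dom d)) f"
  shows "smooth_on (chart_map d ` (chart_dom d \<inter> chart_dom c)) (\<lambda>u. f (chart_map c (chart_inv d u)))"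
proof (rule smooth_on_compose[OF open_chart_overlap[OF sA d c] open_chart_overlap[OF sA c d] _ f])
  show "smooth_on (chart_map d ` (chart_dom d \<inter> chart_dom c)) (\<lambda>u. chart_map c (chart_inv d u))"
    using smooth_transition[OF sA d c] by (simp add: comp_def)
  show "(\<lambda>u. chart_map c (chart_inv d u)) ` chart_map d ` (chart_dom d \<inter> chart_dom c)
      \<subseteq> chart_map c ` (chart_dom c \<inter> chart_dom d)"
    using chart_inv_in[OF sA d, of _ "chart_dom d \<inter> chart_dom c"] by blast
qed

lemma smooth_chart_function:
  assumes c: "c \<in> A" and K: "cutoff_support A c K" and zero: "\<And>u. u \<notin> K \<Longrightarrow> z u = 0"
    and z: "smooth_on (chart_map c ` chart_dom c) z"
  shows "smooth_function A (chart_function c z)"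
  unfolding smooth_function_def comp_def
proof
  fix d assume d: "d \<in> A"
  show "smooth_on (chart_map d ` chart_dom d) (\<lambda>u. chart_function c z (chart_inv d u))"
  proof (rule smooth_extend_by_zero[OF c d K])
    show "chart_function c z y = 0" if "y \<notin> chart_inv c ` K" for y
      using cutoff_outside[OF c _ that] zero by (simp add: chart_function_def)
    have "smooth_on (chart_map c ` (chart_dom c \<inter> chart_dom d)) z"
      by (rule smooth_on_subset[OF z]) auto
    from smooth_on_chart_overlap[OF c d this]
    show "smooth_on (chart_map d ` (chart_dom d \<inter> chart_dom c))
      (\<lambda>u. chart_function c z (chart_inv d u))"
    proof (rule smooth_on_cong[OF open_chart_overlap[OF sA d c], rotated])
      fix u assume "u \<in> chart_map d ` (chart_dom d \<inter> chart_dom c)"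
      then have "chart_inv d u \<in> chart_dom d \<inter> chart_dom c" by (rule chart_inv_in[OF sA d]) auto
      then show "z (chart_map c (chart_inv d u)) = chart_function c z (chart_inv d u)"
        by (simp add: chart_function_def)
    qed
  qed
qed

lemma chart_field_in: "c \<in> A \<Longrightarrow> chart_field A c Z y \<in> tangent_space A y"
  unfolding chart_field_def by (simp add: zero_in_tangent[OF sA] coord_vec_in[OF sA] charts_at_def)

lemma chart_field_apply:
  "c \<in> charts_at A y \<Longrightarrow> chart_field A c Z y c = Z (chart_map c y)"
  unfolding chart_field_def by (simp add: coord_vec_apply[OF sA] charts_at_def)

text \<open>In another chart \<open>d\<close> the component is the derivative of the transition
  applied to \<open>Z\<close>, which is smooth on the overlap; outside the support it
  vanishes.\<close>

lemma vector_field_chart_field: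
  assumes c: "c \<in> A" and K: "cutoff_support A c K" and zero: "\<And>u. u \<notin> K \<Longrightarrow> Z u = 0"
    and Z: "smooth_on (chart_map c ` chart_dom c) Z"
  shows "chart_field A c Z \<in> vector_fields A"
proof (rule vector_fieldI[OF chart_field_in[OF c]])
  fix d assume d: "d \<in> A"
  let ?U = "chart_map c ` (chart_dom c \<inter> chart_dom d)"
  let ?T = "\<lambda>u. frechet_derivative (chart_map d \<circ> chart_inv c) (at u)"
  show "smooth_on (chart_map d ` chart_dom d) (\<lambda>u. chart_field A c Z (chart_inv d u) d)"
  proof (rule smooth_extend_by_zero[OF c d K, where f = "\<lambda>y. chart_field A c Z y d"])
    show "chart_field A c Z y d = 0" if "y \<notin> chart_inv c ` K" for y
    proof (cases "y \<in> chart_dom c")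
      case True
      \<comment> \<open>Writing the vector as a multiple by 0 lets linearity in the component show
        that component 0 gives the zero vector in every chart.\<close>
      then have "chart_field A c Z y = 0 *\<^sub>R coord_vec A c 0 y"
        using cutoff_outside[OF c True that] zero
          coord_vec_scaleR[OF sA, of c y 0 0] c by (simp add: chart_field_def charts_at_def)
      then show ?thesis by simp
    qed (simp add: chart_field_def)
    have "smooth_on ?U (\<lambda>u. ?T u (Z u))"
    proof (rule smooth_on_linear_apply[OF open_chart_overlap[OF sA c d], where L = ?T])
      show "linear (?T u)" if "u \<in> ?U" for u
        by (rule has_derivative_linear[OF smooth_on_has_derivative[OF smooth_transition[OF sA c d] that]])
      show "smooth_on ?U (\<lambda>x. ?T x b)" for b
        by (rule smooth_on_frechet_derivative[OF smooth_transition[OF sA c d]])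
      show "smooth_on ?U Z" by (rule smooth_on_subset[OF Z]) auto
    qed
    from smooth_on_chart_overlap[OF c d this]
    show "smooth_on (chart_map d ` (chart_dom d \<inter> chart_dom c))
      (\<lambda>u. chart_field A c Z (chart_inv d u) d)"
    proof (rule smooth_on_cong[OF open_chart_overlap[OF sA d c], rotated])
      fix u assume "u \<in> chart_map d ` (chart_dom d \<inter> chart_dom c)"
      then have y: "chart_inv d u \<in> chart_dom d \<inter> chart_dom c" by (rule chart_inv_in[OF sA d]) auto
      then show "?T (chart_map c (chart_inv d u)) (Z (chart_map c (chart_inv d u))) =
          chart_field A c Z (chart_inv d u) d"
        using d by (simp add: chart_field_def coord_vec_def charts_at_def chart_change_def)
    qed
  qed
qed

end

section \<open>Cutoffs at a point and fields with prescribed first-order data\<close>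

locale manifold =
  fixes A :: "('m, 'e::euclidean_space) chart set"
  assumes mA: "smooth_manifold A"
begin

lemma sA: "smooth_atlas A"
  using mA by (simp add: smooth_manifold_def)

lemmas sTA = smooth_atlas_tangent_atlas[OF sA]

text \<open>A closed ball in the chart image is compact, hence so is its image in the manifold, and
  compact subsets of a Hausdorff space are closed. A bump function vanishing off this ball is a
  cutoff.\<close>

lemma exists_chart_cutoff:
  assumes "c \<in> charts_at A x"
  obtains U \<rho> where "chart_cutoff A c x U \<rho>"
proof -
  have c: "c \<in> A" "x \<in> chart_dom c" using assms by (auto simp: charts_at_def)
  obtain r where r: "r > 0" "cball (chart_map c x) r \<subseteq> chart_map c ` chart_dom c"
    using open_chart_image[OF sA c(1)] c(2) open_contains_cball by (metis imageI)
  let ?K = "cball (chart_map c x) r"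
  have "compactin (top_of_set (chart_map c ` chart_dom c)) ?K"
    using r by (simp add: compactin_subtopology)
  then have "compactin (atlas_topology A) (chart_inv c ` ?K)"
    by (rule image_compactin[OF _ chart_inv_continuous[OF sA c(1)]])
  then have K: "cutoff_support A c ?K"
    using mA r unfolding smooth_manifold_def cutoff_support_def by (metis compactin_imp_closedin)
  obtain \<rho> :: "'e \<Rightarrow> real" and s where \<rho>: "smooth_on UNIV \<rho>" "0 < s"
    "\<And>u. dist (chart_map c x) u < s \<Longrightarrow> \<rho> u = 1" "\<And>u. dist (chart_map c x) u \<ge> r \<Longrightarrow> \<rho> u = 0"
    using exists_bump[OF r(1)] by metis
  let ?U = "ball (chart_map c x) s \<inter> chart_map c ` chart_dom c"
  have "chart_cutoff A c x ?U \<rho>"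
    unfolding chart_cutoff_def
  proof (intro conjI exI[of _ ?K] allI impI)
    show "\<rho> u = 0" if "u \<notin> ?K" for u using that \<rho>(4) by simp
    show "open ?U" by (intro open_Int open_ball open_chart_image[OF sA c(1)])
  qed (use \<rho> K c in auto)
  then show ?thesis by (rule that)
qed

lemma cutoff_chart_function:
  assumes c: "c \<in> A" and \<rho>: "chart_cutoff A c x U \<rho>" and z: "smooth_on (chart_map c ` chart_dom c) z"
  shows "smooth_function A (chart_function c (\<lambda>u. \<rho> u * z u))"
proof -
  obtain K where K: "cutoff_support A c K" "\<And>u. u \<notin> K \<Longrightarrow> \<rho> u = 0"
    using \<rho> unfolding chart_cutoff_def by blast
  have "smooth_on (chart_map c ` chart_dom c) \<rho>"
    using \<rho> smooth_on_subset unfolding chart_cutoff_def by blast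
  then show ?thesis
    using K by (intro smooth_chart_function[OF sA c K(1)] smooth_on_mult[OF open_chart_image[OF sA c]] z) auto
qed

lemma cutoff_chart_field:
  assumes c: "c \<in> A" and \<rho>: "chart_cutoff A c x U \<rho>" and Z: "smooth_on (chart_map c ` chart_dom c) Z"
  shows "chart_field A c (\<lambda>u. \<rho> u *\<^sub>R Z u) \<in> vector_fields A"
proof -
  obtain K where K: "cutoff_support A c K" "\<And>u. u \<notin> K \<Longrightarrow> \<rho> u = 0"
    using \<rho> unfolding chart_cutoff_def by blast
  have "smooth_on (chart_map c ` chart_dom c) \<rho>"
    using \<rho> smooth_on_subset unfolding chart_cutoff_def by blast
  then show ?thesis
    using K by (intro vector_field_chart_field[OF sA c K(1)] smooth_on_scaleR[OF open_chart_image[OF sA c]] Z) auto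
qed

lemma cutoff_at: "chart_cutoff A c x U \<rho> \<Longrightarrow> \<rho> (chart_map c x) = 1"
  unfolding chart_cutoff_def by blast

lemma cutoff_has_derivative:
  assumes c: "c \<in> A" and \<rho>: "chart_cutoff A c x U \<rho>"
    and F: "(F has_derivative F') (at (chart_map c x))"
    and eq: "\<And>u. u \<in> U \<Longrightarrow> \<rho> u = 1 \<Longrightarrow> chart_map c (chart_inv c u) = u \<Longrightarrow> chart_inv c u \<in> chart_dom c \<Longrightarrow> F u = H u"
  shows "(H has_derivative F') (at (chart_map c x))"
proof (rule has_derivative_transform_within_open[OF F])
  show "open U" "chart_map c x \<in> U" using \<rho> by (auto simp: chart_cutoff_def)
  show "F u = H u" if u: "u \<in> U" for u
  proof (rule eq[OF u])
    have "u \<in> chart_map c ` chart_dom c" "\<rho> u = 1" using \<rho> u by (auto simp: chart_cutoff_def)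
    then show "\<rho> u = 1" "chart_map c (chart_inv c u) = u" "chart_inv c u \<in> chart_dom c"
      using chart_map_chart_inv[OF sA, of u c "chart_dom c"] chart_inv_in[OF sA c, of u "chart_dom c"] by auto
  qed
qed

text \<open>The field is an affine map in the chart, multiplied by a cutoff. It realises any value
  and any linear derivative at \<open>x\<close>, as needed to produce horizontal vectors.\<close>

lemma exists_field_with_derivative:
  assumes c: "c \<in> charts_at A x" and L: "linear L"
  obtains Y where "Y \<in> vector_fields A" "Y x c = e"
    "frechet_derivative (\<lambda>u. Y (chart_inv c u) c) (at (chart_map c x)) = L"
proof -
  have c': "c \<in> A" "x \<in> chart_dom c" using c by (auto simp: charts_at_def)
  obtain U \<rho> where \<rho>: "chart_cutoff A c x U \<rho>" using exists_chart_cutoff[OF c] .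
  have bl: "bounded_linear L" using L by (simp add: linear_conv_bounded_linear)
  let ?Z = "\<lambda>u. e + L (u - chart_map c x)"
  define Y where "Y = chart_field A c (\<lambda>u. \<rho> u *\<^sub>R ?Z u)"
  have opn: "open (chart_map c ` chart_dom c)" by (rule open_chart_image[OF sA c'(1)])
  have "smooth_on (chart_map c ` chart_dom c) ?Z"
    by (intro smooth_on_add[OF opn] smooth_on_linear_compose[OF bl opn] smooth_on_diff[OF opn]
        smooth_on_const smooth_on_bounded_linear[OF bounded_linear_ident])
  then have Y: "Y \<in> vector_fields A" unfolding Y_def by (rule cutoff_chart_field[OF c'(1) \<rho>])
  have Yx: "Y x c = e"
    unfolding Y_def using chart_field_apply[OF sA c] cutoff_at[OF \<rho>] linear_0[OF L] by simp
  have "(?Z has_derivative L) (at (chart_map c x))"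
    using L by (auto intro!: derivative_eq_intros bounded_linear.has_derivative[OF bl])
  then have "((\<lambda>u. Y (chart_inv c u) c) has_derivative L) (at (chart_map c x))"
    by (rule cutoff_has_derivative[OF c'(1) \<rho>])
      (use c' chart_field_apply[OF sA] in \<open>simp add: Y_def charts_at_def\<close>)
  then show ?thesis using that[OF Y Yx] frechet_derivative_at by metis
qed

end

section \<open>Connection coefficients\<close>

definition connection_coefficients ::
    "('m, 'e::euclidean_space) chart set \<Rightarrow>
      (('m \<Rightarrow> ('m, 'e) tvec) \<Rightarrow> ('m \<Rightarrow> ('m, 'e) tvec) \<Rightarrow> 'm \<Rightarrow> ('m, 'e) tvec) \<Rightarrow>
      ('m, 'e) chart \<Rightarrow> 'm \<Rightarrow> ('e \<Rightarrow> 'e \<Rightarrow> 'e) \<Rightarrow> bool"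
  where "connection_coefficients A D c x G \<longleftrightarrow>
    (\<forall>e. linear (G e)) \<and> (\<forall>e. linear (\<lambda>e'. G e' e)) \<and>
    (\<forall>X\<in>vector_fields A. \<forall>Y\<in>vector_fields A. D X Y x c =
      frechet_derivative (\<lambda>u. Y (chart_inv c u) c) (at (chart_map c x)) (X x c) + G (X x c) (Y x c))"

text \<open>The choice leaves no freedom on a manifold: fields attain all components at
  \<open>x\<close>, so the defining formula fixes every value. This is why a pointwise choice can
  still depend smoothly on the point.\<close>

definition christoffel ::
    "('m, 'e::euclidean_space) chart set \<Rightarrow>
      (('m \<Rightarrow> ('m, 'e) tvec) \<Rightarrow> ('m \<Rightarrow> ('m, 'e) tvec) \<Rightarrow> 'm \<Rightarrow> ('m, 'e) tvec) \<Rightarrow>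
      ('m, 'e) chart \<Rightarrow> 'm \<Rightarrow> 'e \<Rightarrow> 'e \<Rightarrow> 'e"
  where "christoffel A D c x = (SOME G. connection_coefficients A D c x G)"

locale manifold_connection = manifold A
  for A :: "('m, 'e::euclidean_space) chart set" +
  fixes D :: "('m \<Rightarrow> ('m, 'e) tvec) \<Rightarrow> ('m \<Rightarrow> ('m, 'e) tvec) \<Rightarrow> 'm \<Rightarrow> ('m, 'e) tvec"
  assumes D: "linear_connection A D"
begin

lemma connection_field: "X \<in> vector_fields A \<Longrightarrow> Y \<in> vector_fields A \<Longrightarrow> D X Y \<in> vector_fields A"
  and connection_add1: "X \<in> vector_fields A \<Longrightarrow> X' \<in> vector_fields A \<Longrightarrow> Y \<in> vector_fields A \<Longrightarrow>
    D (X + X') Y = D X Y + D X' Y"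
  and connection_add2: "X \<in> vector_fields A \<Longrightarrow> Y \<in> vector_fields A \<Longrightarrow> Y' \<in> vector_fields A \<Longrightarrow>
    D X (Y + Y') = D X Y + D X Y'"
  using D unfolding linear_connection_def by blast+

lemma connection_scale1:
  assumes "smooth_function A f" "X \<in> vector_fields A" "Y \<in> vector_fields A"
  shows "D (\<lambda>x. f x *\<^sub>R X x) Y x = f x *\<^sub>R D X Y x"
proof -
  have "D (\<lambda>x. f x *\<^sub>R X x) Y = (\<lambda>x. f x *\<^sub>R D X Y x)"
    using D assms unfolding linear_connection_def by blast
  then show ?thesis by (simp add: fun_eq_iff)
qed

lemma connection_scale2:
  assumes "smooth_function A f" "X \<in> vector_fields A" "Y \<in> vector_fields A"
  shows "D X (\<lambda>x. f x *\<^sub>R Y x) x = vec_deriv A x (X x) f *\<^sub>R Y x + f x *\<^sub>R D X Y x"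
proof -
  have "D X (\<lambda>x. f x *\<^sub>R Y x) = (\<lambda>x. vec_deriv A x (X x) f *\<^sub>R Y x + f x *\<^sub>R D X Y x)"
    using D assms unfolding linear_connection_def by blast
  then show ?thesis by (simp add: fun_eq_iff)
qed

lemma connection_sum1:
  assumes "\<And>i. i \<in> I \<Longrightarrow> X i \<in> vector_fields A" "Y \<in> vector_fields A"
  shows "D (\<Sum>i\<in>I. X i) Y = (\<Sum>i\<in>I. D (X i) Y)"
proof -
  have "D (0 + 0) Y = D 0 Y + D 0 Y"
    by (rule connection_add1) (use vector_field_zero[OF sA] assms in \<open>simp_all add: zero_fun_def\<close>)
  then have 0: "D 0 Y = 0" by simp
  show ?thesis using assms(1)
    by (induction I rule: infinite_finite_induct)
      (simp_all add: 0 connection_add1[OF _ vector_field_sum[OF sA] assms(2)])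
qed

lemma connection_sum2:
  assumes "\<And>i. i \<in> I \<Longrightarrow> Y i \<in> vector_fields A" "X \<in> vector_fields A"
  shows "D X (\<Sum>i\<in>I. Y i) = (\<Sum>i\<in>I. D X (Y i))"
proof -
  have "D X (0 + 0) = D X 0 + D X 0"
    by (rule connection_add2) (use vector_field_zero[OF sA] assms in \<open>simp_all add: zero_fun_def\<close>)
  then have 0: "D X 0 = 0" by simp
  show ?thesis using assms(1)
    by (induction I rule: infinite_finite_induct)
      (simp_all add: 0 connection_add2[OF assms(2) _ vector_field_sum[OF sA]])
qed

text \<open>With a cutoff \<open>r\<close>, both \<open>r X\<^sub>b\<close> and \<open>r \<partial>\<^sub>b\<close> extend to the manifold and \<open>r\<^sup>2 X\<close> is the sum of
  their products; since \<open>r = 1\<close> near \<open>x\<close>, replacing \<open>X\<close> by \<open>r\<^sup>2 X\<close> does not affect \<open>D\<close> at \<open>x\<close>.\<close>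

lemma exists_connection_coefficients:
  assumes c: "c \<in> charts_at A x"
  shows "\<exists>G. connection_coefficients A D c x G"
proof -
  have c': "c \<in> A" "x \<in> chart_dom c" using c by (auto simp: charts_at_def)
  obtain U \<rho> where \<rho>: "chart_cutoff A c x U \<rho>" using exists_chart_cutoff[OF c] .
  let ?S = "chart_map c ` chart_dom c"
  have opn: "open ?S" by (rule open_chart_image[OF sA c'(1)])
  define E where "E b = chart_field A c (\<lambda>u. \<rho> u *\<^sub>R b)" for b
  define f where "f X b = chart_function c (\<lambda>u. \<rho> u * (X (chart_inv c u) c \<bullet> b))" for X :: "'m \<Rightarrow> ('m,'e) tvec" and b
  define r where "r = chart_function c (\<lambda>u. \<rho> u * 1)"
  have E: "E b \<in> vector_fields A" for b
    unfolding E_def by (rule cutoff_chart_field[OF c'(1) \<rho> smooth_on_const])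
  have f: "smooth_function A (f X b)" if "X \<in> vector_fields A" for X b
    unfolding f_def
    by (rule cutoff_chart_function[OF c'(1) \<rho> smooth_on_linear_compose[OF bounded_linear_inner_left opn]])
      (rule vector_field_smooth[OF that c'(1)])
  have r: "smooth_function A r"
    unfolding r_def by (rule cutoff_chart_function[OF c'(1) \<rho> smooth_on_const])
  have rr: "smooth_function A (\<lambda>y. r y * r y)" by (rule smooth_function_mult[OF sA r r])
  have rx: "r x = 1" using c' cutoff_at[OF \<rho>] by (simp add: r_def chart_function_def)
  have inv: "chart_inv c (chart_map c y) = y" if "y \<in> chart_dom c" for y
    by (rule chart_inv_chart_map[OF sA c'(1) that])
  have fx: "f X b x = X x c \<bullet> b" for X b
    using c' cutoff_at[OF \<rho>] inv by (simp add: f_def chart_function_def)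
  have Ex: "E b x c = b" for b
    unfolding E_def using chart_field_apply[OF sA c] cutoff_at[OF \<rho>] by simp
  have fE: "(\<lambda>y. f X b y *\<^sub>R E b y) \<in> vector_fields A" if "X \<in> vector_fields A" for X b
    by (rule vector_field_scale[OF sA f[OF that] E])
  have expand: "(\<lambda>y. (r y * r y) *\<^sub>R X y) = (\<Sum>b\<in>Basis. (\<lambda>y. f X b y *\<^sub>R E b y))"
    if X: "X \<in> vector_fields A" for X
  proof
    fix y
    show "(r y * r y) *\<^sub>R X y = (\<Sum>b\<in>Basis. (\<lambda>y. f X b y *\<^sub>R E b y)) y"
    proof (cases "y \<in> chart_dom c")
      case True
      then have cy: "c \<in> charts_at A y" using c' by (simp add: charts_at_def)
      show ?thesis
      proof (rule tangent_space_eqI[OF sA cy])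
        show "(r y * r y) *\<^sub>R X y \<in> tangent_space A y"
          by (rule vector_field_in[OF vector_field_scale[OF sA rr X]])
        show "(\<Sum>b\<in>Basis. (\<lambda>y. f X b y *\<^sub>R E b y)) y \<in> tangent_space A y"
          by (rule vector_field_in[OF vector_field_sum[OF sA fE[OF X]]])
        let ?s = "\<rho> (chart_map c y)"
        have "(\<Sum>b\<in>Basis. (\<lambda>y. f X b y *\<^sub>R E b y)) y c =
            (\<Sum>b\<in>Basis. (?s * (X y c \<bullet> b)) *\<^sub>R (?s *\<^sub>R b))"
          using True inv chart_field_apply[OF sA cy]
          by (simp add: sum_fun_apply f_def E_def chart_function_def)
        also have "\<dots> = (?s * ?s) *\<^sub>R (\<Sum>b\<in>Basis. (X y c \<bullet> b) *\<^sub>R b)"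
          unfolding scaleR_sum_right by (rule sum.cong) simp_all
        finally show "((r y * r y) *\<^sub>R X y) c = (\<Sum>b\<in>Basis. (\<lambda>y. f X b y *\<^sub>R E b y)) y c"
          using True by (simp add: euclidean_representation r_def chart_function_def)
      qed
    next
      case False
      then show ?thesis by (simp add: sum_fun_apply r_def f_def chart_function_def)
    qed
  qed
  \<comment> \<open>Tensoriality in the direction: only the value of \<open>X\<close> at
    \<open>x\<close> enters.\<close>
  have step1: "D X Y x = (\<Sum>b\<in>Basis. (X x c \<bullet> b) *\<^sub>R D (E b) Y x)"
    if X: "X \<in> vector_fields A" and Y: "Y \<in> vector_fields A" for X Y
  proof -
    have "D X Y x = D (\<lambda>y. (r y * r y) *\<^sub>R X y) Y x"
      using connection_scale1[OF rr X Y] rx by simp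
    also have "\<dots> = (\<Sum>b\<in>Basis. D (\<lambda>y. f X b y *\<^sub>R E b y) Y) x"
      unfolding expand[OF X] by (simp add: connection_sum1[OF fE[OF X] Y])
    also have "\<dots> = (\<Sum>b\<in>Basis. (X x c \<bullet> b) *\<^sub>R D (E b) Y x)"
      by (simp add: sum_fun_apply connection_scale1[OF f[OF X] E Y] fx)
    finally show ?thesis .
  qed
  \<comment> \<open>In the second slot the Leibniz terms matter. The derivative of
    \<open>r * r\<close> vanishes, as \<open>r\<close> is 1 near \<open>x\<close>, while those of
    the coefficients \<open>f Y b\<close> add up to the derivative of the components of
    \<open>Y\<close>.\<close>
  have step2: "D X Y x c = frechet_derivative (\<lambda>u. Y (chart_inv c u) c) (at (chart_map c x)) (X x c)
      + (\<Sum>b\<in>Basis. (Y x c \<bullet> b) *\<^sub>R D X (E b) x c)"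
    if X: "X \<in> vector_fields A" and Y: "Y \<in> vector_fields A" for X Y
  proof -
    let ?Y' = "frechet_derivative (\<lambda>u. Y (chart_inv c u) c) (at (chart_map c x))"
    note Xx = vector_field_in[OF X, of x]
    have "((\<lambda>y. r y * r y) \<circ> chart_inv c has_derivative (\<lambda>v. 0)) (at (chart_map c x))"
      by (rule cutoff_has_derivative[OF c'(1) \<rho> has_derivative_const[of 1]])
        (simp add: r_def chart_function_def)
    then have rr': "vec_deriv A x (X x) (\<lambda>y. r y * r y) = 0"
      using vec_deriv_eq[OF sA c Xx] by blast
    have f': "vec_deriv A x (X x) (f Y b) = ?Y' (X x c) \<bullet> b" for b
    proof -
      have "((\<lambda>u. Y (chart_inv c u) c) has_derivative ?Y') (at (chart_map c x))"
        by (rule smooth_on_has_derivative[OF vector_field_smooth[OF Y c'(1)]]) (use c' in auto)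
      then have "((\<lambda>u. Y (chart_inv c u) c \<bullet> b) has_derivative (\<lambda>v. ?Y' v \<bullet> b)) (at (chart_map c x))"
        by (rule has_derivative_inner_left)
      then have "(f Y b \<circ> chart_inv c has_derivative (\<lambda>v. ?Y' v \<bullet> b)) (at (chart_map c x))"
        by (rule cutoff_has_derivative[OF c'(1) \<rho>]) (simp add: f_def chart_function_def)
      then show ?thesis by (rule vec_deriv_eq[OF sA c Xx])
    qed
    have "D X Y x = D X (\<lambda>y. (r y * r y) *\<^sub>R Y y) x"
      using connection_scale2[OF rr X Y] rx rr' by simp
    also have "\<dots> = (\<Sum>b\<in>Basis. D X (\<lambda>y. f Y b y *\<^sub>R E b y)) x"
      unfolding expand[OF Y] by (simp add: connection_sum2[OF fE[OF Y] X])
    also have "\<dots> = (\<Sum>b\<in>Basis. (?Y' (X x c) \<bullet> b) *\<^sub>R E b x + (Y x c \<bullet> b) *\<^sub>R D X (E b) x)"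
      by (simp add: sum_fun_apply connection_scale2[OF f[OF Y] X E] fx f')
    finally have "D X Y x c = (\<Sum>b\<in>Basis. (?Y' (X x c) \<bullet> b) *\<^sub>R b + (Y x c \<bullet> b) *\<^sub>R D X (E b) x c)"
      by (simp add: sum_fun_apply Ex)
    then show ?thesis by (simp add: sum.distrib euclidean_representation)
  qed
  \<comment> \<open>The coefficients are the components of \<open>D (E a) (E b)\<close> at
    \<open>x\<close>: \<open>step2\<close> expands in the second slot, and \<open>step1\<close>
    applied to \<open>D X (E b)\<close> in the first.\<close>
  define G where "G e e' = (\<Sum>b\<in>Basis. (e' \<bullet> b) *\<^sub>R (\<Sum>a\<in>Basis. (e \<bullet> a) *\<^sub>R D (E a) (E b) x c))" for e e'
  have "linear (G e)" for e
    unfolding G_def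
    by (intro linearI) (simp_all add: inner_add_left scaleR_add_left distrib_right sum.distrib scaleR_sum_right mult.assoc)
  moreover have "linear (\<lambda>e. G e e')" for e'
    unfolding G_def
    by (intro linearI) (simp_all add: inner_add_left scaleR_add_left scaleR_add_right sum.distrib scaleR_sum_right mult.left_commute)
  moreover have "D X Y x c = frechet_derivative (\<lambda>u. Y (chart_inv c u) c) (at (chart_map c x)) (X x c)
      + G (X x c) (Y x c)" if X: "X \<in> vector_fields A" and Y: "Y \<in> vector_fields A" for X Y
    unfolding step2[OF X Y] G_def step1[OF X E] by (simp add: sum_fun_apply)
  ultimately show ?thesis unfolding connection_coefficients_def by blast
qed

lemma christoffel:
  assumes "c \<in> charts_at A x"
  shows "linear (christoffel A D c x e)" "linear (\<lambda>e'. christoffel A D c x e' e)"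
    "X \<in> vector_fields A \<Longrightarrow> Y \<in> vector_fields A \<Longrightarrow> D X Y x c =
      frechet_derivative (\<lambda>u. Y (chart_inv c u) c) (at (chart_map c x)) (X x c)
        + christoffel A D c x (X x c) (Y x c)"
proof -
  have "connection_coefficients A D c x (christoffel A D c x)"
    unfolding christoffel_def by (rule someI_ex[OF exists_connection_coefficients[OF assms]])
  then show "linear (christoffel A D c x e)" "linear (\<lambda>e'. christoffel A D c x e' e)"
    "X \<in> vector_fields A \<Longrightarrow> Y \<in> vector_fields A \<Longrightarrow> D X Y x c =
      frechet_derivative (\<lambda>u. Y (chart_inv c u) c) (at (chart_map c x)) (X x c)
        + christoffel A D c x (X x c) (Y x c)"
    unfolding connection_coefficients_def by blast+
qed

text \<open>Fields with constant components \<open>e\<close> and \<open>e'\<close> on a plateau have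
  derivative 0 there, so the Christoffel term equals the component of \<open>D\<close> of these two
  fields, which is a smooth field.\<close>

lemma smooth_christoffel:
  assumes c: "c \<in> A"
  shows "smooth_on (chart_map c ` chart_dom c) (\<lambda>u. christoffel A D c (chart_inv c u) e e')"
proof (rule smooth_on_local)
  fix u assume "u \<in> chart_map c ` chart_dom c"
  then obtain x where x: "x \<in> chart_dom c" "u = chart_map c x" by auto
  then obtain U \<rho> where \<rho>: "chart_cutoff A c x U \<rho>"
    using exists_chart_cutoff[of c x] c by (auto simp: charts_at_def)
  have U: "open U" "u \<in> U" "U \<subseteq> chart_map c ` chart_dom c" "\<And>w. w \<in> U \<Longrightarrow> \<rho> w = 1"
    using \<rho> x by (auto simp: chart_cutoff_def)
  define E where "E b = chart_field A c (\<lambda>u. \<rho> u *\<^sub>R b)" for b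
  have E: "E b \<in> vector_fields A" for b
    unfolding E_def by (rule cutoff_chart_field[OF c \<rho> smooth_on_const])
  have "smooth_on U (\<lambda>w. D (E e) (E e') (chart_inv c w) c)"
    by (rule smooth_on_subset[OF vector_field_smooth[OF connection_field[OF E E] c] U(3)])
  then have "smooth_on U (\<lambda>u. christoffel A D c (chart_inv c u) e e')"
  proof (rule smooth_on_cong[OF U(1), rotated])
    fix w assume w: "w \<in> U"
    define y where "y = chart_inv c w"
    have y: "y \<in> chart_dom c" "chart_map c y = w"
      using w U(3) chart_inv_in[OF sA c, of w "chart_dom c"]
        chart_map_chart_inv[OF sA, of w c "chart_dom c"] unfolding y_def by auto
    then have cy: "c \<in> charts_at A y" using c by (simp add: charts_at_def)
    have Ey: "E b y c = b" for b
      unfolding E_def using chart_field_apply[OF sA cy] y w U(4) by simp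
    \<comment> \<open>The fields must stay fixed while the point moves, so the cutoff made for
      \<open>x\<close> is reused at every point of its plateau.\<close>
    have \<rho>': "chart_cutoff A c y U \<rho>" using \<rho> y w by (simp add: chart_cutoff_def)
    have "((\<lambda>u. E e' (chart_inv c u) c) has_derivative (\<lambda>v. 0)) (at (chart_map c y))"
      by (rule cutoff_has_derivative[OF c \<rho>' has_derivative_const[of e']])
        (use c chart_field_apply[OF sA] in \<open>simp add: E_def charts_at_def\<close>)
    then have "frechet_derivative (\<lambda>u. E e' (chart_inv c u) c) (at (chart_map c y)) = (\<lambda>v. 0)"
      using frechet_derivative_at by metis
    then show "D (E e) (E e') (chart_inv c w) c = christoffel A D c (chart_inv c w) e e'"
      using christoffel(3)[OF cy E E] Ey by (simp add: y_def[symmetric])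
  qed
  then show "\<exists>T. open T \<and> u \<in> T \<and> smooth_on T (\<lambda>u. christoffel A D c (chart_inv c u) e e')"
    using U by blast
qed

end

section \<open>Horizontal and vertical lifts\<close>

context
  fixes A :: "('m, 'e::euclidean_space) chart set"
  assumes sA: "smooth_atlas A"
begin

lemma tangent_chart_at:
  "c \<in> charts_at A x \<Longrightarrow> y \<in> tangent_space A x \<Longrightarrow>
    tangent_chart A c \<in> charts_at (tangent_atlas A) (x, y)"
  by (simp add: charts_at_tangent_atlas[OF sA])

text \<open>In a chart and its bundle chart a section is the graph map from u to the pair of u and
  the component of Y at u, which gives the components at once. Membership requires every bundle
  chart and is obtained from the matching one by
  \<open>has_derivative_into_chart_change\<close>.\<close>

lemma section_differential:
  assumes Y: "Y \<in> vector_fields A" and v: "v \<in> tangent_space A x" and c: "c \<in> charts_at A x"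
  defines "h \<equiv> differential A (tangent_atlas A) (\<lambda>x. (x, Y x)) x v"
  shows "h \<in> tangent_space (tangent_atlas A) (x, Y x)"
    and "h (tangent_chart A c) =
      (v c, frechet_derivative (\<lambda>u. Y (chart_inv c u) c) (at (chart_map c x)) (v c))"
proof -
  note sTA = smooth_atlas_tangent_atlas[OF sA]
  let ?F = "\<lambda>x. (x, Y x)"
  define Y' where "Y' c = frechet_derivative (\<lambda>u. Y (chart_inv c u) c) (at (chart_map c x))" for c
  have der: "(chart_map (tangent_chart A c) \<circ> ?F \<circ> chart_inv c has_derivative (\<lambda>e. (e, Y' c e)))
      (at (chart_map c x))" if c: "c \<in> charts_at A x" for c
  proof -
    have c': "c \<in> A" "x \<in> chart_dom c" using c by (auto simp: charts_at_def)
    have "((\<lambda>u. (u, Y (chart_inv c u) c)) has_derivative (\<lambda>e. (e, Y' c e))) (at (chart_map c x))"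
      unfolding Y'_def
      by (intro has_derivative_Pair has_derivative_ident
          smooth_on_has_derivative[OF vector_field_smooth[OF Y c'(1)]]) (use c' in auto)
    then show ?thesis
      by (rule has_derivative_transform_within_open[OF _ open_chart_image[OF sA c'(1)]])
        (use c' chart_map_chart_inv[OF sA, of _ c "chart_dom c"] in
          \<open>auto simp: chart_map_tangent_chart[OF sA]\<close>)
  qed
  have hc: "h (tangent_chart A c) = (v c, Y' c (v c))" if "c \<in> charts_at A x" for c
    unfolding h_def
    by (rule differential_eq[OF sA that v tangent_chart_at[OF that vector_field_in[OF Y]] der[OF that]])
  then show "h (tangent_chart A c) =
      (v c, frechet_derivative (\<lambda>u. Y (chart_inv c u) c) (at (chart_map c x)) (v c))"
    using c by (simp add: Y'_def)
  show "h \<in> tangent_space (tangent_atlas A) (x, Y x)"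
  proof (rule tangent_spaceI[OF sTA])
    show "h C = 0" if "C \<notin> charts_at (tangent_atlas A) (x, Y x)" for C
      using that by (simp add: h_def differential_def Let_def)
    fix C C' assume C: "C \<in> charts_at (tangent_atlas A) (x, Y x)"
      and C': "C' \<in> charts_at (tangent_atlas A) (x, Y x)"
    obtain c where c: "c \<in> charts_at A x" "C = tangent_chart A c"
      using C by (auto simp: charts_at_tangent_atlas[OF sA] split: if_splits)
    have c': "c \<in> A" "x \<in> chart_dom c" using c by (auto simp: charts_at_def)
    have a: "(?F \<circ> chart_inv c) (chart_map c x) = (x, Y x)"
      using chart_inv_chart_map[OF sA c'] by simp
    have sub: "(?F \<circ> chart_inv c) ` chart_map c ` chart_dom c \<subseteq> chart_dom C"
      using chart_inv_chart_map[OF sA c'(1)] vector_field_in[OF Y]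
      by (auto simp: c chart_dom_tangent_chart[OF sA])
    have "(chart_map C' \<circ> (?F \<circ> chart_inv c) has_derivative
        (\<lambda>e. chart_change C C' ((?F \<circ> chart_inv c) (chart_map c x)) (e, Y' c e))) (at (chart_map c x))"
      by (rule has_derivative_into_chart_change[OF sTA _ _ open_chart_image[OF sA c'(1)] _ sub])
        (use C C' c c' der[OF c(1)] in \<open>simp_all only: a comp_assoc imageI\<close>)
    then have "(chart_map C' \<circ> ?F \<circ> chart_inv c has_derivative
        (\<lambda>e. chart_change C C' (x, Y x) (e, Y' c e))) (at (chart_map c x))"
      by (simp only: a comp_assoc)
    from differential_eq[OF sA c(1) v C' this]
    show "h C' = chart_change C C' (x, Y x) (h C)"
      by (simp add: h_def[symmetric] c hc)
  qed
qed

text \<open>In bundle coordinates the projection is the first coordinate. Prescribing the projection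
  of a vector thus prescribes the first half of its components.\<close>

lemma differential_fst:
  assumes c: "c \<in> charts_at A x" and y: "y \<in> tangent_space A x"
    and h: "h \<in> tangent_space (tangent_atlas A) (x, y)"
  shows "differential (tangent_atlas A) A fst (x, y) h = coord_vec A c (fst (h (tangent_chart A c))) x"
proof
  note sTA = smooth_atlas_tangent_atlas[OF sA]
  let ?C = "tangent_chart A c" and ?a = "(x, y)"
  have c': "c \<in> A" "x \<in> chart_dom c" using c by (auto simp: charts_at_def)
  have C: "?C \<in> charts_at (tangent_atlas A) ?a" by (rule tangent_chart_at[OF c y])
  let ?S = "chart_map ?C ` chart_dom ?C"
  have C': "?C \<in> tangent_atlas A" "?a \<in> chart_dom ?C" using C by (auto simp: charts_at_def)
  have inv: "chart_inv ?C (chart_map ?C ?a) = ?a" by (rule chart_inv_chart_map[OF sTA C'])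
  have S: "open ?S" by (rule open_chart_image[OF sTA C'(1)])
  have into: "chart_inv ?C z \<in> chart_dom ?C" "chart_map ?C (chart_inv ?C z) = z" if "z \<in> ?S" for z
    using chart_inv_in[OF sTA C'(1) that order_refl] chart_map_chart_inv[OF sTA that order_refl] by auto
  fix d
  show "differential (tangent_atlas A) A fst ?a h d = coord_vec A c (fst (h ?C)) x d"
  proof (cases "d \<in> charts_at A x")
    case True
    have "(fst has_derivative fst) (at (chart_map ?C ?a))"
      by (rule bounded_linear_imp_has_derivative[OF bounded_linear_fst])
    then have "(chart_map c \<circ> (fst \<circ> chart_inv ?C) has_derivative fst) (at (chart_map ?C ?a))"
    proof (rule has_derivative_transform_within_open[OF _ S])
      show "chart_map ?C ?a \<in> ?S" using C'(2) by (rule imageI)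
      fix z assume z: "z \<in> ?S"
      have "chart_map c (fst (chart_inv ?C z)) = fst (chart_map ?C (chart_inv ?C z))"
        by (cases "chart_inv ?C z") (simp add: chart_map_tangent_chart[OF sA])
      then show "fst z = (chart_map c \<circ> (fst \<circ> chart_inv ?C)) z" using into[OF z] by simp
    qed
    moreover have "(fst \<circ> chart_inv ?C) ` ?S \<subseteq> chart_dom c"
    proof (rule image_subsetI)
      fix z assume "z \<in> ?S"
      from into(1)[OF this] show "(fst \<circ> chart_inv ?C) z \<in> chart_dom c"
        by (cases "chart_inv ?C z") (simp add: chart_dom_tangent_chart[OF sA])
    qed
    moreover have fa: "(fst \<circ> chart_inv ?C) (chart_map ?C ?a) = x" by (simp only: comp_apply inv fst_conv)
    ultimately have "(chart_map d \<circ> (fst \<circ> chart_inv ?C) has_derivative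
        (\<lambda>v. chart_change c d ((fst \<circ> chart_inv ?C) (chart_map ?C ?a)) (fst v))) (at (chart_map ?C ?a))"
      by (intro has_derivative_into_chart_change[OF sA _ _ S])
        (use c True C'(2) in \<open>simp_all only: fa imageI\<close>)
    then have "(chart_map d \<circ> fst \<circ> chart_inv ?C has_derivative (\<lambda>v. chart_change c d x (fst v)))
        (at (chart_map ?C ?a))"
      by (simp only: fa comp_assoc)
    from differential_eq[OF sTA C h _ this]
    show ?thesis using True by (simp add: coord_vec_def)
  next
    case False
    then show ?thesis by (simp add: differential_def Let_def coord_vec_def)
  qed
qed

text \<open>In each bundle chart the defining curve is a straight line with constant base
  coordinate.\<close>

lemma vertical_lift:
  assumes y: "y \<in> tangent_space A x" and w: "w \<in> tangent_space A x"
  shows "vertical_lift A (x, y) w \<in> tangent_space (tangent_atlas A) (x, y)"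
    and "c \<in> charts_at A x \<Longrightarrow> vertical_lift A (x, y) w (tangent_chart A c) = (0, w c)"
proof -
  note sTA = smooth_atlas_tangent_atlas[OF sA]
  let ?\<gamma> = "\<lambda>t. (x, y + t *\<^sub>R w)" and ?h = "vertical_lift A (x, y) w"
  have in_dom: "y + t *\<^sub>R w \<in> tangent_space A x" for t
    using y w tangent_subspace[OF sA] subspace_add subspace_scale by metis
  have der: "(chart_map (tangent_chart A c) \<circ> ?\<gamma> has_derivative (\<lambda>t. t *\<^sub>R (0, w c))) (at 0)" for c
    unfolding comp_def chart_map_tangent_chart[OF sA] by (auto intro!: derivative_eq_intros)
  have change: "?h C' = chart_change (tangent_chart A c) C' (x, y) (0, w c)"
    if c: "c \<in> charts_at A x" and C': "C' \<in> charts_at (tangent_atlas A) (x, y)" for c C'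
  proof -
    let ?C = "tangent_chart A c"
    have C: "?C \<in> charts_at (tangent_atlas A) (x, y)" by (rule tangent_chart_at[OF c y])
    have g0: "?\<gamma> 0 = (x, y)" by simp
    have "(chart_map C' \<circ> ?\<gamma> has_derivative (\<lambda>t. chart_change ?C C' (?\<gamma> 0) (t *\<^sub>R (0, w c)))) (at 0)"
      by (rule has_derivative_into_chart_change[OF sTA _ _ open_UNIV UNIV_I _ der])
        (use c C C' in_dom in \<open>auto simp: g0 chart_dom_tangent_chart[OF sA] charts_at_def[of A]\<close>)
    then have "(chart_map C' \<circ> ?\<gamma> has_vector_derivative chart_change ?C C' (x, y) (0, w c)) (at 0)"
      unfolding has_vector_derivative_def
      by (simp only: g0 linear_scale[OF linear_chart_change[OF sTA C C']])
    from vector_derivative_at[OF this]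
    show ?thesis using C' by (simp add: vertical_lift_def curve_velocity_def)
  qed
  show hc: "?h (tangent_chart A c) = (0, w c)" if "c \<in> charts_at A x" for c
    using change[OF that tangent_chart_at[OF that y]] chart_change_self[OF sTA tangent_chart_at[OF that y]]
    by simp
  show "?h \<in> tangent_space (tangent_atlas A) (x, y)"
  proof (rule tangent_spaceI[OF sTA])
    show "?h C = 0" if "C \<notin> charts_at (tangent_atlas A) (x, y)" for C
      using that by (simp add: vertical_lift_def curve_velocity_def)
    fix C C' assume C: "C \<in> charts_at (tangent_atlas A) (x, y)"
      and C': "C' \<in> charts_at (tangent_atlas A) (x, y)"
    obtain c where c: "c \<in> charts_at A x" "C = tangent_chart A c"
      using C by (auto simp: charts_at_tangent_atlas[OF sA] split: if_splits)
    show "?h C' = chart_change C C' (x, y) (?h C)"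
      using change[OF c(1) C'] hc[OF c(1)] by (simp add: c)
  qed
qed

end

context manifold_connection
begin

text \<open>In a chart, \<open>D X Y = 0\<close> at \<open>x\<close> says that the derivative of
  \<open>Y\<close> along \<open>X\<close> is minus the Christoffel term. Conversely, a field
  \<open>Y\<close> with value \<open>y\<close> and exactly this derivative exists. So the horizontal
  space is the graph of a linear map over the base directions.\<close>

lemma horizontal_space_iff:
  assumes c: "c \<in> charts_at A x" and y: "y \<in> tangent_space A x"
  shows "h \<in> horizontal_space A D (x, y) \<longleftrightarrow>
    h \<in> tangent_space (tangent_atlas A) (x, y) \<and>
    snd (h (tangent_chart A c)) = - christoffel A D c x (fst (h (tangent_chart A c))) (y c)"
proof
  assume "h \<in> horizontal_space A D (x, y)"
  then obtain X Y where h: "h = differential A (tangent_atlas A) (\<lambda>x. (x, Y x)) x (X x)"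
    and XY: "X \<in> vector_fields A" "Y \<in> vector_fields A" "Y x = y" "D X Y x = 0"
    unfolding horizontal_space_def by auto
  have "D X Y x c = 0" using XY by simp
  then show "h \<in> tangent_space (tangent_atlas A) (x, y) \<and>
    snd (h (tangent_chart A c)) = - christoffel A D c x (fst (h (tangent_chart A c))) (y c)"
    using section_differential[OF sA XY(2) vector_field_in[OF XY(1)] c] XY
      christoffel(3)[OF c XY(1,2)]
    by (simp add: h eq_neg_iff_add_eq_0)
next
  let ?C = "tangent_chart A c"
  assume h: "h \<in> tangent_space (tangent_atlas A) (x, y) \<and>
    snd (h ?C) = - christoffel A D c x (fst (h ?C)) (y c)"
  \<comment> \<open>Only the value of \<open>X\<close> at \<open>x\<close> enters, so its derivative
    is prescribed as 0; for \<open>Y\<close> both value and derivative matter.\<close>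
  obtain X where X: "X \<in> vector_fields A" "X x c = fst (h ?C)"
    using exists_field_with_derivative[OF c linear_zero] by metis
  have L: "linear (\<lambda>e. - christoffel A D c x e (y c))"
    by (rule linear_compose_neg[OF christoffel(2)[OF c]])
  obtain Y where Y: "Y \<in> vector_fields A" "Y x c = y c"
    "frechet_derivative (\<lambda>u. Y (chart_inv c u) c) (at (chart_map c x)) = (\<lambda>e. - christoffel A D c x e (y c))"
    using exists_field_with_derivative[OF c L] by metis
  have Yx: "Y x = y" by (rule tangent_space_eqI[OF sA c vector_field_in[OF Y(1)] y Y(2)])
  have "D X Y x c = 0 c" using christoffel(3)[OF c X(1) Y(1)] Y X by simp
  then have DXY: "D X Y x = 0"
    by (rule tangent_space_eqI[OF sA c vector_field_in[OF connection_field[OF X(1) Y(1)]]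
        zero_in_tangent[OF sA]])
  note diff = section_differential[OF sA Y(1) vector_field_in[OF X(1)] c]
  have "h = differential A (tangent_atlas A) (\<lambda>x. (x, Y x)) x (X x)"
  proof (rule tangent_space_eqI[OF sTA tangent_chart_at[OF sA c y]])
    show "h \<in> tangent_space (tangent_atlas A) (x, y)" using h by simp
    show "differential A (tangent_atlas A) (\<lambda>x. (x, Y x)) x (X x) \<in> tangent_space (tangent_atlas A) (x, y)"
      using diff(1) Yx by simp
    show "h ?C = differential A (tangent_atlas A) (\<lambda>x. (x, Y x)) x (X x) ?C"
      using diff(2) h X Y by (simp add: prod_eq_iff)
  qed
  then show "h \<in> horizontal_space A D (x, y)"
    unfolding horizontal_space_def using X Y Yx DXY by auto
qed

text \<open>Over a graph, the projection determines the vector, so the definite description has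
  exactly one solution; it is written down by its components in one bundle chart.\<close>

lemma horizontal_lift:
  assumes c: "c \<in> charts_at A x" and y: "y \<in> tangent_space A x" and v: "v \<in> tangent_space A x"
  shows "horizontal_lift A D (x, y) v \<in> tangent_space (tangent_atlas A) (x, y)"
    and "horizontal_lift A D (x, y) v (tangent_chart A c) = (v c, - christoffel A D c x (v c) (y c))"
proof -
  let ?C = "tangent_chart A c"
  note C = tangent_chart_at[OF sA c y]
  define h where "h = coord_vec (tangent_atlas A) ?C (v c, - christoffel A D c x (v c) (y c)) (x, y)"
  have h: "h \<in> tangent_space (tangent_atlas A) (x, y)" "h ?C = (v c, - christoffel A D c x (v c) (y c))"
    unfolding h_def by (rule coord_vec_in[OF sTA C] coord_vec_apply[OF sTA C])+
  have "horizontal_lift A D (x, y) v = h"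
    unfolding horizontal_lift_def
  proof (rule the_equality)
    show "h \<in> horizontal_space A D (x, y) \<and> differential (tangent_atlas A) A fst (x, y) h = v"
      using h tangent_space_coord_vec[OF sA c v]
      by (simp add: horizontal_space_iff[OF c y] differential_fst[OF sA c y])
    fix k assume k: "k \<in> horizontal_space A D (x, y) \<and> differential (tangent_atlas A) A fst (x, y) k = v"
    then have k': "k \<in> tangent_space (tangent_atlas A) (x, y)"
      "snd (k ?C) = - christoffel A D c x (fst (k ?C)) (y c)"
      by (simp_all add: horizontal_space_iff[OF c y])
    have "v c = fst (k ?C)"
      using k differential_fst[OF sA c y k'(1)] coord_vec_apply[OF sA c] by metis
    then show "k = h"
      using k' h by (intro tangent_space_eqI[OF sTA C]) (simp_all add: prod_eq_iff)
  qed
  then show "horizontal_lift A D (x, y) v \<in> tangent_space (tangent_atlas A) (x, y)"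
    "horizontal_lift A D (x, y) v ?C = (v c, - christoffel A D c x (v c) (y c))"
    using h by simp_all
qed

end

section \<open>Splitting tangent vectors of the bundle into horizontal and vertical parts\<close>

definition hv_lift ::
    "('m, 'e::euclidean_space) chart set \<Rightarrow>
      (('m \<Rightarrow> ('m, 'e) tvec) \<Rightarrow> ('m \<Rightarrow> ('m, 'e) tvec) \<Rightarrow> 'm \<Rightarrow> ('m, 'e) tvec) \<Rightarrow>
      'm \<times> ('m, 'e) tvec \<Rightarrow> ('m, 'e) tvec \<Rightarrow> ('m, 'e) tvec \<Rightarrow>
      ('m \<times> ('m, 'e) tvec, 'e \<times> 'e) tvec"
  where "hv_lift A D a v w = horizontal_lift A D a v + vertical_lift A a w"

context manifold_connection
begin

context
  fixes x y
  assumes x: "x \<in> points A" and y: "y \<in> tangent_space A x"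
begin

lemma hv_lift_in:
  assumes "v \<in> tangent_space A x" "w \<in> tangent_space A x"
  shows "hv_lift A D (x, y) v w \<in> tangent_space (tangent_atlas A) (x, y)"
proof -
  obtain c where c: "c \<in> charts_at A x" using x unfolding points_charts_at by blast
  show ?thesis
    unfolding hv_lift_def
    by (rule subspace_add[OF tangent_subspace[OF sTA] horizontal_lift(1)[OF c y assms(1)]
        vertical_lift(1)[OF sA y assms(2)]])
qed

lemma hv_lift_apply:
  assumes "c \<in> charts_at A x" "v \<in> tangent_space A x" "w \<in> tangent_space A x"
  shows "hv_lift A D (x, y) v w (tangent_chart A c) = (v c, w c - christoffel A D c x (v c) (y c))"
  unfolding hv_lift_def
  using horizontal_lift(2)[OF assms(1) y assms(2)] vertical_lift(2)[OF sA y assms(3,1)] by simp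

text \<open>Solves the component formula of \<open>hv_lift_apply\<close> for both parts. The
  horizontal lift contributes minus the Christoffel term to the second component, hence the
  correction with a plus sign in the vertical part.\<close>

lemma hv_lift_coords:
  assumes c: "c \<in> charts_at A x" and \<xi>: "\<xi> \<in> tangent_space (tangent_atlas A) (x, y)"
  shows "\<xi> = hv_lift A D (x, y) (coord_vec A c (fst (\<xi> (tangent_chart A c))) x)
    (coord_vec A c (snd (\<xi> (tangent_chart A c))
      + christoffel A D c x (fst (\<xi> (tangent_chart A c))) (y c)) x)"
  by (rule tangent_space_eqI[OF sTA tangent_chart_at[OF sA c y] \<xi>
        hv_lift_in[OF coord_vec_in[OF sA c] coord_vec_in[OF sA c]]])
    (simp add: hv_lift_apply[OF c coord_vec_in[OF sA c] coord_vec_in[OF sA c]] coord_vec_apply[OF sA c])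

lemma hv_lift_cases:
  assumes "\<xi> \<in> tangent_space (tangent_atlas A) (x, y)"
  obtains v w where "v \<in> tangent_space A x" "w \<in> tangent_space A x" "\<xi> = hv_lift A D (x, y) v w"
proof -
  obtain c where c: "c \<in> charts_at A x" using x unfolding points_charts_at by blast
  show ?thesis by (rule that[OF coord_vec_in[OF sA c] coord_vec_in[OF sA c] hv_lift_coords[OF c assms]])
qed

lemma hv_lift_inj:
  assumes "v \<in> tangent_space A x" "w \<in> tangent_space A x" "v' \<in> tangent_space A x" "w' \<in> tangent_space A x"
    and eq: "hv_lift A D (x, y) v w = hv_lift A D (x, y) v' w'"
  shows "v = v'" "w = w'"
proof -
  obtain c where c: "c \<in> charts_at A x" using x unfolding points_charts_at by blast
  have *: "(v c, w c - christoffel A D c x (v c) (y c)) = (v' c, w' c - christoffel A D c x (v' c) (y c))"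
    using eq hv_lift_apply[OF c assms(1,2)] hv_lift_apply[OF c assms(3,4)] by metis
  show "v = v'" by (rule tangent_space_eqI[OF sA c assms(1,3)]) (use * in simp)
  show "w = w'" by (rule tangent_space_eqI[OF sA c assms(2,4)]) (use * in force)
qed

text \<open>At fixed \<open>y\<close> the Christoffel term depends linearly on \<open>v\<close>, so
  the components depend linearly on the pair \<open>(v, w)\<close>.\<close>

lemma hv_lift_add:
  assumes "v \<in> tangent_space A x" "w \<in> tangent_space A x" "v' \<in> tangent_space A x" "w' \<in> tangent_space A x"
  shows "hv_lift A D (x, y) (v + v') (w + w') = hv_lift A D (x, y) v w + hv_lift A D (x, y) v' w'"
proof -
  obtain c where c: "c \<in> charts_at A x" using x unfolding points_charts_at by blast
  note add = subspace_add[OF tangent_subspace[OF sA]]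
  show ?thesis
  proof (rule tangent_space_eqI[OF sTA tangent_chart_at[OF sA c y]])
    show "hv_lift A D (x, y) (v + v') (w + w') \<in> tangent_space (tangent_atlas A) (x, y)"
      by (intro hv_lift_in add assms)
    show "hv_lift A D (x, y) v w + hv_lift A D (x, y) v' w' \<in> tangent_space (tangent_atlas A) (x, y)"
      by (intro subspace_add[OF tangent_subspace[OF sTA]] hv_lift_in assms)
    show "hv_lift A D (x, y) (v + v') (w + w') (tangent_chart A c) =
        (hv_lift A D (x, y) v w + hv_lift A D (x, y) v' w') (tangent_chart A c)"
      using hv_lift_apply[OF c add[OF assms(1,3)] add[OF assms(2,4)]]
        hv_lift_apply[OF c assms(1,2)] hv_lift_apply[OF c assms(3,4)]
      by (simp add: linear_add[OF christoffel(2)[OF c]])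
  qed
qed

lemma hv_lift_scaleR:
  assumes "v \<in> tangent_space A x" "w \<in> tangent_space A x"
  shows "hv_lift A D (x, y) (r *\<^sub>R v) (r *\<^sub>R w) = r *\<^sub>R hv_lift A D (x, y) v w"
proof -
  obtain c where c: "c \<in> charts_at A x" using x unfolding points_charts_at by blast
  note sc = subspace_scale[OF tangent_subspace[OF sA]]
  show ?thesis
  proof (rule tangent_space_eqI[OF sTA tangent_chart_at[OF sA c y]])
    show "hv_lift A D (x, y) (r *\<^sub>R v) (r *\<^sub>R w) \<in> tangent_space (tangent_atlas A) (x, y)"
      by (intro hv_lift_in sc assms)
    show "r *\<^sub>R hv_lift A D (x, y) v w \<in> tangent_space (tangent_atlas A) (x, y)"
      by (intro subspace_scale[OF tangent_subspace[OF sTA]] hv_lift_in assms)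
    show "hv_lift A D (x, y) (r *\<^sub>R v) (r *\<^sub>R w) (tangent_chart A c) =
        (r *\<^sub>R hv_lift A D (x, y) v w) (tangent_chart A c)"
      using hv_lift_apply[OF c sc[OF assms(1)] sc[OF assms(2)]] hv_lift_apply[OF c assms(1,2)]
      by (simp add: linear_scale[OF christoffel(2)[OF c]] algebra_simps)
  qed
qed

end

end

section \<open>The musical isomorphisms\<close>

context
  fixes A :: "('m, 'e::euclidean_space) chart set" and g and x :: 'm
  assumes sA: "smooth_atlas A" and x: "x \<in> points A"
    and g: "scalar_product_on (tangent_space A x) (g x)"
begin

lemma scalar_product_commute:
  "v \<in> tangent_space A x \<Longrightarrow> w \<in> tangent_space A x \<Longrightarrow> g x v w = g x w v"
  using g unfolding scalar_product_on_def by simp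

lemma scalar_product_add_right:
  "u \<in> tangent_space A x \<Longrightarrow> v \<in> tangent_space A x \<Longrightarrow> w \<in> tangent_space A x \<Longrightarrow>
    g x u (v + w) = g x u v + g x u w"
  using g unfolding scalar_product_on_def linear_map_on_def by simp

lemma scalar_product_scaleR_right:
  "u \<in> tangent_space A x \<Longrightarrow> v \<in> tangent_space A x \<Longrightarrow> g x u (r *\<^sub>R v) = r * g x u v"
  using g unfolding scalar_product_on_def linear_map_on_def by simp

lemma scalar_product_add_left:
  assumes "u \<in> tangent_space A x" "v \<in> tangent_space A x" "w \<in> tangent_space A x"
  shows "g x (v + w) u = g x v u + g x w u"
  using scalar_product_add_right[OF assms] assms scalar_product_commute[of u]
    subspace_add[OF tangent_subspace[OF sA]] by simp

lemma scalar_product_scaleR_left: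
  assumes "u \<in> tangent_space A x" "v \<in> tangent_space A x"
  shows "g x (r *\<^sub>R v) u = r * g x v u"
  using scalar_product_scaleR_right[OF assms] assms scalar_product_commute[of u]
    subspace_scale[OF tangent_subspace[OF sA]] by simp

lemma scalar_product_minus:
  assumes "u \<in> tangent_space A x" "v \<in> tangent_space A x"
  shows "g x u (- v) = - g x u v" "g x (- v) u = - g x v u"
  using scalar_product_scaleR_right[OF assms, of "- 1"] scalar_product_scaleR_left[OF assms, of "- 1"]
  by simp_all

lemma scalar_product_diff:
  assumes "u \<in> tangent_space A x" "v \<in> tangent_space A x" "w \<in> tangent_space A x"
  shows "g x u (v - w) = g x u v - g x u w" "g x (v - w) u = g x v u - g x w u"
proof -
  have "- w \<in> tangent_space A x"
    by (rule subspace_neg[OF tangent_subspace[OF sA] assms(3)])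
  then show "g x u (v - w) = g x u v - g x u w" "g x (v - w) u = g x v u - g x w u"
    using scalar_product_add_right[of u v "- w"] scalar_product_add_left[of u v "- w"]
      scalar_product_minus[OF assms(1,3)] assms by simp_all
qed

lemmas scalar_product_linear =
  scalar_product_add_left scalar_product_add_right scalar_product_scaleR_left
  scalar_product_scaleR_right scalar_product_minus scalar_product_diff

lemma flat_add:
  assumes "v \<in> tangent_space A x" "w \<in> tangent_space A x"
  shows "flat A g x (v + w) = flat A g x v + flat A g x w"
  using scalar_product_add_left[OF _ assms] by (auto simp: flat_def fun_eq_iff)

lemma flat_scaleR:
  assumes "v \<in> tangent_space A x"
  shows "flat A g x (r *\<^sub>R v) = r *\<^sub>R flat A g x v"
  using scalar_product_scaleR_left[OF _ assms] by (auto simp: flat_def fun_eq_iff)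

lemma flat_in: "v \<in> tangent_space A x \<Longrightarrow> flat A g x v \<in> cotangent_space A x"
  using g tangent_subspace[OF sA] subspace_add subspace_scale
  unfolding cotangent_space_def flat_def scalar_product_on_def linear_map_on_def
  by (simp add: subspace_add subspace_scale)

lemma inj_on_flat: "inj_on (flat A g x) (tangent_space A x)"
proof (rule inj_onI)
  note sub = tangent_subspace[OF sA]
  fix v w assume v: "v \<in> tangent_space A x" and w: "w \<in> tangent_space A x"
    and eq: "flat A g x v = flat A g x w"
  have mw: "(- 1) *\<^sub>R w \<in> tangent_space A x" by (rule subspace_scale[OF sub w])
  have d: "v + (- 1) *\<^sub>R w \<in> tangent_space A x" by (rule subspace_add[OF sub v mw])
  have "flat A g x (v + (- 1) *\<^sub>R w) = 0"
    using flat_add[OF v mw] flat_scaleR[OF w, of "- 1"] eq by simp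
  then have "g x (v + (- 1) *\<^sub>R w) u = 0" if "u \<in> tangent_space A x" for u
    using that by (metis flat_def zero_fun_apply)
  then have "v + (- 1) *\<^sub>R w = 0"
    using g d unfolding scalar_product_on_def by blast
  then show "v = w" by simp
qed

lemma sharp_flat: "v \<in> tangent_space A x \<Longrightarrow> sharp A g x (flat A g x v) = v"
  unfolding sharp_def by (rule inv_into_f_f[OF inj_on_flat])

text \<open>A dimension count in one chart: \<open>L\<close>, the Gram matrix of the metric, is an
  injective endomorphism of a Euclidean space by nondegeneracy and so hits the vector of values of
  \<open>\<alpha>\<close> on the coordinate basis.\<close>

lemma flat_surj:
  assumes \<alpha>: "\<alpha> \<in> cotangent_space A x"
  shows "\<alpha> \<in> flat A g x ` tangent_space A x"
proof -
  obtain c where c: "c \<in> charts_at A x" using x unfolding points_charts_at by blast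
  note ci = coord_vec_in[OF sA c]
  let ?k = "\<lambda>e. coord_vec A c e x"
  define L where "L e = (\<Sum>b\<in>Basis. g x (?k e) (?k b) *\<^sub>R b)" for e
  have lin: "linear (\<lambda>e. g x (?k e) (?k b))" for b
    by (rule linearI) (simp_all add: coord_vec_add[OF sA c] coord_vec_scaleR[OF sA c]
      scalar_product_add_left[OF ci ci ci] scalar_product_scaleR_left[OF ci ci])
  have linr: "linear (\<lambda>e'. g x (?k e) (?k e'))" for e
    by (rule linearI) (simp_all add: coord_vec_add[OF sA c] coord_vec_scaleR[OF sA c]
      scalar_product_add_right[OF ci ci ci] scalar_product_scaleR_right[OF ci ci])
  have lin\<alpha>: "linear (\<lambda>e. \<alpha> (?k e))"
    using \<alpha> ci unfolding cotangent_space_def linear_map_on_def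
    by (intro linearI) (simp_all add: coord_vec_add[OF sA c] coord_vec_scaleR[OF sA c])
  have linL: "linear L"
    unfolding L_def
    by (rule linearI) (simp_all add: linear_add[OF lin] linear_scale[OF lin] scaleR_add_left sum.distrib scaleR_sum_right)
  have Lb: "L e \<bullet> b = g x (?k e) (?k b)" if "b \<in> Basis" for e b
    using that by (simp add: L_def inner_sum_left_Basis)
  have "inj L"
    unfolding linear_inj_iff_eq_0[OF linL]
  proof (intro allI impI)
    fix e assume "L e = 0"
    then have b0: "g x (?k e) (?k b) = 0" if "b \<in> Basis" for b using Lb[OF that, of e] by simp
    have "(\<lambda>e'. g x (?k e) (?k e')) = (\<lambda>e'. 0)"
      by (rule linear_eq_stdbasis[OF linr linear_zero]) (use b0 in simp)
    then have "\<forall>w\<in>tangent_space A x. g x (?k e) w = 0"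
      using tangent_space_coord_vec[OF sA c] by metis
    then have "?k e = 0" using g ci unfolding scalar_product_on_def by blast
    then show "e = 0" using coord_vec_apply[OF sA c, of e] by simp
  qed
  then have "surj L" using linear_injective_imp_surjective[OF linL] by simp
  then obtain e where e: "L e = (\<Sum>b\<in>Basis. \<alpha> (?k b) *\<^sub>R b)" by (metis surjD)
  have "(\<lambda>e'. g x (?k e) (?k e')) = (\<lambda>e'. \<alpha> (?k e'))"
  proof (rule linear_eq_stdbasis[OF linr lin\<alpha>])
    fix b :: 'e assume b: "b \<in> Basis"
    show "g x (?k e) (?k b) = \<alpha> (?k b)"
      using Lb[OF b, of e] e b by (simp add: inner_sum_left_Basis)
  qed
  then have "g x (?k e) w = \<alpha> w" if "w \<in> tangent_space A x" for w
    using tangent_space_coord_vec[OF sA c that] by metis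
  moreover have "\<alpha> w = 0" if "w \<notin> tangent_space A x" for w
    using \<alpha> that by (simp add: cotangent_space_def)
  ultimately have "flat A g x (?k e) = \<alpha>" by (auto simp: flat_def fun_eq_iff)
  then show ?thesis using ci by blast
qed

lemma sharp_in: "\<alpha> \<in> cotangent_space A x \<Longrightarrow> sharp A g x \<alpha> \<in> tangent_space A x"
  unfolding sharp_def by (rule inv_into_into[OF flat_surj])

lemma flat_sharp: "\<alpha> \<in> cotangent_space A x \<Longrightarrow> flat A g x (sharp A g x \<alpha>) = \<alpha>"
  unfolding sharp_def by (rule f_inv_into_f[OF flat_surj])

end

section \<open>The structure on the tangent bundle\<close>

text \<open>The parameter is the chart coordinate \<open>u\<close>, so that the smoothness clause
  for an endomorphism is smoothness in \<open>u\<close> at fixed \<open>e\<close>; likewise for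
  \<open>coord_metric\<close>.\<close>

definition coord_endo ::
    "('m, 'e::euclidean_space) chart set \<Rightarrow> ('m \<Rightarrow> ('m, 'e) tvec \<Rightarrow> ('m, 'e) tvec) \<Rightarrow>
      ('m, 'e) chart \<Rightarrow> 'e \<Rightarrow> 'e \<Rightarrow> 'e"
  where "coord_endo A J c u e = J (chart_inv c u) (coord_vec A c e (chart_inv c u)) c"

definition coord_metric ::
    "('m, 'e::euclidean_space) chart set \<Rightarrow> ('m \<Rightarrow> ('m, 'e) tvec \<Rightarrow> ('m, 'e) tvec \<Rightarrow> real) \<Rightarrow>
      ('m, 'e) chart \<Rightarrow> 'e \<Rightarrow> 'e \<Rightarrow> 'e \<Rightarrow> real"
  where "coord_metric A g c u e e' =
    g (chart_inv c u) (coord_vec A c e (chart_inv c u)) (coord_vec A c e' (chart_inv c u))"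

locale metallic_lift = manifold_connection A D
  for A :: "('m, 'e::euclidean_space) chart set" and D +
  fixes g :: "'m \<Rightarrow> ('m, 'e) tvec \<Rightarrow> ('m, 'e) tvec \<Rightarrow> real"
    and J :: "'m \<Rightarrow> ('m, 'e) tvec \<Rightarrow> ('m, 'e) tvec"
    and p q :: real
  assumes g: "pseudo_riemannian_metric A g"
    and J: "symmetric_endomorphism A g J"
    and check_g: "x \<in> points A \<Longrightarrow>
      scalar_product_on (generalized_tangent_space A x) (check_g A g J p q x)"
begin

abbreviation hv :: "'m \<times> ('m, 'e) tvec \<Rightarrow> ('m, 'e) tvec \<Rightarrow> ('m, 'e) tvec \<Rightarrow>
    ('m \<times> ('m, 'e) tvec, 'e \<times> 'e) tvec"
  where "hv \<equiv> hv_lift A D"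

abbreviation BJ :: "'m \<times> ('m, 'e) tvec \<Rightarrow> ('m \<times> ('m, 'e) tvec, 'e \<times> 'e) tvec \<Rightarrow>
    ('m \<times> ('m, 'e) tvec, 'e \<times> 'e) tvec"
  where "BJ \<equiv> bar_J A g D J p q"

abbreviation Bg :: "'m \<times> ('m, 'e) tvec \<Rightarrow> ('m \<times> ('m, 'e) tvec, 'e \<times> 'e) tvec \<Rightarrow>
    ('m \<times> ('m, 'e) tvec, 'e \<times> 'e) tvec \<Rightarrow> real"
  where "Bg \<equiv> bar_g A g D J p q"

lemma metric_at: "x \<in> points A \<Longrightarrow> scalar_product_on (tangent_space A x) (g x)"
  using g by (simp add: pseudo_riemannian_metric_def)

lemma endo_smooth: "c \<in> A \<Longrightarrow> smooth_on (chart_map c ` chart_dom c) (\<lambda>u. coord_endo A J c u e)"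
  using J by (simp add: symmetric_endomorphism_def tangent_endomorphism_def coord_endo_def Let_def)

lemma metric_smooth: "c \<in> A \<Longrightarrow> smooth_on (chart_map c ` chart_dom c) (\<lambda>u. coord_metric A g c u e e')"
  using g by (simp add: pseudo_riemannian_metric_def coord_metric_def Let_def)

section \<open>Pointwise algebra of the lifted structure\<close>

context
  fixes x :: 'm
  assumes x: "x \<in> points A"
begin

lemma endo_in: "v \<in> tangent_space A x \<Longrightarrow> J x v \<in> tangent_space A x"
  using J x unfolding symmetric_endomorphism_def tangent_endomorphism_def by blast

lemma endo_add:
  "v \<in> tangent_space A x \<Longrightarrow> w \<in> tangent_space A x \<Longrightarrow> J x (v + w) = J x v + J x w"
  using J x by (simp add: symmetric_endomorphism_def tangent_endomorphism_def linear_map_on_def)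

lemma endo_scaleR: "v \<in> tangent_space A x \<Longrightarrow> J x (r *\<^sub>R v) = r *\<^sub>R J x v"
  using J x by (simp add: symmetric_endomorphism_def tangent_endomorphism_def linear_map_on_def)

lemma endo_symmetric:
  "v \<in> tangent_space A x \<Longrightarrow> w \<in> tangent_space A x \<Longrightarrow> g x (J x v) w = g x v (J x w)"
  using J x by (simp add: symmetric_endomorphism_def)

lemma tangent_closed:
  "v \<in> tangent_space A x \<Longrightarrow> w \<in> tangent_space A x \<Longrightarrow> v + w \<in> tangent_space A x"
  "v \<in> tangent_space A x \<Longrightarrow> w \<in> tangent_space A x \<Longrightarrow> v - w \<in> tangent_space A x"
  "v \<in> tangent_space A x \<Longrightarrow> r *\<^sub>R v \<in> tangent_space A x"
  "v \<in> tangent_space A x \<Longrightarrow> - v \<in> tangent_space A x"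
  using tangent_subspace[OF sA, of x]
  by (simp_all add: subspace_add subspace_diff subspace_scale subspace_neg)

lemma endo_minus: "v \<in> tangent_space A x \<Longrightarrow> J x (- v) = - J x v"
  using endo_scaleR[of v "- 1"] by simp

lemma endo_diff:
  assumes "v \<in> tangent_space A x" "w \<in> tangent_space A x" shows "J x (v - w) = J x v - J x w"
  using endo_add[OF assms(1) tangent_closed(4)[OF assms(2)]] endo_minus[OF assms(2)] by simp

lemmas endo_linear = endo_add endo_scaleR endo_minus endo_diff

lemmas metric_linear = scalar_product_linear[where g = g, OF sA x metric_at[OF x]]

lemmas metric_diff = scalar_product_diff[where g = g, OF sA x metric_at[OF x]]

lemmas metric_commute = scalar_product_commute[where g = g, OF sA x metric_at[OF x]]

lemmas flat_linear = flat_add[where g = g, OF sA x metric_at[OF x]] flat_scaleR[where g = g, OF sA x metric_at[OF x]]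

lemmas flat_mem = flat_in[where g = g, OF sA x metric_at[OF x]]

lemmas flat_inj = inj_onD[OF inj_on_flat[where g = g, OF sA x metric_at[OF x]]]

lemmas sharp_of_flat = sharp_flat[where g = g, OF sA x metric_at[OF x]]

lemmas sharp_mem = sharp_in[where g = g, OF sA x metric_at[OF x]]

lemmas flat_of_sharp = flat_sharp[where g = g, OF sA x metric_at[OF x]]

text \<open>Symmetry of \<open>J\<close> moves it across the metric; this removes covectors from the
  formula for \<open>check_J\<close>.\<close>

lemma dual_endomorphism_flat:
  assumes w: "w \<in> tangent_space A x"
  shows "dual_endomorphism A J x (flat A g x w) = flat A g x (J x w)"
  using endo_symmetric[OF w] endo_in by (auto simp: dual_endomorphism_def flat_def fun_eq_iff)

lemma flat_diff:
  assumes "v \<in> tangent_space A x" "w \<in> tangent_space A x"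
  shows "flat A g x (v - w) = flat A g x v - flat A g x w"
  using metric_diff(2)[OF _ assms] by (auto simp: flat_def fun_eq_iff)

context
  fixes y
  assumes y: "y \<in> tangent_space A x"
begin

text \<open>Injectivity of \<open>Psi\<close> makes the choice in \<open>inv_into\<close> harmless:
  the two parts of a vector are unique and \<open>sharp\<close> is injective on covectors. All later
  computations use this formula instead of the inverse.\<close>

lemma Psi_inv_hv_lift:
  assumes v: "v \<in> tangent_space A x" and w: "w \<in> tangent_space A x"
  shows "Psi_inv A g D (x, y) (hv (x, y) v w) = (v, flat A g x w)"
  unfolding Psi_inv_def fst_conv
proof (rule inv_into_f_eq)
  show "inj_on (Psi A g D (x, y)) (generalized_tangent_space A x)"
  proof (rule inj_onI, clarify)
    fix v \<alpha> w \<beta>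
    assume *: "(v, \<alpha>) \<in> generalized_tangent_space A x" "(w, \<beta>) \<in> generalized_tangent_space A x"
      "Psi A g D (x, y) (v, \<alpha>) = Psi A g D (x, y) (w, \<beta>)"
    then have m: "v \<in> tangent_space A x" "\<alpha> \<in> cotangent_space A x"
      "w \<in> tangent_space A x" "\<beta> \<in> cotangent_space A x"
      by (auto simp: generalized_tangent_space_def)
    have eq: "hv (x, y) v (sharp A g x \<alpha>) = hv (x, y) w (sharp A g x \<beta>)"
      using *(3) by (simp add: Psi_def hv_lift_def)
    have "v = w" "sharp A g x \<alpha> = sharp A g x \<beta>"
      using hv_lift_inj[OF x y m(1) sharp_mem[OF m(2)] m(3) sharp_mem[OF m(4)] eq] by auto
    then show "v = w \<and> \<alpha> = \<beta>" using flat_of_sharp m by metis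
  qed
  show "(v, flat A g x w) \<in> generalized_tangent_space A x"
    using v flat_mem[OF w] by (simp add: generalized_tangent_space_def)
  show "Psi A g D (x, y) (v, flat A g x w) = hv (x, y) v w"
    using sharp_of_flat[OF w] by (simp add: Psi_def hv_lift_def)
qed

lemma bar_J_hv_lift:
  assumes v: "v \<in> tangent_space A x" and w: "w \<in> tangent_space A x"
  shows "BJ (x, y) (hv (x, y) v w) =
    hv (x, y) (J x v + (- J x (J x w) + p *\<^sub>R J x w + q *\<^sub>R w)) (v - J x w + p *\<^sub>R w)"
proof -
  have "flat A g x v - flat A g x (J x w) + p *\<^sub>R flat A g x w = flat A g x (v - J x w + p *\<^sub>R w)"
    using v w by (simp add: flat_linear flat_diff tangent_closed endo_in)
  moreover have "sharp A g x (flat A g x (v - J x w + p *\<^sub>R w)) = v - J x w + p *\<^sub>R w"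
    using v w by (intro sharp_of_flat tangent_closed endo_in)
  ultimately show ?thesis
    unfolding bar_J_def comp_def fst_conv Psi_inv_hv_lift[OF v w] check_J_def Let_def case_prod_conv
      sharp_of_flat[OF w] dual_endomorphism_flat[OF w]
    by (simp add: Psi_def hv_lift_def)
qed

lemma bar_g_hv_lift:
  assumes "v \<in> tangent_space A x" "w \<in> tangent_space A x" "v' \<in> tangent_space A x" "w' \<in> tangent_space A x"
  shows "Bg (x, y) (hv (x, y) v w) (hv (x, y) v' w') =
    g x v v' + (p\<^sup>2 + 4 * q) / 4 * g x w w' + p / 4 * (g x w v' + g x w' v)
      - 1 / 2 * (g x w (J x v') + g x w' (J x v))"
  unfolding bar_g_def fst_conv Psi_inv_hv_lift[OF assms(1,2)] Psi_inv_hv_lift[OF assms(3,4)]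
    check_g_def case_prod_conv sharp_of_flat[OF assms(2)] sharp_of_flat[OF assms(4)]
  using assms by (simp add: flat_def endo_in)

lemma bar_J_in:
  assumes "\<xi> \<in> tangent_space (tangent_atlas A) (x, y)"
  shows "BJ (x, y) \<xi> \<in> tangent_space (tangent_atlas A) (x, y)"
proof -
  obtain v w where *: "v \<in> tangent_space A x" "w \<in> tangent_space A x" "\<xi> = hv (x, y) v w"
    by (rule hv_lift_cases[OF x y assms])
  show ?thesis
    unfolding *(3) bar_J_hv_lift[OF *(1,2)]
    using * by (intro hv_lift_in[OF x y] tangent_closed endo_in)
qed

lemma linear_bar_J: "linear_map_on (tangent_space (tangent_atlas A) (x, y)) (BJ (x, y))"
  unfolding linear_map_on_def
proof (intro conjI ballI allI)
  fix \<xi> \<eta> assume \<xi>: "\<xi> \<in> tangent_space (tangent_atlas A) (x, y)"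
    and \<eta>: "\<eta> \<in> tangent_space (tangent_atlas A) (x, y)"
  obtain v w where 1: "v \<in> tangent_space A x" "w \<in> tangent_space A x" "\<xi> = hv (x, y) v w"
    by (rule hv_lift_cases[OF x y \<xi>])
  obtain v' w' where 2: "v' \<in> tangent_space A x" "w' \<in> tangent_space A x" "\<eta> = hv (x, y) v' w'"
    by (rule hv_lift_cases[OF x y \<eta>])
  show "BJ (x, y) (\<xi> + \<eta>) = BJ (x, y) \<xi> + BJ (x, y) \<eta>"
    using 1(1,2) 2(1,2) unfolding 1(3) 2(3)
    by (simp add: hv_lift_add[OF x y, symmetric] bar_J_hv_lift tangent_closed endo_in endo_linear
        algebra_simps)
next
  fix \<xi> r assume \<xi>: "\<xi> \<in> tangent_space (tangent_atlas A) (x, y)"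
  obtain v w where 1: "v \<in> tangent_space A x" "w \<in> tangent_space A x" "\<xi> = hv (x, y) v w"
    by (rule hv_lift_cases[OF x y \<xi>])
  show "BJ (x, y) (r *\<^sub>R \<xi>) = r *\<^sub>R BJ (x, y) \<xi>"
    using 1(1,2) unfolding 1(3)
    by (simp add: hv_lift_scaleR[OF x y, symmetric] bar_J_hv_lift tangent_closed endo_in endo_linear
        algebra_simps)
qed

text \<open>On pairs (v, w) the endomorphism is the matrix ((J, -J^2 + pJ + q), (1, p - J)), with
  trace p and determinant J(p - J) - (-J^2 + pJ + q) = -q. Cayley-Hamilton is the claim; the
  simplifier multiplies it out.\<close>

lemma metallic_bar_J:
  assumes \<xi>: "\<xi> \<in> tangent_space (tangent_atlas A) (x, y)"
  shows "BJ (x, y) (BJ (x, y) \<xi>) = p *\<^sub>R BJ (x, y) \<xi> + q *\<^sub>R \<xi>"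
proof -
  obtain v w where 1: "v \<in> tangent_space A x" "w \<in> tangent_space A x" "\<xi> = hv (x, y) v w"
    by (rule hv_lift_cases[OF x y \<xi>])
  show ?thesis
    using 1(1,2) unfolding 1(3)
    by (simp add: hv_lift_scaleR[OF x y, symmetric] hv_lift_add[OF x y, symmetric]
        bar_J_hv_lift tangent_closed endo_in endo_linear algebra_simps)
qed

text \<open>Relative to \<open>g\<close> the form has the matrix B = ((1, p/4 - J/2), (p/4 - J/2,
  (p^2 + 4q)/4)). With M the matrix of \<open>BJ\<close> and J self-adjoint, it suffices that BM is
  symmetric: both off-diagonal entries are (p^2 + 4q)/4 + pJ/4 - J^2/2.\<close>

lemma symmetric_bar_J:
  assumes \<xi>: "\<xi> \<in> tangent_space (tangent_atlas A) (x, y)"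
    and \<eta>: "\<eta> \<in> tangent_space (tangent_atlas A) (x, y)"
  shows "Bg (x, y) (BJ (x, y) \<xi>) \<eta> = Bg (x, y) \<xi> (BJ (x, y) \<eta>)"
proof -
  obtain v w where 1: "v \<in> tangent_space A x" "w \<in> tangent_space A x" "\<xi> = hv (x, y) v w"
    by (rule hv_lift_cases[OF x y \<xi>])
  obtain v' w' where 2: "v' \<in> tangent_space A x" "w' \<in> tangent_space A x" "\<eta> = hv (x, y) v' w'"
    by (rule hv_lift_cases[OF x y \<eta>])
  \<comment> \<open>These rules put the unprimed vector first and every \<open>J\<close> on the
    second argument; they are used only at fixed pairs, so rewriting cannot loop. The third power
    arises because \<open>Bg\<close> applies \<open>J\<close> to the horizontal part of
    \<open>BJ\<close>, which already contains \<open>J x (J x w)\<close>.\<close>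
  have swap: "g x b a = g x a b" "g x b (J x a) = g x a (J x b)"
    "g x b (J x (J x a)) = g x a (J x (J x b))"
    "g x b (J x (J x (J x a))) = g x a (J x (J x (J x b)))"
    if "a \<in> tangent_space A x" "b \<in> tangent_space A x" for a b
    using that metric_commute endo_symmetric endo_in by metis+
  note m = 1(1,2) 2(1,2)
  show ?thesis
    using m unfolding 1(3) 2(3)
    by (simp add: bar_J_hv_lift bar_g_hv_lift tangent_closed endo_in endo_linear metric_linear
        endo_symmetric swap[OF m(1) m(3)] swap[OF m(1) m(4)] swap[OF m(2) m(3)] swap[OF m(2) m(4)])
      (simp add: field_simps power2_eq_square)
qed

text \<open>\<open>Psi_inv\<close> is a linear bijection onto the generalized tangent space, so the
  properties assumed of \<open>check_g\<close> carry over.\<close>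

lemma scalar_product_bar_g:
  "scalar_product_on (tangent_space (tangent_atlas A) (x, y)) (Bg (x, y))"
proof -
  let ?T = "tangent_space (tangent_atlas A) (x, y)" and ?P = "Psi_inv A g D (x, y)"
  let ?G = "generalized_tangent_space A x" and ?b = "check_g A g J p q x"
  have b: "scalar_product_on ?G ?b" by (rule check_g[OF x])
  have Bg: "Bg (x, y) \<xi> \<eta> = ?b (?P \<xi>) (?P \<eta>)" for \<xi> \<eta> by (simp add: bar_g_def)
  have P_in: "?P \<xi> \<in> ?G" if \<xi>: "\<xi> \<in> ?T" for \<xi>
  proof -
    obtain v w where "v \<in> tangent_space A x" "w \<in> tangent_space A x" "\<xi> = hv (x, y) v w"
      by (rule hv_lift_cases[OF x y \<xi>])
    then show ?thesis by (simp add: Psi_inv_hv_lift flat_mem generalized_tangent_space_def)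
  qed
  have P_add: "?P (\<xi> + \<eta>) = ?P \<xi> + ?P \<eta>" if \<xi>: "\<xi> \<in> ?T" and \<eta>: "\<eta> \<in> ?T" for \<xi> \<eta>
  proof -
    obtain v w where 1: "v \<in> tangent_space A x" "w \<in> tangent_space A x" "\<xi> = hv (x, y) v w"
      by (rule hv_lift_cases[OF x y \<xi>])
    obtain v' w' where 2: "v' \<in> tangent_space A x" "w' \<in> tangent_space A x" "\<eta> = hv (x, y) v' w'"
      by (rule hv_lift_cases[OF x y \<eta>])
    show ?thesis
      using 1(1,2) 2(1,2) unfolding 1(3) 2(3)
      by (simp add: hv_lift_add[OF x y, symmetric] Psi_inv_hv_lift tangent_closed flat_linear)
  qed
  have P_scale: "?P (r *\<^sub>R \<xi>) = r *\<^sub>R ?P \<xi>" if \<xi>: "\<xi> \<in> ?T" for r \<xi>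
  proof -
    obtain v w where 1: "v \<in> tangent_space A x" "w \<in> tangent_space A x" "\<xi> = hv (x, y) v w"
      by (rule hv_lift_cases[OF x y \<xi>])
    show ?thesis
      using 1(1,2) unfolding 1(3)
      by (simp add: hv_lift_scaleR[OF x y, symmetric] Psi_inv_hv_lift tangent_closed flat_linear)
  qed
  \<comment> \<open>Nondegeneracy needs surjectivity: the image of a vector orthogonal to all of
    \<open>?T\<close> must be orthogonal to the whole generalized tangent space.\<close>
  have P_surj: "\<exists>\<eta>\<in>?T. ?P \<eta> = \<zeta>" if \<zeta>: "\<zeta> \<in> ?G" for \<zeta>
  proof -
    obtain v \<alpha> where *: "\<zeta> = (v, \<alpha>)" "v \<in> tangent_space A x" "\<alpha> \<in> cotangent_space A x"
      using \<zeta> by (auto simp: generalized_tangent_space_def)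
    have "?P (hv (x, y) v (sharp A g x \<alpha>)) = \<zeta>"
      using * by (simp add: Psi_inv_hv_lift sharp_mem flat_of_sharp)
    then show ?thesis using hv_lift_in[OF x y *(2) sharp_mem[OF *(3)]] by blast
  qed
  show ?thesis
    unfolding scalar_product_on_def linear_map_on_def
  proof (intro conjI ballI allI impI)
    fix \<xi> \<eta> \<zeta> assume "\<xi> \<in> ?T" "\<eta> \<in> ?T" "\<zeta> \<in> ?T"
    then show "Bg (x, y) \<xi> (\<eta> + \<zeta>) = Bg (x, y) \<xi> \<eta> + Bg (x, y) \<xi> \<zeta>"
      using b P_in by (simp add: Bg P_add scalar_product_on_def linear_map_on_def)
  next
    fix \<xi> \<eta> r assume "\<xi> \<in> ?T" "\<eta> \<in> ?T"
    then show "Bg (x, y) \<xi> (r *\<^sub>R \<eta>) = r *\<^sub>R Bg (x, y) \<xi> \<eta>"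
      using b P_in by (simp add: Bg P_scale scalar_product_on_def linear_map_on_def)
  next
    fix \<xi> \<eta> assume "\<xi> \<in> ?T" "\<eta> \<in> ?T"
    then show "Bg (x, y) \<xi> \<eta> = Bg (x, y) \<eta> \<xi>"
      using b P_in by (simp add: Bg scalar_product_on_def)
  next
    fix \<xi> assume \<xi>: "\<xi> \<in> ?T" and 0: "\<forall>\<eta>\<in>?T. Bg (x, y) \<xi> \<eta> = 0"
    have "\<forall>\<zeta>\<in>?G. ?b (?P \<xi>) \<zeta> = 0"
    proof
      fix \<zeta> assume "\<zeta> \<in> ?G"
      then obtain \<eta> where "\<eta> \<in> ?T" "?P \<eta> = \<zeta>" using P_surj by blast
      then show "?b (?P \<xi>) \<zeta> = 0" using 0 Bg by metis
    qed
    then have P0: "?P \<xi> = 0"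
      using b P_in[OF \<xi>] unfolding scalar_product_on_def by blast
    obtain v w where 1: "v \<in> tangent_space A x" "w \<in> tangent_space A x" "\<xi> = hv (x, y) v w"
      by (rule hv_lift_cases[OF x y \<xi>])
    have vw: "v = 0" "flat A g x w = 0"
      using P0 1 by (simp_all add: Psi_inv_hv_lift prod_eq_iff)
    \<comment> \<open>Scaling by 0 shows that the zero vector has zero covector; injectivity of
      \<open>flat\<close> then forces \<open>w = 0\<close>.\<close>
    have "flat A g x (0 *\<^sub>R w) = 0" using flat_linear(2)[OF 1(2), of 0] by simp
    then have "w = 0"
      using vw flat_inj[of w 0] 1(2) zero_in_tangent[OF sA] by simp
    then have "\<xi> = 0 *\<^sub>R hv (x, y) v w"
      using hv_lift_scaleR[OF x y 1(1,2), of 0] vw 1(3) by simp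
    then show "\<xi> = 0" by simp
  qed
qed

end

end

section \<open>Smoothness of the lifted structure in bundle charts\<close>

lemma linear_coord_endo:
  assumes c: "c \<in> charts_at A (chart_inv c u)"
  shows "linear (coord_endo A J c u)"
proof -
  have x: "chart_inv c u \<in> points A" using c unfolding points_charts_at by blast
  show ?thesis
    unfolding coord_endo_def
    by (rule linearI) (simp_all add: coord_vec_add[OF sA c] coord_vec_scaleR[OF sA c]
      endo_linear[OF x] coord_vec_in[OF sA c])
qed

lemma linear_coord_metric:
  assumes c: "c \<in> charts_at A (chart_inv c u)"
  shows "linear (coord_metric A g c u e)" "linear (\<lambda>e. coord_metric A g c u e e')"
proof -
  have x: "chart_inv c u \<in> points A" using c unfolding points_charts_at by blast
  show "linear (coord_metric A g c u e)" "linear (\<lambda>e. coord_metric A g c u e e')"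
    unfolding coord_metric_def
    by (rule linearI; simp add: coord_vec_add[OF sA c] coord_vec_scaleR[OF sA c]
      metric_linear[OF x] coord_vec_in[OF sA c])+
qed

context
  fixes c
  assumes c: "c \<in> A"
begin

abbreviation (input) "\<Omega> \<equiv> chart_map c ` chart_dom c \<times> (UNIV :: 'e set)"

lemma bundle_chart_image:
  "chart_map (tangent_chart A c) ` chart_dom (tangent_chart A c) = \<Omega>"
  using image_tangent_chart[OF sA order_refl c] by (simp add: chart_dom_tangent_chart[OF sA])

lemma open_bundle_chart: "open \<Omega>"
  by (intro open_Times open_chart_image[OF sA c] open_UNIV)

lemma bundle_chart_point:
  assumes "z \<in> \<Omega>"
  shows "chart_inv c (fst z) \<in> points A" "c \<in> charts_at A (chart_inv c (fst z))"
    "coord_vec A c (snd z) (chart_inv c (fst z)) \<in> tangent_space A (chart_inv c (fst z))"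
    "chart_inv (tangent_chart A c) z =
      (chart_inv c (fst z), coord_vec A c (snd z) (chart_inv c (fst z)))"
proof -
  have u: "fst z \<in> chart_map c ` chart_dom c" using assms by auto
  have "chart_inv c (fst z) \<in> chart_dom c" by (rule chart_inv_in[OF sA c u order_refl])
  then show ch: "c \<in> charts_at A (chart_inv c (fst z))" using c by (simp add: charts_at_def)
  then show "chart_inv c (fst z) \<in> points A" unfolding points_charts_at by blast
  show "coord_vec A c (snd z) (chart_inv c (fst z)) \<in> tangent_space A (chart_inv c (fst z))"
    by (rule coord_vec_in[OF sA ch])
  show "chart_inv (tangent_chart A c) z =
      (chart_inv c (fst z), coord_vec A c (snd z) (chart_inv c (fst z)))"
    using chart_inv_tangent_chart[OF sA c u, of "snd z"] by simp
qed

lemma smooth_on_bundle_base: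
  "smooth_on (chart_map c ` chart_dom c) f \<Longrightarrow> smooth_on \<Omega> (\<lambda>z. f (fst z))"
  by (rule smooth_on_compose[OF open_bundle_chart open_chart_image[OF sA c] _ _
      smooth_on_bounded_linear[OF bounded_linear_fst]]) auto

lemma smooth_on_coord_endo:
  assumes "smooth_on \<Omega> f" shows "smooth_on \<Omega> (\<lambda>z. coord_endo A J c (fst z) (f z))"
  by (rule smooth_on_linear_apply[OF open_bundle_chart, where L = "\<lambda>z. coord_endo A J c (fst z)"])
    (rule linear_coord_endo bundle_chart_point smooth_on_bundle_base endo_smooth c assms | assumption)+

text \<open>Bilinearity: the expansion of a varying argument in the basis is used once for each
  slot, which leaves the symbols at constant vectors.\<close>

lemma smooth_on_christoffel:
  assumes "smooth_on \<Omega> f" "smooth_on \<Omega> f'"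
  shows "smooth_on \<Omega> (\<lambda>z. christoffel A D c (chart_inv c (fst z)) (f z) (f' z))"
proof (rule smooth_on_linear_apply[OF open_bundle_chart,
      where L = "\<lambda>z e. christoffel A D c (chart_inv c (fst z)) e (f' z)", OF _ _ assms(1)])
  show "linear (\<lambda>e. christoffel A D c (chart_inv c (fst z)) e (f' z))" if "z \<in> \<Omega>" for z
    by (rule christoffel(2)[OF bundle_chart_point(2)[OF that]])
  show "smooth_on \<Omega> (\<lambda>z. christoffel A D c (chart_inv c (fst z)) b (f' z))" for b
  proof (rule smooth_on_linear_apply[OF open_bundle_chart,
        where L = "\<lambda>z. christoffel A D c (chart_inv c (fst z)) b", OF _ _ assms(2)])
    show "linear (christoffel A D c (chart_inv c (fst z)) b)" if "z \<in> \<Omega>" for z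
      by (rule christoffel(1)[OF bundle_chart_point(2)[OF that]])
    show "smooth_on \<Omega> (\<lambda>z. christoffel A D c (chart_inv c (fst z)) b b')" for b'
      by (rule smooth_on_bundle_base[OF smooth_christoffel[OF c]])
  qed
qed

lemma smooth_on_coord_metric:
  assumes "smooth_on \<Omega> f" "smooth_on \<Omega> f'"
  shows "smooth_on \<Omega> (\<lambda>z. coord_metric A g c (fst z) (f z) (f' z))"
proof (rule smooth_on_linear_apply[OF open_bundle_chart,
      where L = "\<lambda>z e. coord_metric A g c (fst z) e (f' z)", OF _ _ assms(1)])
  show "linear (\<lambda>e. coord_metric A g c (fst z) e (f' z))" if "z \<in> \<Omega>" for z
    by (rule linear_coord_metric(2)[OF bundle_chart_point(2)[OF that]])
  show "smooth_on \<Omega> (\<lambda>z. coord_metric A g c (fst z) b (f' z))" for b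
  proof (rule smooth_on_linear_apply[OF open_bundle_chart,
        where L = "\<lambda>z. coord_metric A g c (fst z) b", OF _ _ assms(2)])
    show "linear (coord_metric A g c (fst z) b)" if "z \<in> \<Omega>" for z
      by (rule linear_coord_metric(1)[OF bundle_chart_point(2)[OF that]])
    show "smooth_on \<Omega> (\<lambda>z. coord_metric A g c (fst z) b b')" for b'
      by (rule smooth_on_bundle_base[OF metric_smooth[OF c]])
  qed
qed

text \<open>The connector (connection map) in bundle coordinates: the vertical part of the
  coordinate vector with components \<open>e\<close> at \<open>z\<close>, while its horizontal part
  is simply \<open>fst e\<close>.\<close>

definition vert :: "'e \<times> 'e \<Rightarrow> 'e \<times> 'e \<Rightarrow> 'e"
  where "vert e z = snd e + christoffel A D c (chart_inv c (fst z)) (fst e) (snd z)"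

lemma smooth_on_vert: "smooth_on \<Omega> (vert e)"
  unfolding vert_def
  by (intro smooth_on_add[OF open_bundle_chart] smooth_on_christoffel smooth_on_const
      smooth_on_bounded_linear[OF bounded_linear_snd])

lemma coord_vec_hv_lift:
  assumes z: "z \<in> \<Omega>"
  defines "x \<equiv> chart_inv c (fst z)"
  shows "coord_vec (tangent_atlas A) (tangent_chart A c) e (chart_inv (tangent_chart A c) z) =
    hv (x, coord_vec A c (snd z) x) (coord_vec A c (fst e) x) (coord_vec A c (vert e z) x)"
proof -
  note pt = bundle_chart_point[OF z, folded x_def]
  note C = tangent_chart_at[OF sA pt(2,3)]
  show ?thesis
    unfolding pt(4)
    using hv_lift_coords[OF pt(1,3,2) coord_vec_in[OF sTA C], of e]
    by (simp add: coord_vec_apply[OF sTA C] coord_vec_apply[OF sA pt(2)] vert_def x_def[symmetric])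
qed

lemma smooth_on_bar_J:
  "smooth_on \<Omega> (\<lambda>z. let a = chart_inv (tangent_chart A c) z in
    BJ a (coord_vec (tangent_atlas A) (tangent_chart A c) e a) (tangent_chart A c))"
proof -
  note op = open_bundle_chart
  let ?j = "\<lambda>z. coord_endo A J c (fst z)"
  \<comment> \<open>\<open>V\<close> and \<open>W\<close> are the base-chart components of the
    horizontal and vertical parts in \<open>bar_J_hv_lift\<close>, taken at v = \<open>fst e\<close>
    and w = \<open>vert e z\<close>; returning to bundle components subtracts the Christoffel term
    from \<open>W\<close>.\<close>
  define V where "V z = ?j z (fst e) + (- ?j z (?j z (vert e z)) + p *\<^sub>R ?j z (vert e z) + q *\<^sub>R vert e z)" for z
  define W where "W z = fst e - ?j z (vert e z) + p *\<^sub>R vert e z" for z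
  have jw: "smooth_on \<Omega> (\<lambda>z. ?j z (vert e z))"
    by (rule smooth_on_coord_endo[OF smooth_on_vert])
  have neg: "smooth_on \<Omega> (\<lambda>z. - ?j z (?j z (vert e z)))"
    by (rule smooth_on_linear_compose[OF bounded_linear_minus[OF bounded_linear_ident] op
        smooth_on_coord_endo[OF jw]])
  have V: "smooth_on \<Omega> V"
    unfolding V_def
    by (intro smooth_on_add[OF op] smooth_on_scaleR[OF op] neg jw smooth_on_vert smooth_on_const
        smooth_on_coord_endo[OF smooth_on_const])
  have W: "smooth_on \<Omega> W"
    unfolding W_def
    by (intro smooth_on_add[OF op] smooth_on_scaleR[OF op] smooth_on_diff[OF op] jw smooth_on_vert
        smooth_on_const)
  have "smooth_on \<Omega> (\<lambda>z. (V z, W z - christoffel A D c (chart_inv c (fst z)) (V z) (snd z)))"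
    by (intro smooth_on_Pair[OF op] smooth_on_diff[OF op] smooth_on_christoffel V W
        smooth_on_bounded_linear[OF bounded_linear_snd])
  then show ?thesis
  proof (rule smooth_on_cong[OF op, rotated])
    fix z assume z: "z \<in> \<Omega>"
    define x where "x = chart_inv c (fst z)"
    note pt = bundle_chart_point[OF z, folded x_def]
    let ?k = "\<lambda>e. coord_vec A c e x"
    note k = coord_vec_in[OF sA pt(2)] and kc = coord_vec_apply[OF sA pt(2)]
    \<comment> \<open>Rewriting \<open>J\<close> of a coordinate vector as a coordinate vector turns
      nested applications of \<open>J\<close> into iterates of \<open>coord_endo\<close>.\<close>
    have J_k: "J x (?k e) = ?k (?j z e)" for e
      using tangent_space_coord_vec[OF sA pt(2) endo_in[OF pt(1) k]]
      by (simp add: coord_endo_def x_def)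
    show "(V z, W z - christoffel A D c (chart_inv c (fst z)) (V z) (snd z)) =
      (let a = chart_inv (tangent_chart A c) z in
        BJ a (coord_vec (tangent_atlas A) (tangent_chart A c) e a) (tangent_chart A c))"
      unfolding Let_def coord_vec_hv_lift[OF z]
      unfolding pt(4) x_def[symmetric]
        bar_J_hv_lift[OF pt(1,3) k k] J_k
      by (subst hv_lift_apply[OF pt(1,3,2)])
        (simp_all add: k kc tangent_closed[OF pt(1)] V_def W_def x_def[symmetric])
  qed
qed

lemma smooth_on_bar_g:
  "smooth_on \<Omega> (\<lambda>z. let a = chart_inv (tangent_chart A c) z in
    Bg a (coord_vec (tangent_atlas A) (tangent_chart A c) e a)
      (coord_vec (tangent_atlas A) (tangent_chart A c) e' a))"
proof -
  note op = open_bundle_chart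
  let ?j = "\<lambda>z. coord_endo A J c (fst z)" and ?m = "\<lambda>z. coord_metric A g c (fst z)"
  have "smooth_on \<Omega> (\<lambda>z. ?m z (fst e) (fst e') + (p\<^sup>2 + 4 * q) / 4 * ?m z (vert e z) (vert e' z)
      + p / 4 * (?m z (vert e z) (fst e') + ?m z (vert e' z) (fst e))
      - 1 / 2 * (?m z (vert e z) (?j z (fst e')) + ?m z (vert e' z) (?j z (fst e))))"
    by (intro smooth_on_add[OF op] smooth_on_mult[OF op] smooth_on_diff[OF op] smooth_on_const
        smooth_on_coord_metric smooth_on_vert smooth_on_coord_endo)
  then show ?thesis
  proof (rule smooth_on_cong[OF op, rotated])
    fix z assume z: "z \<in> \<Omega>"
    define x where "x = chart_inv c (fst z)"
    note pt = bundle_chart_point[OF z, folded x_def]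
    let ?k = "\<lambda>e. coord_vec A c e x"
    note k = coord_vec_in[OF sA pt(2)]
    have J_k: "J x (?k e) = ?k (?j z e)" for e
      using tangent_space_coord_vec[OF sA pt(2) endo_in[OF pt(1) k]]
      by (simp add: coord_endo_def x_def)
    show "?m z (fst e) (fst e') + (p\<^sup>2 + 4 * q) / 4 * ?m z (vert e z) (vert e' z)
      + p / 4 * (?m z (vert e z) (fst e') + ?m z (vert e' z) (fst e))
      - 1 / 2 * (?m z (vert e z) (?j z (fst e')) + ?m z (vert e' z) (?j z (fst e))) =
      (let a = chart_inv (tangent_chart A c) z in
        Bg a (coord_vec (tangent_atlas A) (tangent_chart A c) e a)
          (coord_vec (tangent_atlas A) (tangent_chart A c) e' a))"
      unfolding Let_def coord_vec_hv_lift[OF z]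
      unfolding pt(4) x_def[symmetric]
        bar_g_hv_lift[OF pt(1,3) k k k k] J_k
      by (simp add: coord_metric_def x_def[symmetric])
  qed
qed

end

lemma metallic_tangent_bundle: "metallic_pseudo_riemannian_manifold (tangent_atlas A) BJ Bg"
  unfolding metallic_pseudo_riemannian_manifold_def
proof (intro conjI)
  show "pseudo_riemannian_manifold (tangent_atlas A) Bg"
    unfolding pseudo_riemannian_manifold_def pseudo_riemannian_metric_def
  proof (intro conjI ballI allI)
    show "smooth_manifold (tangent_atlas A)" by (rule smooth_manifold_tangent_atlas[OF mA])
    show "scalar_product_on (tangent_space (tangent_atlas A) a) (Bg a)"
      if "a \<in> points (tangent_atlas A)" for a
      using that scalar_product_bar_g by (auto simp: points_tangent_atlas[OF sA])
    fix C e e' assume "C \<in> tangent_atlas A"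
    then obtain c where c: "c \<in> A" "C = tangent_chart A c" unfolding tangent_atlas_def by blast
    show "smooth_on (chart_map C ` chart_dom C) (\<lambda>z. let a = chart_inv C z in
        Bg a (coord_vec (tangent_atlas A) C e a) (coord_vec (tangent_atlas A) C e' a))"
      unfolding c(2) bundle_chart_image[OF c(1)] by (rule smooth_on_bar_g[OF c(1)])
  qed
  show "symmetric_endomorphism (tangent_atlas A) Bg BJ"
    unfolding symmetric_endomorphism_def tangent_endomorphism_def
  proof (intro conjI ballI allI)
    fix a assume a: "a \<in> points (tangent_atlas A)"
    then show "linear_map_on (tangent_space (tangent_atlas A) a) (BJ a)"
      using linear_bar_J by (auto simp: points_tangent_atlas[OF sA])
    show "BJ a ` tangent_space (tangent_atlas A) a \<subseteq> tangent_space (tangent_atlas A) a"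
      using a bar_J_in by (auto simp: points_tangent_atlas[OF sA])
    show "Bg a (BJ a \<xi>) \<eta> = Bg a \<xi> (BJ a \<eta>)"
      if "\<xi> \<in> tangent_space (tangent_atlas A) a" "\<eta> \<in> tangent_space (tangent_atlas A) a" for \<xi> \<eta>
      using a that symmetric_bar_J by (auto simp: points_tangent_atlas[OF sA])
  next
    fix C e assume "C \<in> tangent_atlas A"
    then obtain c where c: "c \<in> A" "C = tangent_chart A c" unfolding tangent_atlas_def by blast
    show "smooth_on (chart_map C ` chart_dom C) (\<lambda>z. let a = chart_inv C z in
        BJ a (coord_vec (tangent_atlas A) C e a) C)"
      unfolding c(2) bundle_chart_image[OF c(1)] by (rule smooth_on_bar_J[OF c(1)])
  qed
  have "BJ a (BJ a \<xi>) = p *\<^sub>R BJ a \<xi> + q *\<^sub>R \<xi>"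
    if "a \<in> points (tangent_atlas A)" "\<xi> \<in> tangent_space (tangent_atlas A) a" for a \<xi>
    using that metallic_bar_J by (auto simp: points_tangent_atlas[OF sA])
  then show "\<exists>p q. \<forall>a\<in>points (tangent_atlas A). \<forall>\<xi>\<in>tangent_space (tangent_atlas A) a.
      BJ a (BJ a \<xi>) = p *\<^sub>R BJ a \<xi> + q *\<^sub>R \<xi>"
    by blast
qed

end

theorem proposition7p1:
  fixes A :: "('m, 'e::euclidean_space) chart set"
    and g :: "'m \<Rightarrow> ('m, 'e) tvec \<Rightarrow> ('m, 'e) tvec \<Rightarrow> real"
    and D :: "('m \<Rightarrow> ('m, 'e) tvec) \<Rightarrow> ('m \<Rightarrow> ('m, 'e) tvec) \<Rightarrow> 'm \<Rightarrow> ('m, 'e) tvec"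
    and J :: "'m \<Rightarrow> ('m, 'e) tvec \<Rightarrow> ('m, 'e) tvec"
    and p q :: real
  assumes "pseudo_riemannian_manifold A g"
    and "linear_connection A D"
    and "symmetric_endomorphism A g J"
    and check_g_metric:
      "\<forall>x\<in>points A. scalar_product_on (generalized_tangent_space A x) (check_g A g J p q x)"
  shows "metallic_pseudo_riemannian_manifold (tangent_atlas A)
    (bar_J A g D J p q) (bar_g A g D J p q)"
proof -
  have "smooth_manifold A" "pseudo_riemannian_metric A g"
    using assms(1) by (simp_all add: pseudo_riemannian_manifold_def)
  then have "metallic_lift A D g J p q"
    using assms(2-4) by unfold_locales simp_all
  then show ?thesis by (rule metallic_lift.metallic_tangent_bundle)
qed

end
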